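(* The following congruences hold: \begin{align*} \sum_{n=0}^{\infty } N_{2}( 11 n+6)\, q^{n} &\equiv 3\, E(q)^{13} \pmod{11},\\ \sum_{n=0}^{\infty } N_{4}( 11 n+6)\, q^{n} &\equiv 7\, E(q)^{13} \pmod{11},\\ \sum_{n=0}^{\infty } N_{6}( 11 n+6)\, q^{n} &\equiv E(q)^{13} \left( 4+E_{4}(\tau) \right) \pmod{11},\\ \sum_{n=0}^{\infty } N_{8}( 11 n+6)\, q^{n} &\equiv E(q)^{13} \left( 5+6 E_{4}(\tau)+6 E_{6}(\tau) \right) \pmod{11},\\ \sum_{n=0}^{\infty } N_{10}( 11 n+6)\, q^{n} &\equiv E(q)^{13} \left( 5+4 E_{4}(\tau)+6 E_{6}(\tau)+6 E_{4}(\tau)^{2} \right) \pmod{11}. \end{align*}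
   Context: The rank of a partition is its largest part minus its number of parts. $N(m,n)$ denotes the number of partitions of $n$ with rank $m$, and for even $k$ the $k$-th rank moment is $N_k(n)=\sum_{m} m^k N(m,n)$, the sum being over all integers $m$. $E(q)=\prod_{n=1}^\infty (1-q^n)$. With $q=\exp(2\pi i\tau)$, $\Im\tau>0$, and $\sigma_j(n)=\sum_{d\mid n} d^j$, the Eisenstein series are $$E_4(\tau)=1+240\sum_{n=1}^\infty \sigma_3(n)q^n,\qquad E_6(\tau)=1-504\sum_{n=1}^\infty\sigma_5(n)q^n.$$ A congruence modulo $11$ between power series in $q$ with integer coefficients means that all corresponding coefficients are congruent modulo $11$. *)

theory Defs
  imports
    "HOL-Analysis.Analysis"
    "HOL-Number_Theory.Cong"
    "HOL-Library.Multiset"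
    "HOL-Library.Groups_Big_Fun"
    "HOL-Computational_Algebra.Formal_Power_Series"
begin

definition partitions :: "nat \<Rightarrow> nat multiset set" where
  "partitions n = {P. 0 \<notin># P \<and> sum_mset P = n}"

text \<open>The \<open>0\<close> inserted below only matters for the empty partition, whose rank becomes \<open>0\<close>.\<close>

definition partition_rank :: "nat multiset \<Rightarrow> int" where
  "partition_rank P = int (Max (insert 0 (set_mset P))) - int (size P)"

definition rank_count :: "int \<Rightarrow> nat \<Rightarrow> nat" where
  "rank_count m n = card {P \<in> partitions n. partition_rank P = m}"

text \<open>
  \<open>Sum_any\<close> sums over all integers \<open>m\<close> provided only finitely many summands are nonzero, and is
  \<open>0\<close> otherwise; the support is finite by \<open>finite_rank_count_support\<close> below.
\<close>

definition rank_moment :: "nat \<Rightarrow> nat \<Rightarrow> int" where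
  "rank_moment k n = Sum_any (\<lambda>m :: int. m ^ k * int (rank_count m n))"

text \<open>
  The infinite product is taken in the \<open>q\<close>-adic topology on formal power series; its convergence is
  \<open>convergent_prod_euler_E\<close> below.
\<close>

definition euler_E :: "int fps" where
  "euler_E = prodinf (\<lambda>n. 1 - fps_X ^ Suc n)"

definition divisor_sigma :: "nat \<Rightarrow> nat \<Rightarrow> nat" where
  "divisor_sigma j n = (\<Sum>d | d dvd n. d ^ j)"

text \<open>
  The Eisenstein series are represented by their expansions in \<open>q = exp (2 * pi * \<i> * \<tau>)\<close>, because
  congruences between \<open>q\<close>-series are congruences between coefficients.
\<close>

definition eisenstein_E4 :: "int fps" where
  "eisenstein_E4 = 1 + 240 * Abs_fps (\<lambda>n. if n = 0 then 0 else int (divisor_sigma 3 n))"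

definition eisenstein_E6 :: "int fps" where
  "eisenstein_E6 = 1 - 504 * Abs_fps (\<lambda>n. if n = 0 then 0 else int (divisor_sigma 5 n))"

definition fps_cong :: "int \<Rightarrow> int fps \<Rightarrow> int fps \<Rightarrow> bool" where
  "fps_cong m f g \<longleftrightarrow> (\<forall>n. [fps_nth f n = fps_nth g n] (mod m))"

lemma finite_partitions: "finite (partitions n)"
proof (rule finite_subset)
  show "finite (mset ` {xs. set xs \<subseteq> {..n} \<and> length xs \<le> n})"
    by (intro finite_imageI finite_lists_length_le) simp
  show "partitions n \<subseteq> mset ` {xs. set xs \<subseteq> {..n} \<and> length xs \<le> n}"
  proof
    fix P assume P: "P \<in> partitions n"
    obtain xs where xs: "P = mset xs"
      by (metis ex_mset)
    have "0 \<notin> set xs" and sum: "sum_list xs = n"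
      using P by (auto simp: partitions_def xs sum_mset_sum_list)
    then have "length xs \<le> sum_list xs"
      by (induction xs arbitrary: n) auto
    moreover have "set xs \<subseteq> {..n}"
      using sum member_le_sum_list by fastforce
    ultimately show "P \<in> mset ` {xs. set xs \<subseteq> {..n} \<and> length xs \<le> n}"
      using xs sum by auto
  qed
qed

lemma finite_rank_count_support: "finite {m. m ^ k * int (rank_count m n) \<noteq> 0}"
proof (rule finite_subset)
  show "finite (partition_rank ` partitions n)"
    by (intro finite_imageI finite_partitions)
  show "{m. m ^ k * int (rank_count m n) \<noteq> 0} \<subseteq> partition_rank ` partitions n"
  proof
    fix m assume "m \<in> {m. m ^ k * int (rank_count m n) \<noteq> 0}"
    then have "{P \<in> partitions n. partition_rank P = m} \<noteq> {}"
      by (metis (mono_tags) card.empty mem_Collect_eq mult_zero_right of_nat_0 rank_count_def)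
    then show "m \<in> partition_rank ` partitions n"
      by auto
  qed
qed

lemma convergent_prod_euler_E: "convergent_prod (\<lambda>n. 1 - fps_X ^ Suc n :: int fps)"
proof -
  define P :: "nat \<Rightarrow> int fps" where "P N = (\<Prod>n\<le>N. 1 - fps_X ^ Suc n)" for N
  define L where "L = Abs_fps (\<lambda>k. fps_nth (P k) k)"
  have step: "fps_nth (P (Suc N)) k = fps_nth (P N) k" if "k \<le> N" for k N
  proof -
    have "P (Suc N) = P N - P N * fps_X ^ Suc (Suc N)"
      by (simp add: P_def algebra_simps)
    then show ?thesis
      using that by (simp add: fps_X_power_mult_right_nth del: power_Suc)
  qed
  have stable: "fps_nth (P N) k = fps_nth L k" if "k \<le> N" for k N
    using that by (induction N rule: dec_induct) (simp_all add: step L_def)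
  have "P \<longlonglongrightarrow> L"
    by (rule tendsto_fpsI) (auto intro!: eventually_sequentiallyI stable)
  moreover have "fps_nth L 0 = 1"
    by (simp add: L_def P_def)
  then have "L \<noteq> 0"
    by auto
  ultimately have "raw_has_prod (\<lambda>n. 1 - fps_X ^ Suc n) 0 L"
    by (simp add: raw_has_prod_def P_def[abs_def] del: power_Suc)
  then show ?thesis
    unfolding convergent_prod_def by blast
qed

end

theory Submission
  imports Defs
begin

text \<open>Let P = 1/E be the generating function of partitions and D = q d/dq.

  Dyson's map yields a recursion for the number of partitions of rank at least m. Its solution is P
  times the sum over j >= 1 of (-1)^(j-1) q^(j(3j-1)/2 + mj), see \<open>rank_ge_series\<close>.
  Summation by parts then writes an even rank moment series as 2 P times a double sum
  \<open>weighted_appell\<close> with weight m^k - (m-1)^k (\<open>rank_moment_series\<close>).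
  Modulo 11, P equals E^32 / E(q^11)^3, so the coefficients with index 6 modulo 11 are governed by
  those of E^32 times the double sum. With x = m - 6 the weight is an odd polynomial in x modulo 11,
  and it is enough to treat the weights x^a for a = 3, 5, 7, 9, 11.

  The double sum is not modular; the bridge to modular objects is
  \<open>weighted_appell_cong\<close>. Let theta be the sum of (-1)^n z^n q^(n(n+1)/2), and let
  \<open>theta8\<close> be the coefficients of E^8 theta^8, with the exponent of z centred. Since
  theta vanishes at z = 1, the moments of order below 8 vanish; the eighth is 8! E^32 and the tenth
  a multiple of E^32 E2. The indicator of a class modulo 11 is a polynomial of degree 10, so the sum
  of \<open>theta8\<close> over a suitable class of exponents is 6 x^2 times a coefficient of E^32
  (\<open>theta8_residue_class\<close>). Trading the coefficients of E^32 for such sums and applying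
  the quasi-periodicity of theta makes the double sum telescope (\<open>alt_sum_telescope\<close>)
  to a sum of r^(a-2) i \<open>theta8\<close> (r + 11 i). Expanding powers of r + 11 i modulo 121
  identifies 11 times this sum with the difference of the moments of orders a - 1 and a + 9.

  These moments are E^32 times polynomials in E2, E4, E6 (\<open>theta_moment_quasimodular\<close>),
  by the heat equation for theta, Jacobi's series for E^3 and Ramanujan's differential equations.
  The latter come from counting solutions of a x + b y = n in two ways
  (\<open>bilin_reps_sum\<close>).

  Modulo 11 one has E4 E6 = 1, and every form in sight becomes a power of y = E6 times a polynomial
  in u = E4^5. An identity q^5 f = (q h)^11 + D H shows that h collects the coefficients of f with
  index 6 modulo 11, because D kills the indices divisible by 11 (\<open>class6_eqI\<close>).
  Explicit polynomials H settle each weight, and \<open>rank_moment_class6\<close> assembles the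
  results.\<close>

section \<open>Euler's product and its logarithmic derivative\<close>

definition qderiv :: "'a::comm_ring_1 fps \<Rightarrow> 'a fps" where
  "qderiv f = fps_X * fps_deriv f"

lemma qderiv_nth [simp]: "fps_nth (qderiv f) n = of_nat n * fps_nth f n"
  by (cases n) (simp_all add: qderiv_def)

lemma qderiv_add [simp]: "qderiv (f + g) = qderiv f + qderiv g"
  and qderiv_diff [simp]: "qderiv (f - g) = qderiv f - qderiv g"
  and qderiv_uminus [simp]: "qderiv (- f) = - qderiv f"
  and qderiv_mult: "qderiv (f * g) = qderiv f * g + f * qderiv g"
  and qderiv_of_int [simp]: "qderiv (of_int c) = 0"
  and qderiv_numeral [simp]: "qderiv (numeral w) = 0"
  and qderiv_0 [simp]: "qderiv 0 = 0"
  and qderiv_1 [simp]: "qderiv 1 = 0"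
  by (simp_all add: qderiv_def algebra_simps)

lemma qderiv_power: "qderiv (f ^ n) = of_nat n * f ^ (n - 1) * qderiv f"
  by (simp add: qderiv_def fps_deriv_power' mult_ac)

lemma qderiv_sum: "qderiv (sum f A) = (\<Sum>i\<in>A. qderiv (f i))"
  by (induction A rule: infinite_finite_induct) auto

definition euler_partial :: "nat \<Rightarrow> int fps" where
  "euler_partial N = (\<Prod>n<N. 1 - fps_X ^ Suc n)"

lemma euler_partial_Suc_nth: "k \<le> N \<Longrightarrow> fps_nth (euler_partial (Suc N)) k = fps_nth (euler_partial N) k"
  by (simp add: euler_partial_def algebra_simps fps_X_power_mult_nth flip: power_Suc)

lemma euler_partial_nth_stable:
  assumes "k \<le> N"
  shows "fps_nth (euler_partial N) k = fps_nth (euler_partial k) k"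
  using assms by (induction N rule: dec_induct) (auto simp: euler_partial_Suc_nth)

lemma euler_E_nth:
  assumes "k \<le> N"
  shows "fps_nth euler_E k = fps_nth (euler_partial N) k"
proof -
  let ?f = "\<lambda>n. 1 - fps_X ^ Suc n :: int fps"
  define L where "L = Abs_fps (\<lambda>k. fps_nth (euler_partial k) k)"
  have "(\<lambda>n. euler_partial (Suc n)) \<longlonglongrightarrow> L"
  proof (rule tendsto_fpsI)
    show "\<forall>\<^sub>F n in sequentially. fps_nth (euler_partial (Suc n)) k = fps_nth L k" for k
      by (rule eventually_sequentiallyI[of k]) (simp only: L_def fps_nth_Abs_fps, rule euler_partial_nth_stable, simp)
  qed
  then have lim: "(\<lambda>n. \<Prod>i\<le>n. ?f i) \<longlonglongrightarrow> L"
    by (simp only: euler_partial_def lessThan_Suc_atMost)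
  have "fps_nth L 0 = 1"
    by (simp add: L_def euler_partial_def)
  then have "L \<noteq> 0"
    by auto
  with lim have L: "raw_has_prod ?f 0 L"
    by (simp add: raw_has_prod_def)
  \<comment> \<open>\<open>has_prod\<close> also admits the value 0 caused by a vanishing factor.
    Every factor here has constant term 1, so only convergence of the partial products from index 0
    remains.\<close>
  have nz: "?f n \<noteq> 0" for n
  proof
    assume "?f n = 0"
    then have "fps_nth (?f n) 0 = 0"
      by (simp only: fps_zero_nth)
    then show False
      by simp
  qed
  have E: "euler_E = L"
    unfolding euler_E_def prodinf_def
  proof (rule the_equality)
    show "?f has_prod L"
      using L by (simp add: has_prod_def)
    fix p assume "?f has_prod p"
    then have "(\<lambda>n. \<Prod>i\<le>n. ?f i) \<longlonglongrightarrow> p"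
      using nz by (simp add: has_prod_def raw_has_prod_def)
    then show "p = L"
      using lim LIMSEQ_unique by blast
  qed
  show ?thesis
    by (simp only: E euler_partial_nth_stable[OF assms] L_def fps_nth_Abs_fps)
qed

lemma euler_E_0 [simp]: "fps_nth euler_E 0 = 1"
  using euler_E_nth[of 0 0] by (simp add: euler_partial_def)

definition sigma_series :: "nat \<Rightarrow> int fps" where
  "sigma_series j = Abs_fps (\<lambda>n. if n = 0 then 0 else int (divisor_sigma j n))"

lemma sigma_series_nth: "fps_nth (sigma_series j) n = (if n = 0 then 0 else (\<Sum>d | d dvd n. int d ^ j))"
  by (simp add: sigma_series_def divisor_sigma_def)

text \<open>The factor 1 - q^k contributes - k q^k / (1 - q^k) to the logarithmic derivative, and
  this geometric series has coefficient k at the positive multiples of k.\<close>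

lemma qderiv_euler_partial:
  "qderiv (euler_partial N) = - euler_partial N * (\<Sum>k\<in>{1..N}. Abs_fps (\<lambda>n. if n > 0 \<and> k dvd n then int k else 0))"
proof (induction N)
  case 0
  show ?case by (simp add: euler_partial_def)
next
  case (Suc N)
  define L :: "nat \<Rightarrow> int fps" where "L k = Abs_fps (\<lambda>n. if n > 0 \<and> k dvd n then int k else 0)" for k
  have L: "(1 - fps_X ^ k) * L k = of_nat k * fps_X ^ k" if "k > 0" for k
  proof (rule fps_ext)
    fix n
    have "(n > k \<longrightarrow> k dvd n - k \<longleftrightarrow> k dvd n)"
      by (meson dvd_diffD dvd_diff_nat dvd_refl less_imp_le)
    moreover have "k dvd n \<Longrightarrow> n < k \<Longrightarrow> n = 0"
      using dvd_imp_le by fastforce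
    ultimately show "fps_nth ((1 - fps_X ^ k) * L k) n = fps_nth (of_nat k * fps_X ^ k) n"
      using that by (auto simp: L_def left_diff_distrib fps_X_power_mult_nth not_less)
  qed
  have d: "qderiv (1 - fps_X ^ Suc N :: int fps) = - (of_nat (Suc N) * fps_X ^ Suc N)"
  proof (rule fps_ext)
    fix n
    show "fps_nth (qderiv (1 - fps_X ^ Suc N :: int fps)) n = fps_nth (- (of_nat (Suc N) * fps_X ^ Suc N)) n"
      by (simp only: qderiv_nth fps_neg_nth fps_sub_nth fps_one_nth fps_X_power_nth fps_mult_of_nat_nth) auto
  qed
  have "qderiv (euler_partial (Suc N)) = qderiv (euler_partial N) * (1 - fps_X ^ Suc N)
      + euler_partial N * qderiv (1 - fps_X ^ Suc N)"
    by (simp add: euler_partial_def qderiv_mult)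
  also have "qderiv (1 - fps_X ^ Suc N) = - ((1 - fps_X ^ Suc N) * L (Suc N))"
    unfolding d by (subst L) simp_all
  also have "qderiv (euler_partial N) = - euler_partial N * (\<Sum>k\<in>{1..N}. L k)"
    by (simp only: Suc.IH L_def)
  also have "- euler_partial N * (\<Sum>k\<in>{1..N}. L k) * (1 - fps_X ^ Suc N) +
      euler_partial N * - ((1 - fps_X ^ Suc N) * L (Suc N))
      = - (euler_partial N * (1 - fps_X ^ Suc N)) * ((\<Sum>k\<in>{1..N}. L k) + L (Suc N))"
    by algebra
  also have "\<dots> = - euler_partial (Suc N) * (\<Sum>k\<in>{1..Suc N}. L k)"
    by (simp add: euler_partial_def)
  finally show ?case
    by (simp only: L_def)
qed

text \<open>Coefficients up to index n see only the factors with k <= n. Collecting, for each index,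
  the k that divide it turns the sum of geometric series into divisor sums.\<close>

lemma qderiv_euler_E: "qderiv euler_E = - euler_E * sigma_series 1"
proof (rule fps_ext)
  fix n
  have s: "(\<Sum>k\<in>{1..n}. if m > 0 \<and> k dvd m then int k else 0) = fps_nth (sigma_series 1) m" if "m \<le> n" for m
  proof (cases "m = 0")
    case False
    have "k \<in> {1..n}" if "k dvd m" for k
      using False that \<open>m \<le> n\<close> dvd_imp_le[of k m] by (cases "k = 0") auto
    then have "{k\<in>{1..n}. k dvd m} = {k. k dvd m}"
      by blast
    moreover have "(\<Sum>k\<in>{1..n}. if m > 0 \<and> k dvd m then int k else 0) = sum int {k\<in>{1..n}. k dvd m}"
      using False by (subst sum.inter_filter[symmetric]) simp_all
    ultimately show ?thesis
      using False by (simp add: sigma_series_nth)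
  qed (simp add: sigma_series_nth)
  have "fps_nth (qderiv euler_E) n = fps_nth (qderiv (euler_partial n)) n"
    by (simp add: euler_E_nth)
  also have "\<dots> = - (\<Sum>i=0..n. fps_nth (euler_partial n) i * (\<Sum>k\<in>{1..n}. if n - i > 0 \<and> k dvd n - i then int k else 0))"
    by (simp only: qderiv_euler_partial) (simp add: fps_mult_nth fps_sum_nth)
  also have "\<dots> = - (\<Sum>i=0..n. fps_nth euler_E i * fps_nth (sigma_series 1) (n - i))"
    by (intro arg_cong[where f = uminus] sum.cong refl arg_cong2[where f = times] s)
       (auto simp: euler_E_nth[of _ n])
  also have "\<dots> = fps_nth (- euler_E * sigma_series 1) n"
    by (simp add: fps_mult_nth)
  finally show "fps_nth (qderiv euler_E) n = fps_nth (- euler_E * sigma_series 1) n" .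
qed

section \<open>Convolutions of divisor sums and Ramanujan's differential equations\<close>

definition bilin_reps :: "nat \<Rightarrow> (nat \<times> nat \<times> nat \<times> nat) set" where
  "bilin_reps n = {(a, b, x, y). 0 < a \<and> 0 < b \<and> 0 < x \<and> 0 < y \<and> a * x + b * y = n}"

lemma finite_bilin_reps [simp]: "finite (bilin_reps n)"
proof (rule finite_subset)
  show "bilin_reps n \<subseteq> {..n} \<times> {..n} \<times> {..n} \<times> {..n}"
  proof
    fix p assume "p \<in> bilin_reps n"
    then obtain a b x y where p: "p = (a, b, x, y)" "0 < a" "0 < b" "0 < x" "0 < y" "a * x + b * y = n"
      by (auto simp: bilin_reps_def)
    then have "a \<le> a * x" "b \<le> b * y" "x \<le> a * x" "y \<le> b * y"
      by auto
    then show "p \<in> {..n} \<times> {..n} \<times> {..n} \<times> {..n}"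
      by (auto simp: p(1) p(6)[symmetric] intro: trans_le_add1 trans_le_add2)
  qed
qed simp

text \<open>A divisor a of k amounts to a factorization k = a x, so the Cauchy product of two
  divisor sums becomes a single sum over solutions of a x + b y = n.\<close>

lemma sigma_series_mult_nth:
  "fps_nth (sigma_series i * sigma_series j) n = (\<Sum>(a, b, x, y)\<in>bilin_reps n. int a ^ i * int b ^ j)"
proof -
  define A where "A = (SIGMA k:{k\<in>{0..n}. k > 0 \<and> n - k > 0}. {a. a dvd k} \<times> {b. b dvd n - k})"
  have fin: "finite {a. a dvd k}" if "k > 0" for k :: nat
    using that by (simp add: finite_divisors_nat)
  have "fps_nth (sigma_series i * sigma_series j) n
      = (\<Sum>k\<in>{k\<in>{0..n}. k > 0 \<and> n - k > 0}. fps_nth (sigma_series i) k * fps_nth (sigma_series j) (n - k))"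
    by (simp only: fps_mult_nth) (rule sum.mono_neutral_right, auto simp: sigma_series_nth)
  also have "\<dots> = (\<Sum>k\<in>{k\<in>{0..n}. k > 0 \<and> n - k > 0}. \<Sum>(a, b)\<in>{a. a dvd k} \<times> {b. b dvd n - k}. int a ^ i * int b ^ j)"
    by (rule sum.cong) (simp_all add: sigma_series_nth sum_product sum.cartesian_product)
  also have "\<dots> = (\<Sum>(k, a, b)\<in>A. int a ^ i * int b ^ j)"
    unfolding A_def by (subst sum.Sigma) (auto simp: fin)
  also have "\<dots> = (\<Sum>(a, b, x, y)\<in>bilin_reps n. int a ^ i * int b ^ j)"
    by (rule sum.reindex_bij_witness[where i = "\<lambda>(a, b, x, y). (a * x, a, b)"
          and j = "\<lambda>(k, a, b). (a, b, k div a, (n - k) div b)"])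
       (auto simp: A_def bilin_reps_def simp: dvd_div_eq_0_iff intro!: gr0I)
  finally show ?thesis .
qed

text \<open>Splitting the solutions of \<open>a x + b y = n\<close> by comparing \<open>a\<close> with \<open>b\<close>, resp. \<open>x\<close> with \<open>y\<close>,
  the map \<open>(a, b, x, y) \<mapsto> (a + b, b, x, y - x)\<close> matches the parts \<open>x < y\<close> and \<open>b < a\<close>; only the
  diagonals survive.\<close>

lemma bilin_reps_sum:
  fixes q :: "int \<Rightarrow> int \<Rightarrow> int"
  assumes sym: "\<And>a b. q a b = q b a" and refl: "\<And>c b. q c b = q c (c - b)" and n: "n > 0"
  shows "(\<Sum>(a, b, x, y)\<in>bilin_reps n. q (int a) (int b) - q (int a + int b) (int b)) =
    (\<Sum>d | d dvd n. (int (n div d) - 1) * q (int d) (int d) - (\<Sum>b\<in>{1..<d}. q (int d) (int b)))"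
proof -
  let ?S = "bilin_reps n"
  define f g :: "nat \<times> nat \<times> nat \<times> nat \<Rightarrow> int"
    where "f = (\<lambda>(a, b, x, y). q (int a) (int b))" and "g = (\<lambda>(a, b, x, y). q (int a + int b) (int b))"
  have fsplit: "sum f ?S = sum f {(a,b,x,y)\<in>?S. a > b} + sum f {(a,b,x,y)\<in>?S. a < b} + sum f {(a,b,x,y)\<in>?S. a = b}"
    by (subst sum.union_disjoint[symmetric], auto intro: finite_subset[OF _ finite_bilin_reps])+
       (auto intro!: sum.cong)
  have gsplit: "sum g ?S = sum g {(a,b,x,y)\<in>?S. x < y} + sum g {(a,b,x,y)\<in>?S. x > y} + sum g {(a,b,x,y)\<in>?S. x = y}"
    by (subst sum.union_disjoint[symmetric], auto intro: finite_subset[OF _ finite_bilin_reps])+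
       (auto intro!: sum.cong)
  have fswap: "sum f {(a,b,x,y)\<in>?S. a < b} = sum f {(a,b,x,y)\<in>?S. a > b}"
    by (rule sum.reindex_bij_witness[where i = "\<lambda>(a,b,x,y). (b,a,y,x)" and j = "\<lambda>(a,b,x,y). (b,a,y,x)"])
       (auto simp: f_def bilin_reps_def sym)
  have "q (a + b) a = q (a + b) b" for a b
    using refl[of "a + b" a] by simp
  then have gswap: "sum g {(a,b,x,y)\<in>?S. x > y} = sum g {(a,b,x,y)\<in>?S. x < y}"
    by (intro sum.reindex_bij_witness[where i = "\<lambda>(a,b,x,y). (b,a,y,x)" and j = "\<lambda>(a,b,x,y). (b,a,y,x)"])
       (auto simp: g_def bilin_reps_def add.commute)
  have fg: "sum g {(a,b,x,y)\<in>?S. x < y} = sum f {(a,b,x,y)\<in>?S. a > b}"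
    by (rule sum.reindex_bij_witness[where i = "\<lambda>(a,b,x,y). (a-b,b,x,x+y)" and j = "\<lambda>(a,b,x,y). (a+b,b,x,y-x)"])
       (auto simp: f_def g_def bilin_reps_def algebra_simps diff_mult_distrib diff_mult_distrib2
         intro!: le_add_diff_inverse trans_le_add1 mult_le_mono1)
  have pos: "d > 0" if "d dvd n" for d
    using that n by (rule dvd_pos_nat[rotated])
  have fin: "finite {d. d dvd n}"
    using n by simp
  \<comment> \<open>For a = b = d the equation reads d (x + y) = n, so d divides n and x takes n/d -
    1 values.\<close>
  have "sum f {(a,b,x,y)\<in>?S. a = b} = (\<Sum>(d, x)\<in>(SIGMA d:{d. d dvd n}. {1..<n div d}). q (int d) (int d))"
    by (rule sum.reindex_bij_witness[where i = "\<lambda>(d, x). (d, d, x, n div d - x)" and j = "\<lambda>(a,b,x,y). (a, x)"])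
       (auto simp: f_def bilin_reps_def pos simp flip: distrib_left)
  also have "\<dots> = (\<Sum>d | d dvd n. \<Sum>x\<in>{1..<n div d}. q (int d) (int d))"
    using fin by (subst sum.Sigma) auto
  also have "\<dots> = (\<Sum>d | d dvd n. (int (n div d) - 1) * q (int d) (int d))"
  proof (rule sum.cong)
    fix d assume "d \<in> {d. d dvd n}"
    then have "n div d > 0"
      using n pos by (auto simp: div_greater_zero_iff dvd_imp_le)
    then show "(\<Sum>x\<in>{1..<n div d}. q (int d) (int d)) = (int (n div d) - 1) * q (int d) (int d)"
      by (simp add: of_nat_diff)
  qed simp
  finally have fdiag: "sum f {(a,b,x,y)\<in>?S. a = b} = (\<Sum>d | d dvd n. (int (n div d) - 1) * q (int d) (int d))" .
  \<comment> \<open>For x = y the number d = a + b divides n, and b runs through the positive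
    integers below d.\<close>
  have "sum g {(a,b,x,y)\<in>?S. x = y} = (\<Sum>(d, b)\<in>(SIGMA d:{d. d dvd n}. {1..<d}). q (int d) (int b))"
    by (rule sum.reindex_bij_witness[where i = "\<lambda>(d, b). (d - b, b, n div d, n div d)" and j = "\<lambda>(a,b,x,y). (a + b, b)"])
       (auto simp: g_def bilin_reps_def pos simp flip: distrib_right)
  also have "\<dots> = (\<Sum>d | d dvd n. \<Sum>b\<in>{1..<d}. q (int d) (int b))"
    using fin by (subst sum.Sigma) auto
  finally have gdiag: "sum g {(a,b,x,y)\<in>?S. x = y} = \<dots>" .
  have "sum f ?S - sum g ?S = (\<Sum>d | d dvd n. (int (n div d) - 1) * q (int d) (int d)) - (\<Sum>d | d dvd n. \<Sum>b\<in>{1..<d}. q (int d) (int b))"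
    unfolding fsplit gsplit fswap gswap fg fdiag gdiag by simp
  then show ?thesis
    by (simp add: f_def g_def sum_subtractf case_prod_unfold)
qed

text \<open>Faulhaber's formulas with cleared denominators. They evaluate the sums of q(d, b) over b
  < d left by \<open>bilin_reps_sum\<close>.\<close>

lemma sum_power_below:
  fixes d :: nat
  shows "2 * (\<Sum>b\<in>{1..<d}. int b) = int d ^ 2 - int d"
    and "6 * (\<Sum>b\<in>{1..<d}. int b ^ 2) = 2 * int d ^ 3 - 3 * int d ^ 2 + int d"
    and "4 * (\<Sum>b\<in>{1..<d}. int b ^ 3) = int d ^ 4 - 2 * int d ^ 3 + int d ^ 2"
    and "30 * (\<Sum>b\<in>{1..<d}. int b ^ 4) = 6 * int d ^ 5 - 15 * int d ^ 4 + 10 * int d ^ 3 - int d"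
    and "12 * (\<Sum>b\<in>{1..<d}. int b ^ 5) = 2 * int d ^ 6 - 6 * int d ^ 5 + 5 * int d ^ 4 - int d ^ 2"
    and "42 * (\<Sum>b\<in>{1..<d}. int b ^ 6) = 6 * int d ^ 7 - 21 * int d ^ 6 + 21 * int d ^ 5 - 7 * int d ^ 3 + int d"
proof (induction d)
  case (Suc d)
  have *: "{1..<Suc d} = (if d = 0 then {} else insert d {1..<d})"
    by auto
  { case 1 show ?case using Suc.IH(1) by (auto simp: * algebra_simps power2_eq_square) }
  { case 2 show ?case using Suc.IH(2) by (auto simp: * algebra_simps eval_nat_numeral) }
  { case 3 show ?case using Suc.IH(3) by (auto simp: * algebra_simps eval_nat_numeral) }
  { case 4 show ?case using Suc.IH(4) by (auto simp: * algebra_simps eval_nat_numeral) }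
  { case 5 show ?case using Suc.IH(5) by (auto simp: * algebra_simps eval_nat_numeral) }
  { case 6 show ?case using Suc.IH(6) by (auto simp: * algebra_simps eval_nat_numeral) }
qed auto


lemma qderiv_sigma_series_nth:
  "fps_nth (qderiv (sigma_series j)) n = (if n = 0 then 0 else (\<Sum>d | d dvd n. int (n div d) * int d ^ Suc j))"
  by (auto simp: sigma_series_nth sum_distrib_left mult_ac intro!: sum.cong simp flip: of_nat_mult mult.assoc)

text \<open>The form q = a^2 - a b + b^2 has both symmetries demanded by
  \<open>bilin_reps_sum\<close>, and q(a, b) - q(a + b, b) = - 2 a b.\<close>

lemma sigma_series_1_1: "12 * sigma_series 1 ^ 2 = 5 * sigma_series 3 + sigma_series 1 - 6 * qderiv (sigma_series 1)"
proof (rule fps_ext)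
  fix n
  define q :: "int \<Rightarrow> int \<Rightarrow> int" where "q a b = a\<^sup>2 - a * b + b\<^sup>2" for a b
  have below: "6 * (\<Sum>b\<in>{1..<d}. q (int d) (int b)) = 5 * int d ^ 3 - 6 * int d ^ 2 + int d" for d
  proof (cases "d = 0")
    case False
    have "6 * (\<Sum>b\<in>{1..<d}. q (int d) (int b)) = 6 * int d ^ 2 * (\<Sum>b\<in>{1..<d}. 1)
        - 3 * int d * (2 * (\<Sum>b\<in>{1..<d}. int b)) + 6 * (\<Sum>b\<in>{1..<d}. int b ^ 2)"
      by (simp add: q_def sum.distrib sum_subtractf sum_distrib_left algebra_simps)
    also have "\<dots> = 5 * int d ^ 3 - 6 * int d ^ 2 + int d"
      unfolding sum_power_below using False by (simp add: of_nat_diff algebra_simps eval_nat_numeral)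
    finally show ?thesis .
  qed simp
  show "fps_nth (12 * sigma_series 1 ^ 2) n = fps_nth (5 * sigma_series 3 + sigma_series 1 - 6 * qderiv (sigma_series 1)) n"
  proof (cases "n = 0")
    case False
    have "12 * fps_nth (sigma_series 1 * sigma_series 1) n = - 6 * (\<Sum>(a, b, x, y)\<in>bilin_reps n. q (int a) (int b) - q (int a + int b) (int b))"
      unfolding sigma_series_mult_nth
      by (simp add: sum_distrib_left case_prod_unfold q_def algebra_simps power2_eq_square)
    also have "\<dots> = (\<Sum>d | d dvd n. 6 * (\<Sum>b\<in>{1..<d}. q (int d) (int b)) - 6 * (int (n div d) - 1) * q (int d) (int d))"
      by (subst bilin_reps_sum) (use False in \<open>auto simp: q_def sum_distrib_left algebra_simps power2_eq_square sum_negf[symmetric] simp del: sum_negf intro!: sum.cong\<close>)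
    also have "\<dots> = (\<Sum>d | d dvd n. 5 * int d ^ 3 + int d ^ 1 - 6 * (int (n div d) * int d ^ Suc 1))"
      unfolding below by (rule sum.cong) (simp_all add: q_def algebra_simps power2_eq_square)
    also have "\<dots> = fps_nth (5 * sigma_series 3 + sigma_series 1 - 6 * qderiv (sigma_series 1)) n"
      using False by (simp add: sigma_series_nth qderiv_sigma_series_nth sum.distrib sum_subtractf sum_distrib_left del: qderiv_nth)
    finally show ?thesis
      by (simp add: power2_eq_square numeral_fps_const)
  qed (simp add: sigma_series_nth fps_mult_nth numeral_fps_const power2_eq_square)
qed


text \<open>For the square of the form a^2 - a b + b^2 the difference q(a, b) - q(a + b, b) is - 4 a
  b (a^2 + b^2).\<close>

lemma sigma_series_1_3: "240 * (sigma_series 1 * sigma_series 3) = 21 * sigma_series 5 + 10 * sigma_series 3 - sigma_series 1 - 30 * qderiv (sigma_series 3)"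
proof (rule fps_ext)
  fix n
  define q :: "int \<Rightarrow> int \<Rightarrow> int" where "q a b = (a\<^sup>2 - a * b + b\<^sup>2) ^ 2" for a b
  have below: "30 * (\<Sum>b\<in>{1..<d}. q (int d) (int b)) = 21 * int d ^ 5 - 30 * int d ^ 4 + 10 * int d ^ 3 - int d" for d
  proof (cases "d = 0")
    case False
    have "30 * (\<Sum>b\<in>{1..<d}. q (int d) (int b)) = 30 * int d ^ 4 * (\<Sum>b\<in>{1..<d}. 1) - 30 * int d ^ 3 * (2 * (\<Sum>b\<in>{1..<d}. int b)) + 15 * int d ^ 2 * (6 * (\<Sum>b\<in>{1..<d}. int b ^ 2)) - 15 * int d * (4 * (\<Sum>b\<in>{1..<d}. int b ^ 3)) + 30 * (\<Sum>b\<in>{1..<d}. int b ^ 4)"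
      by (simp add: q_def sum.distrib sum_subtractf sum_distrib_left algebra_simps eval_nat_numeral)
    also have "\<dots> = 21 * int d ^ 5 - 30 * int d ^ 4 + 10 * int d ^ 3 - int d"
      unfolding sum_power_below using False by (simp add: of_nat_diff algebra_simps eval_nat_numeral)
    finally show ?thesis .
  qed simp
  show "fps_nth (240 * (sigma_series 1 * sigma_series 3)) n = fps_nth (21 * sigma_series 5 + 10 * sigma_series 3 - sigma_series 1 - 30 * qderiv (sigma_series 3)) n"
  proof (cases "n = 0")
    case False
    \<comment> \<open>The difference contains a b^3 and a^3 b symmetrically, so the product is split
      into two halves with the factors in both orders.\<close>
    have *: "240 * fps_nth (sigma_series 1 * sigma_series 3) n = 120 * fps_nth (sigma_series 1 * sigma_series 3) n + 120 * fps_nth (sigma_series 3 * sigma_series 1) n"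
      by (simp add: mult.commute)
    have "240 * fps_nth (sigma_series 1 * sigma_series 3) n = - 30 * (\<Sum>(a, b, x, y)\<in>bilin_reps n. q (int a) (int b) - q (int a + int b) (int b))"
      unfolding * unfolding sigma_series_mult_nth
      by (simp add: sum_distrib_left sum.distrib[symmetric] case_prod_unfold q_def algebra_simps eval_nat_numeral)
    also have "\<dots> = (\<Sum>d | d dvd n. 30 * (\<Sum>b\<in>{1..<d}. q (int d) (int b)) - 30 * (int (n div d) - 1) * q (int d) (int d))"
      by (subst bilin_reps_sum) (use False in \<open>auto simp: q_def sum_distrib_left algebra_simps eval_nat_numeral sum_negf[symmetric] simp del: sum_negf intro!: sum.cong\<close>)
    also have "\<dots> = (\<Sum>d | d dvd n. 21 * int d ^ 5 + 10 * int d ^ 3 - int d ^ 1 - 30 * (int (n div d) * int d ^ Suc 3))"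
      by (rule sum.cong) (use below in \<open>simp_all add: q_def algebra_simps eval_nat_numeral\<close>)
    also have "\<dots> = fps_nth (21 * sigma_series 5 + 10 * sigma_series 3 - sigma_series 1 - 30 * qderiv (sigma_series 3)) n"
      using False by (simp add: sigma_series_nth qderiv_sigma_series_nth sum.distrib sum_subtractf sum_distrib_left del: qderiv_nth)
    finally show ?thesis
      by (simp add: power2_eq_square numeral_fps_const)
  qed (simp add: sigma_series_nth fps_mult_nth numeral_fps_const power2_eq_square)
qed

text \<open>The second invariant, (a b (a - b))^2, gives the difference - 4 a^3 b^3; as it vanishes
  for a = b, no derivative term appears.\<close>

lemma sigma_series_3_3: "120 * sigma_series 3 ^ 2 = sigma_series 7 - sigma_series 3"
proof (rule fps_ext)
  fix n
  define q :: "int \<Rightarrow> int \<Rightarrow> int" where "q a b = (a * b * (a - b))\<^sup>2" for a b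
  have below: "30 * (\<Sum>b\<in>{1..<d}. q (int d) (int b)) = int d ^ 7 - int d ^ 3" for d
  proof (cases "d = 0")
    case False
    have "30 * (\<Sum>b\<in>{1..<d}. q (int d) (int b)) = 5 * int d ^ 4 * (6 * (\<Sum>b\<in>{1..<d}. int b ^ 2)) - 15 * int d ^ 3 * (4 * (\<Sum>b\<in>{1..<d}. int b ^ 3)) + int d ^ 2 * (30 * (\<Sum>b\<in>{1..<d}. int b ^ 4))"
      by (simp add: q_def sum.distrib sum_subtractf sum_distrib_left algebra_simps eval_nat_numeral)
    also have "\<dots> = int d ^ 7 - int d ^ 3"
      unfolding sum_power_below using False by (simp add: of_nat_diff algebra_simps eval_nat_numeral)
    finally show ?thesis .
  qed simp
  show "fps_nth (120 * sigma_series 3 ^ 2) n = fps_nth (sigma_series 7 - sigma_series 3) n"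
  proof (cases "n = 0")
    case False
    have "120 * fps_nth (sigma_series 3 * sigma_series 3) n = - 30 * (\<Sum>(a, b, x, y)\<in>bilin_reps n. q (int a) (int b) - q (int a + int b) (int b))"
      unfolding sigma_series_mult_nth
      by (simp add: sum_distrib_left sum.distrib[symmetric] case_prod_unfold q_def algebra_simps eval_nat_numeral)
    also have "\<dots> = (\<Sum>d | d dvd n. 30 * (\<Sum>b\<in>{1..<d}. q (int d) (int b)) - 30 * (int (n div d) - 1) * q (int d) (int d))"
      by (subst bilin_reps_sum) (use False in \<open>auto simp: q_def sum_distrib_left algebra_simps eval_nat_numeral sum_negf[symmetric] simp del: sum_negf intro!: sum.cong\<close>)
    also have "\<dots> = (\<Sum>d | d dvd n. int d ^ 7 - int d ^ 3)"
      by (rule sum.cong) (use below in \<open>simp_all add: q_def algebra_simps eval_nat_numeral\<close>)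
    also have "\<dots> = fps_nth (sigma_series 7 - sigma_series 3) n"
      using False by (simp add: sigma_series_nth qderiv_sigma_series_nth sum.distrib sum_subtractf sum_distrib_left del: qderiv_nth)
    finally show ?thesis
      by (simp add: power2_eq_square numeral_fps_const)
  qed (simp add: sigma_series_nth fps_mult_nth numeral_fps_const power2_eq_square)
qed

text \<open>The cube of a^2 - a b + b^2 gives the difference - 6 (a^5 b + a b^5) - 14 a^3 b^3, hence
  a mixture of two convolutions.\<close>

lemma sigma_series_1_5_3_3: "5040 * (sigma_series 1 * sigma_series 5) + 5880 * sigma_series 3 ^ 2 = 249 * sigma_series 7 + 210 * sigma_series 5 - 49 * sigma_series 3 + 10 * sigma_series 1 - 420 * qderiv (sigma_series 5)"
proof (rule fps_ext)
  fix n
  define q :: "int \<Rightarrow> int \<Rightarrow> int" where "q a b = (a\<^sup>2 - a * b + b\<^sup>2) ^ 3" for a b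
  have below: "420 * (\<Sum>b\<in>{1..<d}. q (int d) (int b)) = 249 * int d ^ 7 - 420 * int d ^ 6 + 210 * int d ^ 5 - 49 * int d ^ 3 + 10 * int d" for d
  proof (cases "d = 0")
    case False
    have "420 * (\<Sum>b\<in>{1..<d}. q (int d) (int b)) = 420 * int d ^ 6 * (\<Sum>b\<in>{1..<d}. 1) - 630 * int d ^ 5 * (2 * (\<Sum>b\<in>{1..<d}. int b)) + 420 * int d ^ 4 * (6 * (\<Sum>b\<in>{1..<d}. int b ^ 2)) - 735 * int d ^ 3 * (4 * (\<Sum>b\<in>{1..<d}. int b ^ 3)) + 84 * int d ^ 2 * (30 * (\<Sum>b\<in>{1..<d}. int b ^ 4)) - 105 * int d * (12 * (\<Sum>b\<in>{1..<d}. int b ^ 5)) + 10 * (42 * (\<Sum>b\<in>{1..<d}. int b ^ 6))"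
      by (simp add: q_def sum.distrib sum_subtractf sum_distrib_left algebra_simps eval_nat_numeral)
    also have "\<dots> = 249 * int d ^ 7 - 420 * int d ^ 6 + 210 * int d ^ 5 - 49 * int d ^ 3 + 10 * int d"
      unfolding sum_power_below using False by (simp add: of_nat_diff algebra_simps eval_nat_numeral)
    finally show ?thesis .
  qed simp
  show "fps_nth (5040 * (sigma_series 1 * sigma_series 5) + 5880 * sigma_series 3 ^ 2) n = fps_nth (249 * sigma_series 7 + 210 * sigma_series 5 - 49 * sigma_series 3 + 10 * sigma_series 1 - 420 * qderiv (sigma_series 5)) n"
  proof (cases "n = 0")
    case False
    have *: "5040 * fps_nth (sigma_series 1 * sigma_series 5) n = 2520 * fps_nth (sigma_series 1 * sigma_series 5) n + 2520 * fps_nth (sigma_series 5 * sigma_series 1) n"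
      by (simp add: mult.commute)
    have "5040 * fps_nth (sigma_series 1 * sigma_series 5) n + 5880 * fps_nth (sigma_series 3 * sigma_series 3) n = - 420 * (\<Sum>(a, b, x, y)\<in>bilin_reps n. q (int a) (int b) - q (int a + int b) (int b))"
      unfolding * unfolding sigma_series_mult_nth
      by (simp add: sum_distrib_left sum.distrib[symmetric] case_prod_unfold q_def algebra_simps eval_nat_numeral)
    also have "\<dots> = (\<Sum>d | d dvd n. 420 * (\<Sum>b\<in>{1..<d}. q (int d) (int b)) - 420 * (int (n div d) - 1) * q (int d) (int d))"
      by (subst bilin_reps_sum) (use False in \<open>auto simp: q_def sum_distrib_left algebra_simps eval_nat_numeral sum_negf[symmetric] simp del: sum_negf intro!: sum.cong\<close>)
    also have "\<dots> = (\<Sum>d | d dvd n. 249 * int d ^ 7 + 210 * int d ^ 5 - 49 * int d ^ 3 + 10 * int d ^ 1 - 420 * (int (n div d) * int d ^ Suc 5))"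
      by (rule sum.cong) (use below in \<open>simp_all add: q_def algebra_simps eval_nat_numeral\<close>)
    also have "\<dots> = fps_nth (249 * sigma_series 7 + 210 * sigma_series 5 - 49 * sigma_series 3 + 10 * sigma_series 1 - 420 * qderiv (sigma_series 5)) n"
      using False by (simp add: sigma_series_nth qderiv_sigma_series_nth sum.distrib sum_subtractf sum_distrib_left del: qderiv_nth)
    finally show ?thesis
      by (simp add: power2_eq_square numeral_fps_const)
  qed (simp add: sigma_series_nth fps_mult_nth numeral_fps_const power2_eq_square)
qed

definition eisenstein_E2 :: "int fps" where
  "eisenstein_E2 = 1 - 24 * sigma_series 1"

lemma eisenstein_eq:
  "eisenstein_E4 = 1 + 240 * sigma_series 3" "eisenstein_E6 = 1 - 504 * sigma_series 5"
  by (simp_all add: eisenstein_E4_def eisenstein_E6_def sigma_series_def)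

lemma eisenstein_nth_0 [simp]:
  "fps_nth eisenstein_E2 0 = 1" "fps_nth eisenstein_E4 0 = 1" "fps_nth eisenstein_E6 0 = 1"
  by (simp_all add: eisenstein_eq eisenstein_E2_def sigma_series_nth numeral_fps_const)

lemma qderiv_euler_E': "24 * qderiv euler_E = (eisenstein_E2 - 1) * euler_E"
  by (simp add: qderiv_euler_E eisenstein_E2_def algebra_simps)

lemma ramanujan_E2: "12 * qderiv eisenstein_E2 = eisenstein_E2 ^ 2 - eisenstein_E4"
  using sigma_series_1_1 unfolding eisenstein_eq eisenstein_E2_def
  by (simp add: qderiv_mult) algebra

lemma ramanujan_E4: "3 * qderiv eisenstein_E4 = eisenstein_E2 * eisenstein_E4 - eisenstein_E6"
  using sigma_series_1_3 unfolding eisenstein_eq eisenstein_E2_def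
  by (simp add: qderiv_mult) algebra

text \<open>\<open>sigma_series_3_3\<close> eliminates sigma_7 from the mixed identity of weight 8;
  what results is the claim multiplied by 10.\<close>

lemma ramanujan_E6: "2 * qderiv eisenstein_E6 = eisenstein_E2 * eisenstein_E6 - eisenstein_E4 ^ 2"
proof -
  have "10 * (2 * qderiv eisenstein_E6) = 10 * (eisenstein_E2 * eisenstein_E6 - eisenstein_E4 ^ 2)"
    using sigma_series_1_5_3_3 sigma_series_3_3 unfolding eisenstein_eq eisenstein_E2_def
    by (simp add: qderiv_mult) algebra
  then show ?thesis
    by (simp only: mult_cancel_left) simp
qed

section \<open>Gaussian binomials and Jacobi's series for the cube of Euler's product\<close>

text \<open>The q-Pascal rule serves as definition, so that no division of power series
  occurs.\<close>

fun gauss_binomial :: "nat \<Rightarrow> nat \<Rightarrow> int fps" where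
  "gauss_binomial n 0 = 1"
| "gauss_binomial 0 (Suc k) = 0"
| "gauss_binomial (Suc n) (Suc k) = gauss_binomial n k + fps_X ^ Suc k * gauss_binomial n (Suc k)"

lemma gauss_binomial_eq_0: "n < k \<Longrightarrow> gauss_binomial n k = 0"
  by (induction n k rule: gauss_binomial.induct) auto

text \<open>Split off the factor with i = 0 and replace x by q x in the others. The form homogeneous
  in x and y allows a power of q to be substituted for y later.\<close>

lemma gauss_binomial_theorem:
  fixes x y :: "int fps poly"
  shows "(\<Prod>i<n. y + x * [:fps_X ^ i:]) = (\<Sum>k\<le>n. [:fps_X ^ (k * (k - 1) div 2) * gauss_binomial n k:] * x ^ k * y ^ (n - k))"
proof (induction n arbitrary: x)
  case (Suc n)
  let ?t = "\<lambda>k. [:fps_X ^ (k * (k - 1) div 2) * gauss_binomial n k:] * (x * [:fps_X:]) ^ k"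
  let ?s = "\<lambda>k. [:fps_X ^ (k * (k - 1) div 2) * gauss_binomial (Suc n) k:] * x ^ k"
  have tri: "Suc k * (Suc k - 1) div 2 = k * (k - 1) div 2 + k" for k
    by (cases k) (simp_all add: algebra_simps)
  have step: "?s (Suc k) = ?t (Suc k) + x * ?t k" for k
  proof -
    show ?thesis
      unfolding tri gauss_binomial.simps
      by (simp add: power_mult_distrib power_add poly_const_pow smult_add_left smult_add_right smult_power algebra_simps)
  qed
  have "(\<Prod>i<Suc n. y + x * [:fps_X ^ i:]) = (y + x) * (\<Prod>i<n. y + (x * [:fps_X:]) * [:fps_X ^ i:])"
    by (subst prod.lessThan_Suc_shift) (simp add: mult_ac smult_smult)
  also have "\<dots> = (y + x) * (\<Sum>k\<le>n. ?t k * y ^ (n - k))"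
    by (simp only: Suc.IH)
  also have "\<dots> = (\<Sum>k\<le>n. ?t k * y ^ (Suc n - k)) + (\<Sum>k\<le>n. x * ?t k * y ^ (n - k))"
    by (simp add: distrib_right sum_distrib_left Suc_diff_le mult_ac smult_add_right sum.distrib)
  also have "(\<Sum>k\<le>n. ?t k * y ^ (Suc n - k)) = (\<Sum>k\<le>Suc n. ?t k * y ^ (Suc n - k))"
    by (simp add: gauss_binomial_eq_0)
  also have "\<dots> = ?t 0 * y ^ Suc n + (\<Sum>k\<le>n. ?t (Suc k) * y ^ (n - k))"
    by (subst sum.atMost_Suc_shift) simp
  also have "\<dots> + (\<Sum>k\<le>n. x * ?t k * y ^ (n - k)) = ?t 0 * y ^ Suc n + (\<Sum>k\<le>n. ?s (Suc k) * y ^ (n - k))"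
    unfolding step by (simp add: sum.distrib algebra_simps)
  also have "\<dots> = (\<Sum>k\<le>Suc n. ?s k * y ^ (Suc n - k))"
    by (subst sum.atMost_Suc_shift) simp
  finally show ?case .
qed simp

text \<open>The product formula for Gaussian binomials with denominators cleared. It follows from
  the q-Pascal rule; the upper entry vanishes when j = n, which needs a separate case.\<close>

lemma gauss_binomial_euler_partial:
  "k \<le> n \<Longrightarrow> euler_partial k * euler_partial (n - k) * gauss_binomial n k = euler_partial n"
proof (induction n arbitrary: k)
  case 0
  then show ?case by (simp add: euler_partial_def)
next
  case (Suc n)
  show ?case
  proof (cases k)
    case 0
    then show ?thesis by (simp add: euler_partial_def)
  next
    case (Suc j)
    have e: "euler_partial (Suc m) = euler_partial m * (1 - fps_X ^ Suc m)" for m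
      by (simp add: euler_partial_def)
    have j: "j \<le> n" using Suc Suc.prems by simp
    have A: "euler_partial j * euler_partial (n - j) * gauss_binomial n j = euler_partial n"
      using Suc.IH j by blast
    have B: "euler_partial (Suc j) * euler_partial (n - j) * gauss_binomial n (Suc j) = (1 - fps_X ^ (n - j)) * euler_partial n"
    proof (cases "j = n")
      case False
      then have nj: "n - j = Suc (n - Suc j)" using j by simp
      have *: "euler_partial (Suc j) * euler_partial (n - Suc j) * gauss_binomial n (Suc j) = euler_partial n"
        using Suc.IH[of "Suc j"] False j by simp
      show ?thesis
        unfolding nj e[of "n - Suc j"] by (subst *[symmetric]) (simp only: mult_ac)
    qed (simp add: gauss_binomial_eq_0)
    have "euler_partial (Suc j) * euler_partial (n - j) * gauss_binomial (Suc n) (Suc j)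
       = (1 - fps_X ^ Suc j) * (euler_partial j * euler_partial (n - j) * gauss_binomial n j)
         + fps_X ^ Suc j * (euler_partial (Suc j) * euler_partial (n - j) * gauss_binomial n (Suc j))"
      unfolding gauss_binomial.simps e[of j] by algebra
    also have "\<dots> = euler_partial n * (1 - fps_X ^ Suc j * fps_X ^ (n - j))"
      unfolding A B by algebra
    also have "fps_X ^ Suc j * fps_X ^ (n - j) = (fps_X ^ Suc n :: int fps)"
      using j by (simp flip: power_add power_Suc)
    finally show ?thesis
      using Suc by (simp add: e)
  qed
qed

lemma gauss_binomial_symmetric:
  assumes "k \<le> n"
  shows "gauss_binomial n (n - k) = gauss_binomial n k"
proof -
  have "fps_nth (euler_partial m) 0 = 1" for m
    using euler_E_nth[of 0 m] by simp
  then have "euler_partial m \<noteq> 0" for m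
    by (metis fps_zero_nth zero_neq_one)
  then have "euler_partial k * euler_partial (n - k) \<noteq> 0"
    by simp
  moreover have "euler_partial k * euler_partial (n - k) * gauss_binomial n (n - k)
      = euler_partial k * euler_partial (n - k) * gauss_binomial n k"
    using gauss_binomial_euler_partial[OF assms] gauss_binomial_euler_partial[of "n - k" n] assms
    by (simp add: mult.commute)
  ultimately show ?thesis
    by (simp only: mult_cancel_left) simp
qed


lemma prod_pcompose_deriv:
  fixes r :: "'a::idom poly"
  assumes "poly p a = 0"
  shows "poly (pderiv (p * r)) a = poly (pderiv p) a * poly r a"
  using assms by (simp add: pderiv_mult)

lemma sum_atMost_double_Suc:
  fixes f :: "nat \<Rightarrow> 'a::comm_monoid_add"
  shows "(\<Sum>k\<le>2 * N + 1. f k) = (\<Sum>j\<le>N. f (N + 1 + j) + f (N - j))"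
proof -
  have "{..2 * N + 1} = {..N} \<union> {N + 1..2 * N + 1}"
    by auto
  then have "(\<Sum>k\<le>2 * N + 1. f k) = sum f {..N} + sum f {N + 1..2 * N + 1}"
    by (simp add: sum.union_disjoint)
  also have "sum f {N + 1..2 * N + 1} = (\<Sum>j\<le>N. f (N + 1 + j))"
    by (rule sum.reindex_bij_witness[where i = "\<lambda>j. N + 1 + j" and j = "\<lambda>k. k - (N + 1)"]) auto
  also have "sum f {..N} = (\<Sum>j\<le>N. f (N - j))"
    by (rule sum.reindex_bij_witness[where i = "\<lambda>j. N - j" and j = "\<lambda>k. N - k"]) auto
  finally show ?thesis
    by (simp add: sum.distrib add.commute)
qed

text \<open>Expand the product of q^N + x q^i over i <= 2 N by the q-binomial theorem and
  differentiate at x = -1. The factor with i = N vanishes there, so the derivative of the product is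
  the product of the other factors, which is a signed power of q times the square of
  \<open>euler_partial N\<close>.\<close>

lemma finite_jacobi:
  "euler_partial N ^ 2 = (\<Sum>j\<le>N. (-1) ^ j * of_nat (2 * j + 1) * fps_X ^ (j * (j + 1) div 2) * gauss_binomial (2 * N + 1) (N - j))"
proof -
  define n where "n = 2 * N + 1"
  define c :: nat where "c = N * N + N * (N + 1) div 2"
  define p :: "int fps poly" where "p = [:fps_X ^ N:] + [:0, 1:] * [:fps_X ^ N:]"
  define r :: "int fps poly" where "r = (\<Prod>i\<in>{..<n} - {N}. [:fps_X ^ N:] + [:0, 1:] * [:fps_X ^ i:])"
  \<comment> \<open>The k-th term of the q-binomial expansion after differentiation in x and
    evaluation at -1.\<close>
  define t where "t k = fps_X ^ (k * (k - 1) div 2) * gauss_binomial n k * of_nat k * (-1) ^ (k - 1) * (fps_X ^ N) ^ (n - k)" for k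
  have pr: "p * r = (\<Sum>k\<le>n. [:fps_X ^ (k * (k - 1) div 2) * gauss_binomial n k:] * [:0, 1:] ^ k * [:fps_X ^ N:] ^ (n - k))"
    unfolding gauss_binomial_theorem[symmetric] p_def r_def
    by (subst prod.remove[of "{..<n}" N]) (auto simp: n_def)
  have "poly (pderiv ([:a:] * [:0, 1:] ^ k * [:b:])) (-1) = a * of_nat k * (-1) ^ (k - 1) * b" for a b :: "int fps" and k
  proof -
    have "poly (pderiv ([:0, 1:] ^ k)) (-1) = of_nat k * (-1 :: int fps) ^ (k - 1)"
      by (cases k) (simp_all only: pderiv_power_Suc, simp_all add: pderiv_pCons)
    then show ?thesis
      by (simp add: pderiv_mult pderiv_smult pderiv_pCons mult_ac)
  qed
  moreover have "pderiv (sum f A) = (\<Sum>k\<in>A. pderiv (f k))" for f :: "nat \<Rightarrow> int fps poly" and A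
    by (induction A rule: infinite_finite_induct) (auto simp: pderiv_add)
  ultimately have "poly (pderiv (p * r)) (-1) = (\<Sum>k\<le>n. t k)"
    unfolding pr t_def by (simp only: poly_sum poly_const_pow)
  moreover have "poly p (-1) = 0"
    by (simp add: p_def)
  moreover have "poly (pderiv p) (-1) = fps_X ^ N"
    by (simp add: p_def pderiv_pCons)
  moreover have "poly r (-1) = (\<Prod>i\<in>{..<n} - {N}. fps_X ^ N - fps_X ^ i)"
    by (simp add: r_def poly_prod)
  ultimately have "(\<Sum>k\<le>n. t k) = fps_X ^ N * (\<Prod>i\<in>{..<n} - {N}. fps_X ^ N - fps_X ^ i)"
    by (simp add: prod_pcompose_deriv)
  \<comment> \<open>The factors with i < N and those with i > N each give one copy of
    \<open>euler_partial N\<close> up to sign and a power of q.\<close>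
  also have "(\<Prod>i\<in>{..<n} - {N}. fps_X ^ N - fps_X ^ i) = (\<Prod>i<N. fps_X ^ N - fps_X ^ i) * (\<Prod>i\<in>{N<..2 * N}. fps_X ^ N - fps_X ^ i :: int fps)"
    by (subst prod.union_disjoint[symmetric]) (auto simp: n_def intro!: prod.cong)
  also have "(\<Prod>i\<in>{N<..2 * N}. fps_X ^ N - fps_X ^ i) = (\<Prod>i<N. fps_X ^ N * (1 - fps_X ^ Suc i) :: int fps)"
    by (rule prod.reindex_bij_witness[where i = "\<lambda>i. N + Suc i" and j = "\<lambda>i. i - Suc N"])
       (auto simp: right_diff_distrib simp flip: power_add simp del: power_Suc)
  also have "\<dots> = fps_X ^ (N * N) * euler_partial N"
    by (simp add: prod.distrib euler_partial_def power_mult)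
  also have "(\<Prod>i<N. fps_X ^ N - fps_X ^ i :: int fps) = (\<Prod>i<N. - (fps_X ^ i * (1 - fps_X ^ Suc (N - Suc i))))"
    by (rule prod.cong) (auto simp: algebra_simps simp flip: power_add power_Suc)
  also have "\<dots> = (-1) ^ N * (\<Prod>i<N. fps_X ^ i) * euler_partial N"
    by (simp add: prod.distrib euler_partial_def prod.nat_diff_reindex[of "\<lambda>i. 1 - fps_X ^ Suc i" N] prod_uminus del: power_Suc)
  also have "(\<Prod>i<N. fps_X ^ i :: int fps) = fps_X ^ (N * (N - 1) div 2)"
    by (simp add: power_sum[symmetric] Sum_Ico_nat lessThan_atLeast0)
  also have "fps_X ^ N * ((-1) ^ N * fps_X ^ (N * (N - 1) div 2) * euler_partial N * (fps_X ^ (N * N) * euler_partial N))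
     = (-1) ^ N * fps_X ^ (N + N * (N - 1) div 2 + N * N) * euler_partial N ^ 2"
    by (simp add: power_add power2_eq_square mult_ac)
  also have "N + N * (N - 1) div 2 + N * N = c"
    unfolding c_def by (cases N) (simp_all add: algebra_simps)
  finally have lhs: "(\<Sum>k\<le>n. t k) = (-1) ^ N * fps_X ^ c * euler_partial N ^ 2" .
  \<comment> \<open>The terms k = N + 1 + j and k = N - j carry the same power of q and, by
    symmetry, the same Gaussian binomial. Their signs are opposite, so the factors k combine to (N +
    1 + j) - (N - j) = 2 j + 1.\<close>
  have exp1: "(N + 1 + j) * (N + 1 + j - 1) div 2 + N * (n - (N + 1 + j)) = c + j * (j + 1) div 2"
    and exp2: "(N - j) * (N - j - 1) div 2 + N * (n - (N - j)) = c + j * (j + 1) div 2" if j: "j \<le> N" for j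
  proof -
    obtain i where i: "N = j + i" using j le_Suc_ex by blast
    have half: "A' + D = (M + B') + C'"
      if "2 * A' = A" "2 * B' = B" "2 * C' = C" "A + 2 * D = 2 * M + B + C" for A A' B B' C C' D M :: nat
      using that by linarith
    have ev: "2 * (m * (m - 1) div 2) = m * (m - 1)" "2 * (m * (m + 1) div 2) = m * (m + 1)" for m :: nat
      by (rule dvd_mult_div_cancel, cases m, simp, simp)+
    show "(N + 1 + j) * (N + 1 + j - 1) div 2 + N * (n - (N + 1 + j)) = c + j * (j + 1) div 2"
      unfolding c_def by (rule half[OF ev(1) ev(2) ev(2)]) (simp add: i n_def algebra_simps)
    show "(N - j) * (N - j - 1) div 2 + N * (n - (N - j)) = c + j * (j + 1) div 2"
      unfolding c_def by (rule half[OF ev(1) ev(2) ev(2)]) (cases i, simp_all add: i n_def algebra_simps)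
  qed
  have "t (N + 1 + j) + t (N - j) = (-1) ^ N * fps_X ^ c * ((-1) ^ j * of_nat (2 * j + 1) * fps_X ^ (j * (j + 1) div 2) * gauss_binomial n (N - j))"
    if j: "j \<le> N" for j
  proof -
    have g: "gauss_binomial n (N + 1 + j) = gauss_binomial n (N - j)"
      using gauss_binomial_symmetric[of "N - j" n] j by (simp add: n_def)
    have "t (N + 1 + j) = fps_X ^ (c + j * (j + 1) div 2) * gauss_binomial n (N - j) * of_nat (N + 1 + j) * (-1) ^ (N + j)"
      unfolding t_def g exp1[OF j, symmetric] power_add power_mult by (simp add: mult_ac power_add)
    moreover have "t (N - j) = fps_X ^ (c + j * (j + 1) div 2) * gauss_binomial n (N - j) * (- of_nat (N - j) * (-1) ^ (N + j))"
    proof (cases "j = N")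
      case False
      then have sign: "(-1) ^ (N + j) = - ((-1) ^ (N - j - 1) :: int fps)"
        using j by (simp add: minus_one_power_iff)
      show ?thesis
        unfolding sign t_def exp2[OF j, symmetric] power_add[of fps_X] power_mult by (simp add: mult_ac)
    qed (simp add: t_def)
    ultimately show ?thesis
      using j by (simp add: power_add of_nat_diff algebra_simps)
  qed
  then have "(\<Sum>k\<le>n. t k) = (-1) ^ N * fps_X ^ c * (\<Sum>j\<le>N. (-1) ^ j * of_nat (2 * j + 1) * fps_X ^ (j * (j + 1) div 2) * gauss_binomial n (N - j))"
    unfolding n_def sum_atMost_double_Suc sum_distrib_left by (intro sum.cong) auto
  with lhs have "(-1) ^ N * fps_X ^ c * euler_partial N ^ 2 = (-1) ^ N * fps_X ^ c *
      (\<Sum>j\<le>N. (-1) ^ j * of_nat (2 * j + 1) * fps_X ^ (j * (j + 1) div 2) * gauss_binomial n (N - j))"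
    by simp
  then show ?thesis
    unfolding n_def by (simp only: mult_cancel_left) simp
qed

text \<open>Congruence modulo q^(K+1), used in place of a q-adic limit.\<close>

definition agree_upto :: "nat \<Rightarrow> int fps \<Rightarrow> int fps \<Rightarrow> bool" where
  "agree_upto K f g \<longleftrightarrow> (\<forall>k\<le>K. fps_nth f k = fps_nth g k)"

lemma agree_upto_mult: "agree_upto K f f' \<Longrightarrow> agree_upto K g g' \<Longrightarrow> agree_upto K (f * g) (f' * g')"
  by (auto simp: agree_upto_def fps_mult_nth)

lemma agree_upto_sum: "(\<And>i. i \<in> A \<Longrightarrow> agree_upto K (f i) (g i)) \<Longrightarrow> agree_upto K (sum f A) (sum g A)"
  by (auto simp: agree_upto_def fps_sum_nth)

lemma agree_upto_trans: "agree_upto K f g \<Longrightarrow> agree_upto K g h \<Longrightarrow> agree_upto K f h"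
  and agree_upto_sym: "agree_upto K f g \<Longrightarrow> agree_upto K g f"
  and agree_upto_refl [simp]: "agree_upto K f f"
  by (auto simp: agree_upto_def)

lemma agree_upto_mult_cancel:
  assumes "agree_upto K (e * f) (e * g)" and e: "fps_nth e 0 = 1"
  shows "agree_upto K f g"
proof -
  have "fps_nth f k = fps_nth g k" if "k \<le> K" for k
    using that
  proof (induction k rule: less_induct)
    case (less k)
    have split: "fps_nth (e * h) k = fps_nth h k + (\<Sum>i\<in>{1..k}. fps_nth e i * fps_nth h (k - i))" for h
      using e by (simp add: fps_mult_nth sum.atLeast_Suc_atMost)
    have "(\<Sum>i\<in>{1..k}. fps_nth e i * fps_nth f (k - i)) = (\<Sum>i\<in>{1..k}. fps_nth e i * fps_nth g (k - i))"
      using less by (intro sum.cong) auto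
    then show ?case
      using assms(1) less.prems split[of f] split[of g] by (simp add: agree_upto_def)
  qed
  then show ?thesis by (simp add: agree_upto_def)
qed

lemma agree_upto_euler_partial: "K \<le> N \<Longrightarrow> agree_upto K (euler_partial N) euler_E"
  by (simp add: agree_upto_def euler_E_nth[symmetric])

text \<open>Let N grow in \<open>finite_jacobi\<close>: each Gaussian binomial tends to 1/E, and
  multiplying through by E supplies the third factor.\<close>

theorem jacobi_euler_E_cubed:
  "euler_E ^ 3 = Abs_fps (\<lambda>n. \<Sum>j | j * (j + 1) div 2 = n. (-1) ^ j * (2 * int j + 1))"
proof (rule fps_ext)
  fix K :: nat
  \<comment> \<open>This makes N - j >= K for all j <= K, so both truncated products in the
    denominator of the Gaussian binomial agree with E up to q^K. Terms with j > K start beyond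
    q^K.\<close>
  define N where "N = 2 * K"
  define t :: "nat \<Rightarrow> int fps" where "t j = (-1) ^ j * of_nat (2 * j + 1) * fps_X ^ (j * (j + 1) div 2)" for j
  have g: "agree_upto K (gauss_binomial (2 * N + 1) (N - j) * euler_E) 1" if "j \<le> K" for j
  proof -
    have "agree_upto K (euler_E * (euler_E * gauss_binomial (2 * N + 1) (N - j)))
      (euler_partial (N - j) * (euler_partial (2 * N + 1 - (N - j)) * gauss_binomial (2 * N + 1) (N - j)))"
      using that by (intro agree_upto_mult agree_upto_sym[OF agree_upto_euler_partial]) (auto simp: N_def)
    also have "euler_partial (N - j) * (euler_partial (2 * N + 1 - (N - j)) * gauss_binomial (2 * N + 1) (N - j)) = euler_partial (2 * N + 1)"
      using gauss_binomial_euler_partial[of "N - j" "2 * N + 1"] by (simp add: mult.assoc)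
    finally have "agree_upto K (euler_E * (euler_E * gauss_binomial (2 * N + 1) (N - j))) (euler_E * 1)"
      using agree_upto_trans agree_upto_euler_partial[of K "2 * N + 1"] by (auto simp: N_def)
    then show ?thesis
      using agree_upto_mult_cancel[of K euler_E] by (simp add: mult.commute)
  qed
  have small: "agree_upto K (t j * f) 0" if "K < j" for j f
  proof -
    have "j \<le> j * (j + 1) div 2" using that by (cases j) auto
    then have "K < j * (j + 1) div 2" using that by linarith
    moreover have "t j * f = fps_X ^ (j * (j + 1) div 2) * ((-1) ^ j * of_nat (2 * j + 1) * f)"
      by (simp add: t_def mult_ac)
    ultimately show ?thesis
      by (simp only: agree_upto_def) (auto simp: fps_X_power_mult_nth)
  qed
  have "agree_upto K (euler_E ^ 3) (euler_partial N ^ 2 * euler_E)"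
    unfolding power2_eq_square power3_eq_cube
    by (intro agree_upto_mult agree_upto_sym[OF agree_upto_euler_partial]) (auto simp: N_def)
  also have "euler_partial N ^ 2 * euler_E = (\<Sum>j\<le>N. t j * (gauss_binomial (2 * N + 1) (N - j) * euler_E))"
    unfolding finite_jacobi sum_distrib_right t_def by (simp add: mult_ac)
  finally have "agree_upto K (euler_E ^ 3) \<dots>" .
  moreover have "agree_upto K (\<Sum>j\<le>N. t j * (gauss_binomial (2 * N + 1) (N - j) * euler_E)) (\<Sum>j\<le>N. t j * 1)"
  proof (rule agree_upto_sum)
    fix j
    show "agree_upto K (t j * (gauss_binomial (2 * N + 1) (N - j) * euler_E)) (t j * 1)"
    proof (cases "j \<le> K")
      case True
      then show ?thesis by (intro agree_upto_mult g) auto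
    next
      case False
      then show ?thesis
        using small[of j] agree_upto_trans agree_upto_sym not_le by blast
    qed
  qed
  ultimately have "agree_upto K (euler_E ^ 3) (\<Sum>j\<le>N. t j * 1)"
    by (rule agree_upto_trans)
  then have "fps_nth (euler_E ^ 3) K = (\<Sum>j\<le>N. fps_nth (t j) K)"
    by (simp add: agree_upto_def fps_sum_nth)
  moreover have "fps_nth (t j) K = (if j * (j + 1) div 2 = K then (-1) ^ j * (2 * int j + 1) else 0)" for j
  proof -
    have "t j = fps_const ((-1) ^ j * (2 * int j + 1)) * fps_X ^ (j * (j + 1) div 2)"
      by (simp add: t_def fps_of_nat[symmetric] fps_const_neg[symmetric] flip: fps_const_power fps_const_mult fps_const_add del: fps_const_neg)
    then show ?thesis by auto
  qed
  ultimately have "fps_nth (euler_E ^ 3) K = (\<Sum>j\<le>N. if j * (j + 1) div 2 = K then (-1) ^ j * (2 * int j + 1) else 0)"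
    by simp
  also have "(\<Sum>j\<le>N. if j * (j + 1) div 2 = K then (-1) ^ j * (2 * int j + 1) else 0) = (\<Sum>j\<in>{j\<in>{..N}. j * (j + 1) div 2 = K}. (-1) ^ j * (2 * int j + 1))"
    by (rule sum.inter_filter[symmetric]) simp
  also have "{j\<in>{..N}. j * (j + 1) div 2 = K} = {j. j * (j + 1) div 2 = K}"
  proof -
    have "j \<le> j * (j + 1) div 2" for j :: nat by (cases j) auto
    then show ?thesis unfolding N_def by (auto intro: order.trans)
  qed
  finally show "fps_nth (euler_E ^ 3) K = fps_nth (Abs_fps (\<lambda>n. \<Sum>j | j * (j + 1) div 2 = n. (-1) ^ j * (2 * int j + 1))) K"
    by simp
qed

section \<open>The generating function of partitions\<close>

definition partition_series :: "int fps" where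
  "partition_series = Abs_fps (\<lambda>n. int (card (partitions n)))"

definition partitions_bounded :: "nat \<Rightarrow> nat \<Rightarrow> nat multiset set" where
  "partitions_bounded N n = {P \<in> partitions n. \<forall>x\<in>#P. x \<le> N}"

lemma finite_partitions_bounded: "finite (partitions_bounded N n)"
  unfolding partitions_bounded_def by (rule finite_subset[OF _ finite_partitions]) auto

lemma member_le_sum_mset: "x \<in># P \<Longrightarrow> x \<le> sum_mset P" for P :: "nat multiset"
  by (metis insert_DiffM le_add1 sum_mset.add_mset)

text \<open>Either the part N + 1 is absent, or one copy of it can be removed.\<close>

lemma card_partitions_bounded_Suc:
  "card (partitions_bounded (Suc N) n) = card (partitions_bounded N n) +
     (if Suc N \<le> n then card (partitions_bounded (Suc N) (n - Suc N)) else 0)"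
proof -
  have "partitions_bounded (Suc N) n = partitions_bounded N n \<union> {P \<in> partitions_bounded (Suc N) n. Suc N \<in># P}"
    by (auto simp: partitions_bounded_def le_Suc_eq)
  moreover have "partitions_bounded N n \<inter> {P \<in> partitions_bounded (Suc N) n. Suc N \<in># P} = {}"
    by (auto simp: partitions_bounded_def)
  ultimately have "card (partitions_bounded (Suc N) n) = card (partitions_bounded N n) + card {P \<in> partitions_bounded (Suc N) n. Suc N \<in># P}"
    by (metis (no_types, lifting) card_Un_disjoint finite_Un finite_partitions_bounded)
  also have "card {P \<in> partitions_bounded (Suc N) n. Suc N \<in># P} = (if Suc N \<le> n then card (partitions_bounded (Suc N) (n - Suc N)) else 0)"
  proof (cases "Suc N \<le> n")
    case True
    have "bij_betw (\<lambda>P. P - {#Suc N#}) {P \<in> partitions_bounded (Suc N) n. Suc N \<in># P} (partitions_bounded (Suc N) (n - Suc N))"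
      by (rule bij_betw_byWitness[where f' = "add_mset (Suc N)"])
         (use True in \<open>auto simp: partitions_bounded_def partitions_def sum_mset_diff dest: in_diffD\<close>)
    then show ?thesis
      using True by (simp add: bij_betw_same_card)
  next
    case False
    then have "{P \<in> partitions_bounded (Suc N) n. Suc N \<in># P} = {}"
      by (auto simp: partitions_bounded_def partitions_def dest: member_le_sum_mset)
    then show ?thesis
      using False by (simp only: card.empty if_False)
  qed
  finally show ?thesis .
qed

lemma partitions_bounded_series:
  "Abs_fps (\<lambda>n. int (card (partitions_bounded N n))) * euler_partial N = 1"
proof (induction N)
  case 0
  have empty: "P = {#}" if "0 \<notin># P" "\<forall>x\<in>#P. x \<le> 0" for P :: "nat multiset"
    using that by (metis le_zero_eq multiset_nonemptyE)
  have "partitions_bounded 0 n = (if n = 0 then {{#}} else {})" for n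
  proof (intro equalityI subsetI)
    fix P :: "nat multiset" assume "P \<in> partitions_bounded 0 n"
    then have "0 \<notin># P" "\<forall>x\<in>#P. x \<le> 0" "sum_mset P = n"
      unfolding partitions_bounded_def partitions_def by blast+
    then show "P \<in> (if n = 0 then {{#}} else {})"
      using empty[of P] by simp
  next
    fix P :: "nat multiset" assume "P \<in> (if n = 0 then {{#}} else {})"
    then show "P \<in> partitions_bounded 0 n"
      by (simp add: partitions_bounded_def partitions_def split: if_splits)
  qed
  then have "Abs_fps (\<lambda>n. int (card (partitions_bounded 0 n))) = 1"
    by (intro fps_ext) simp
  then show ?case
    by (simp add: euler_partial_def)
next
  case (Suc N)
  let ?f = "\<lambda>N. Abs_fps (\<lambda>n. int (card (partitions_bounded N n)))"
  have "?f (Suc N) = ?f N + fps_X ^ Suc N * ?f (Suc N)"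
    by (rule fps_ext) (use card_partitions_bounded_Suc[of N] in \<open>simp add: fps_X_power_mult_nth del: power_Suc\<close>)
  then have "?f (Suc N) * (1 - fps_X ^ Suc N) = ?f N"
    by (simp add: algebra_simps del: power_Suc)
  then have "?f (Suc N) * euler_partial (Suc N) = ?f N * euler_partial N"
    by (simp add: euler_partial_def mult_ac del: power_Suc)
  with Suc.IH show ?case by simp
qed

lemma partition_series_euler_E: "partition_series * euler_E = 1"
proof (rule fps_ext)
  fix k
  have "partitions n = partitions_bounded k n" if "n \<le> k" for n
    using that by (auto simp: partitions_bounded_def partitions_def dest: member_le_sum_mset)
  then have "fps_nth (partition_series * euler_E) k = fps_nth (Abs_fps (\<lambda>n. int (card (partitions_bounded k n))) * euler_partial k) k"
    by (auto simp: fps_mult_nth partition_series_def euler_E_nth[of _ k] intro!: sum.cong)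
  then show "fps_nth (partition_series * euler_E) k = fps_nth 1 k"
    by (simp add: partitions_bounded_series)
qed

section \<open>Dyson's map and partitions by rank\<close>

definition largest_part :: "nat multiset \<Rightarrow> nat" where
  "largest_part P = Max (insert 0 (set_mset P))"

lemma partition_rank_eq: "partition_rank P = int (largest_part P) - int (size P)"
  by (simp add: partition_rank_def largest_part_def)

lemma largest_part_ge: "x \<in># P \<Longrightarrow> x \<le> largest_part P"
  by (simp add: largest_part_def)

lemma largest_part_le: "(\<And>x. x \<in># P \<Longrightarrow> x \<le> b) \<Longrightarrow> largest_part P \<le> b"
  by (simp add: largest_part_def)

lemma largest_part_in: "P \<noteq> {#} \<Longrightarrow> largest_part P \<in># P"
  using Max_in[of "set_mset P"] Max_insert[of "set_mset P" 0] by (simp add: largest_part_def)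

lemma largest_part_pos: "P \<noteq> {#} \<Longrightarrow> 0 \<notin># P \<Longrightarrow> 0 < largest_part P"
  using largest_part_in by (metis gr0I)

lemma largest_part_empty [simp]: "largest_part {#} = 0"
  by (simp add: largest_part_def)

lemma size_partition_le: "P \<in> partitions n \<Longrightarrow> size P \<le> n"
proof -
  assume "P \<in> partitions n"
  then have "0 \<notin># P" "sum_mset P = n" by (auto simp: partitions_def)
  then show ?thesis
    by (induction P arbitrary: n) auto
qed

definition rank_ge :: "int \<Rightarrow> nat \<Rightarrow> nat multiset set" where
  "rank_ge r n = {P \<in> partitions n. r \<le> partition_rank P}"

definition rank_le :: "int \<Rightarrow> nat \<Rightarrow> nat multiset set" where
  "rank_le r n = {P \<in> partitions n. partition_rank P \<le> r}"

text \<open>Dyson's map: remove the largest part \<open>l\<close> and add a column of height \<open>l - r - 1\<close>.\<close>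

definition dyson_map :: "int \<Rightarrow> nat multiset \<Rightarrow> nat multiset" where
  "dyson_map r P = (let M = P - {#largest_part P#}
     in image_mset Suc M + replicate_mset (nat (int (largest_part P) - r - 1) - size M) 1)"

definition dyson_inv :: "int \<Rightarrow> nat multiset \<Rightarrow> nat multiset" where
  "dyson_inv r Q = (let M = filter_mset (\<lambda>x. 0 < x) (image_mset (\<lambda>x. x - 1) Q); l = nat (int (size Q) + r + 1)
     in if l = 0 then M else add_mset l M)"

text \<open>Deleting the first column loses exactly the parts equal to 1; their number is the drop
  in size.\<close>

lemma first_column_eq:
  assumes "0 \<notin># Q"
  shows "image_mset Suc (filter_mset (\<lambda>x. 0 < x) (image_mset (\<lambda>x. x - 1) Q)) +
    replicate_mset (size Q - size (filter_mset (\<lambda>x. 0 < x) (image_mset (\<lambda>x. x - 1) Q))) 1 = Q"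
  using assms
proof (induction Q)
  case (add x Q)
  let ?M = "filter_mset (\<lambda>x. 0 < x) (image_mset (\<lambda>x. x - 1) Q)"
  have "size ?M \<le> size Q"
    by (metis size_filter_mset_lesseq size_image_mset)
  then show ?case
    using add by (cases "x = 1") (auto simp: Suc_diff_le)
qed simp

lemma sum_first_column:
  "0 \<notin># Q \<Longrightarrow> sum_mset (filter_mset (\<lambda>x. 0 < x) (image_mset (\<lambda>x. x - 1) Q)) + size Q = sum_mset Q" for Q :: "nat multiset"
  by (induction Q) auto

text \<open>If the largest part is l and the rank is at least r, the other parts number at most l -
  r - 1, so a column of that height fits. The image has exactly l - r - 1 parts, all at most l + 1,
  hence rank at most r + 2, and its sum is n - r - 1.\<close>

lemma dyson_map:
  assumes P: "P \<in> rank_ge r n" and nr: "n > 0 \<or> r < 0" and n': "int n' = int n - r - 1"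
  shows "dyson_map r P \<in> rank_le (r + 2) n'" and "dyson_inv r (dyson_map r P) = P"
proof -
  define l where "l = largest_part P"
  define M where "M = P - {#l#}"
  define k where "k = nat (int l - r - 1)"
  have P0: "0 \<notin># P" "sum_mset P = n" and rk: "r \<le> int l - int (size P)"
    using P by (auto simp: rank_ge_def partitions_def partition_rank_eq l_def)
  have PM: "P = (if l = 0 then M else add_mset l M)"
    using largest_part_in[of P] P0 by (cases "P = {#}") (auto simp: M_def l_def)
  have l0: "l = 0 \<longleftrightarrow> P = {#}"
    using largest_part_pos[of P] P0 by (cases "P = {#}") (auto simp: l_def)
  have M: "0 \<notin># M" "\<And>x. x \<in># M \<Longrightarrow> x \<le> l"
    using P0(1) by (auto simp: l_def M_def largest_part_ge dest: in_diffD)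
  have Msum: "sum_mset M + l = n"
    using arg_cong[OF PM, of sum_mset] P0(2) by (simp split: if_splits)
  \<comment> \<open>The empty partition has l = 0, and its column height - r - 1 is nonnegative only
    for r < 0; this is where \<open>nr\<close> enters.\<close>
  have k: "int k = int l - r - 1" "size M \<le> k"
  proof -
    have "int (size M) \<le> int l - r - 1"
    proof (cases "l = 0")
      case True
      then show ?thesis using l0 nr P0 by (auto simp: M_def)
    next
      case False
      then have "size P = Suc (size M)"
        using arg_cong[OF PM, of size] by simp
      then show ?thesis using rk by linarith
    qed
    then show "int k = int l - r - 1" "size M \<le> k" by (auto simp: k_def)
  qed
  have Q: "dyson_map r P = image_mset Suc M + replicate_mset (k - size M) 1"
    by (simp add: dyson_map_def M_def l_def k_def Let_def)
  have sz: "size (dyson_map r P) = k"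
    using k by (simp add: Q)
  have "sum_mset (image_mset Suc M) = sum_mset M + size M"
    by (induction M) auto
  then have "sum_mset (dyson_map r P) = n'"
    using k Msum n' by (simp add: Q sum_mset_replicate_mset)
  moreover have "largest_part (dyson_map r P) \<le> l + 1"
    by (rule largest_part_le) (use M in \<open>auto simp: Q split: if_splits\<close>)
  ultimately show "dyson_map r P \<in> rank_le (r + 2) n'"
    using k sz by (auto simp: rank_le_def partitions_def partition_rank_eq Q)
  have "filter_mset (\<lambda>x. 0 < x) (image_mset (\<lambda>x. x - 1) (dyson_map r P)) = filter_mset (\<lambda>x. 0 < x) M"
  proof -
    have "filter_mset (\<lambda>x. 0 < x) (replicate_mset j (0 :: nat)) = {#}" for j
      by (rule multiset_eqI) simp
    moreover have "image_mset (\<lambda>x. x - 1) (image_mset Suc M) = M"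
      by (induction M) auto
    ultimately show ?thesis
      by (simp only: Q image_mset_union filter_union_mset image_replicate_mset diff_self_eq_0 add_0_right)
  qed
  also have "\<dots> = M"
    using M(1) by (metis filter_mset_True filter_mset_cong gr0I)
  finally have "dyson_inv r (dyson_map r P) = (if l = 0 then M else add_mset l M)"
    using k sz by (simp add: dyson_inv_def Let_def)
  then show "dyson_inv r (dyson_map r P) = P"
    unfolding PM[symmetric] .
qed

lemma dyson_inv:
  assumes Q: "Q \<in> rank_le (r + 2) n'" and nr: "n > 0 \<or> r < 0" and n': "int n' = int n - r - 1"
  shows "dyson_inv r Q \<in> rank_ge r n" and "dyson_map r (dyson_inv r Q) = Q"
proof -
  define M where "M = filter_mset (\<lambda>x. 0 < x) (image_mset (\<lambda>x. x - 1) Q)"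
  define l where "l = nat (int (size Q) + r + 1)"
  have Q0: "0 \<notin># Q" "sum_mset Q = n'" and rk: "int (largest_part Q) - int (size Q) \<le> r + 2"
    using Q by (auto simp: rank_le_def partitions_def partition_rank_eq)
  \<comment> \<open>A nonempty Q has a positive largest part, so the rank bound forces size + r + 1
    >= 0 and \<open>nat\<close> truncates nothing. For empty Q the value is n.\<close>
  have lint: "int l = int (size Q) + r + 1"
  proof (cases "Q = {#}")
    case True
    then show ?thesis using Q0 n' by (simp add: l_def)
  next
    case False
    then have "largest_part Q > 0"
      using largest_part_in[of Q] Q0(1) by (metis gr0I)
    then show ?thesis using rk by (simp add: l_def)
  qed
  have Ml: "x \<le> l" if x: "x \<in># M" for x
  proof -
    have "Suc x \<in># Q"
      using x by (auto simp: M_def)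
    then show ?thesis using largest_part_ge[of "Suc x" Q] rk lint by linarith
  qed
  have M0: "0 \<notin># M" by (simp add: M_def)
  have Msum: "sum_mset M + size Q = n'"
    using sum_first_column[OF Q0(1)] Q0(2) by (simp add: M_def)
  have Msize: "size M \<le> size Q"
    unfolding M_def by (metis size_filter_mset_lesseq size_image_mset)
  have P: "dyson_inv r Q = (if l = 0 then M else add_mset l M)"
    by (simp add: dyson_inv_def M_def l_def Let_def)
  have Mempty: "M = {#}" if "l = 0"
    using Ml M0 that by (metis le_zero_eq multiset_nonemptyE)
  have lp: "largest_part (dyson_inv r Q) = l"
  proof (cases "l = 0")
    case False
    then show ?thesis
      using Ml by (intro antisym largest_part_le) (auto simp: P intro: largest_part_ge)
  qed (simp add: P Mempty)
  have "sum_mset (dyson_inv r Q) = n"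
    using Msum lint n' by (auto simp: P)
  then show "dyson_inv r Q \<in> rank_ge r n"
    using lint Msize M0 nr n' lp Mempty by (auto simp: rank_ge_def partitions_def partition_rank_eq P split: if_splits)
  have "dyson_inv r Q - {#l#} = M"
    using Mempty by (auto simp: P)
  moreover have "nat (int l - r - 1) = size Q"
    using lint by simp
  ultimately show "dyson_map r (dyson_inv r Q) = Q"
    using first_column_eq[OF Q0(1)] by (simp add: dyson_map_def lp Let_def M_def)
qed

lemma card_rank_ge_eq:
  assumes "n > 0 \<or> r < 0" "int n' = int n - r - 1"
  shows "card (rank_ge r n) = card (rank_le (r + 2) n')"
  by (rule bij_betw_same_card[of "dyson_map r"], rule bij_betw_byWitness[where f' = "dyson_inv r"])
     (use dyson_map[OF _ assms] dyson_inv[OF _ assms] in auto)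

lemma card_rank_complement: "int (card (rank_le r n)) = int (card (partitions n)) - int (card (rank_ge (r + 1) n))"
proof -
  have "partitions n = rank_le r n \<union> rank_ge (r + 1) n" "rank_le r n \<inter> rank_ge (r + 1) n = {}"
    by (auto simp: rank_le_def rank_ge_def)
  moreover have "finite (rank_le r n)" "finite (rank_ge (r + 1) n)"
    using finite_partitions[of n] by (auto simp: rank_le_def rank_ge_def)
  ultimately show ?thesis
    by (simp add: card_Un_disjoint)
qed

text \<open>Dyson's map leads from rank at least m to rank at most m + 2, whose complement is rank
  at least m + 3. A partition of n with rank m >= 1 or more requires m < n.\<close>

lemma card_rank_ge_rec:
  assumes "m \<ge> 1"
  shows "int (card (rank_ge (int m) n)) = (if m < n then int (card (partitions (n - m - 1))) - int (card (rank_ge (int (m + 3)) (n - m - 1))) else 0)"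
proof (cases "m < n")
  case True
  then have "card (rank_ge (int m) n) = card (rank_le (int m + 2) (n - m - 1))"
    by (intro card_rank_ge_eq) auto
  then show ?thesis
    using True card_rank_complement[of "int m + 2" "n - m - 1"] by (simp add: algebra_simps)
next
  case False
  have "P \<notin> rank_ge (int m) n" for P
  proof
    assume P: "P \<in> rank_ge (int m) n"
    then have rk: "int m \<le> int (largest_part P) - int (size P)" "P \<in> partitions n"
      by (auto simp: rank_ge_def partition_rank_eq)
    then have "P \<noteq> {#}" using assms by auto
    then have "largest_part P \<le> n" "size P \<ge> 1"
      using rk(2) member_le_sum_mset[OF largest_part_in] by (auto simp: partitions_def Suc_le_eq nonempty_has_size)
    then show False using rk False by linarith
  qed
  then have "rank_ge (int m) n = {}" by blast
  then show ?thesis using False by simp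
qed

text \<open>Dyson's map with r = - m - 2, read backwards.\<close>

lemma card_rank_le_rec:
  assumes "m \<ge> 1"
  shows "int (card (rank_le (- int m) n)) = (if m < n then int (card (partitions (n - m - 1))) - int (card (rank_le (- int (m + 3)) (n - m - 1))) else 0)"
proof (cases "m < n")
  case True
  then have "card (rank_ge (- int m - 2) (n - m - 1)) = card (rank_le (- int m - 2 + 2) n)"
    by (intro card_rank_ge_eq) auto
  then show ?thesis
    using True card_rank_complement[of "- int m - 3" "n - m - 1"] by (simp add: algebra_simps)
next
  case False
  have "P \<notin> rank_le (- int m) n" for P
  proof
    assume P: "P \<in> rank_le (- int m) n"
    then have rk: "int (largest_part P) - int (size P) \<le> - int m" "P \<in> partitions n"
      by (auto simp: rank_le_def partition_rank_eq)
    then have "P \<noteq> {#}" using assms by auto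
    then have "largest_part P \<noteq> 0" "size P \<le> n"
      using rk(2) largest_part_pos[of P] size_partition_le[of P n] by (auto simp: partitions_def)
    then show False using rk False by linarith
  qed
  then have "rank_le (- int m) n = {}" by blast
  then show ?thesis using False by simp
qed

text \<open>Both sides satisfy the same recursion, which replaces conjugation of partitions.\<close>

lemma card_rank_symmetric:
  "m \<ge> 1 \<Longrightarrow> int (card (rank_le (- int m) n)) = int (card (rank_ge (int m) n))"
proof (induction n arbitrary: m rule: less_induct)
  case (less n)
  then show ?case
    using card_rank_ge_rec[OF less.prems, of n] card_rank_le_rec[OF less.prems, of n] less.IH[of "n - m - 1" "m + 3"]
    by (cases "m < n") simp_all
qed


section \<open>Generating functions of ranks and rank moments\<close>

text \<open>The numerator of the generating function of partitions with rank at least m: the sum of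
  (-1)^(j-1) q^(j(3j-1)/2 + mj) over j >= 1.\<close>

definition appell_coeff :: "nat \<Rightarrow> int fps" where
  "appell_coeff m = Abs_fps (\<lambda>N. \<Sum>j | j \<ge> 1 \<and> j * (3 * j - 1) div 2 + m * j = N. (-1) ^ (j - 1))"

lemma appell_index_bound: "j \<ge> 1 \<Longrightarrow> j * (3 * j - 1) div 2 + m * j = N \<Longrightarrow> j \<le> N \<and> m \<le> N" for j m N :: nat
proof -
  assume j: "j \<ge> 1" and N: "j * (3 * j - 1) div 2 + m * j = N"
  have "j * 2 \<le> j * (3 * j - 1)" using j by (intro mult_left_mono) auto
  then have "j \<le> j * (3 * j - 1) div 2" by linarith
  moreover have "m \<le> m * j" using j by simp
  ultimately show ?thesis using N by linarith
qed

lemma finite_appell_index [simp]: "finite {j :: nat. j \<ge> 1 \<and> j * (3 * j - 1) div 2 + m * j = N}"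
proof (rule finite_subset)
  show "{j. j \<ge> 1 \<and> j * (3 * j - 1) div 2 + m * j = N} \<subseteq> {..N}"
    using appell_index_bound by blast
qed simp

text \<open>The term j = 1 is q^(m+1). Replacing j by j + 1 adds m + 1 + 3 j to the exponent, which
  turns m into m + 3, and flips the sign.\<close>

lemma appell_coeff_rec: "appell_coeff m = fps_X ^ (m + 1) * (1 - appell_coeff (m + 3))"
proof (rule fps_ext)
  fix N
  let ?S = "\<lambda>m N. {j :: nat. j \<ge> 1 \<and> j * (3 * j - 1) div 2 + m * j = N}"
  have shift: "Suc j * (3 * Suc j - 1) div 2 + m * Suc j = (m + 1) + (j * (3 * j - 1) div 2 + (m + 3) * j)" if "j \<ge> 1" for j
  proof -
    have "even (j * (3 * j - 1))" using that by (cases "even j") auto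
    then obtain c where c1: "j * (3 * j - 1) = 2 * c" by (elim evenE)
    have "Suc j * (3 * Suc j - 1) = j * (3 * j - 1) + 2 * (3 * j + 1)"
      using that by (cases j) (simp_all add: algebra_simps)
    also have "\<dots> = 2 * (c + 3 * j + 1)"
      unfolding c1 by simp
    finally have c2: "Suc j * (3 * Suc j - 1) = 2 * (c + 3 * j + 1)" .
    show ?thesis unfolding c1 c2 by (simp add: algebra_simps)
  qed
  have split: "?S m N = (if N = m + 1 then {1} else {}) \<union> Suc ` (if m + 1 \<le> N then ?S (m + 3) (N - (m + 1)) else {})"
  proof (intro set_eqI iffI)
    fix j assume j: "j \<in> ?S m N"
    show "j \<in> (if N = m + 1 then {1} else {}) \<union> Suc ` (if m + 1 \<le> N then ?S (m + 3) (N - (m + 1)) else {})"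
    proof (cases "j = 1")
      case False
      then obtain i where i: "j = Suc i" "i \<ge> 1" using j by (cases j) auto
      then show ?thesis using j shift[of i] by auto
    qed (use j in auto)
  next
    fix j assume "j \<in> (if N = m + 1 then {1} else {}) \<union> Suc ` (if m + 1 \<le> N then ?S (m + 3) (N - (m + 1)) else {})"
    then consider "j = 1" "N = m + 1" | i where "j = Suc i" "i \<ge> 1" "m + 1 \<le> N"
        "i * (3 * i - 1) div 2 + (m + 3) * i = N - (m + 1)"
      by (auto split: if_splits)
    then show "j \<in> ?S m N"
    proof cases
      case 2
      then show ?thesis by (simp only: mem_Collect_eq shift) simp
    qed simp
  qed
  have "fps_nth (appell_coeff m) N = (\<Sum>j\<in>(if N = m + 1 then {1} else {}). (-1) ^ (j - 1))
      + (\<Sum>j\<in>Suc ` (if m + 1 \<le> N then ?S (m + 3) (N - (m + 1)) else {}). (-1) ^ (j - 1))"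
    unfolding appell_coeff_def fps_nth_Abs_fps split by (rule sum.union_disjoint) (auto simp del: One_nat_def)
  also have "(\<Sum>j\<in>Suc ` (if m + 1 \<le> N then ?S (m + 3) (N - (m + 1)) else {}). (-1) ^ (j - 1))
      = (if m + 1 \<le> N then - fps_nth (appell_coeff (m + 3)) (N - (m + 1)) else 0)"
  proof -
    have "(-1) ^ (Suc j - 1) = - ((-1) ^ (j - 1) :: int)" if "j \<in> ?S (m + 3) N'" for j N'
      using that by (cases j) auto
    then show ?thesis
      by (simp add: sum.reindex appell_coeff_def sum_negf[symmetric] del: sum_negf One_nat_def)
  qed
  finally show "fps_nth (appell_coeff m) N = fps_nth (fps_X ^ (m + 1) * (1 - appell_coeff (m + 3))) N"
    by (cases "N = m + 1"; cases "m + 1 \<le> N")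
       (simp_all only: fps_X_power_mult_nth fps_sub_nth fps_one_nth if_True if_False not_less[symmetric]
         sum.insert sum.empty, simp_all)
qed

text \<open>Both sides obey the recursion that raises m by 3 and lowers the index by m + 1, so
  strong induction on the index applies.\<close>

lemma rank_ge_series:
  assumes "m \<ge> 1"
  shows "Abs_fps (\<lambda>n. int (card (rank_ge (int m) n))) = partition_series * appell_coeff m"
proof (rule fps_ext)
  fix n
  let ?A = "\<lambda>m. Abs_fps (\<lambda>n. int (card (rank_ge (int m) n)))"
  have rec: "?A m = fps_X ^ (m + 1) * (partition_series - ?A (m + 3))" if "m \<ge> 1" for m
    by (rule fps_ext) (use card_rank_ge_rec[OF that] in \<open>auto simp: fps_X_power_mult_nth partition_series_def simp del: power_Suc\<close>)
  show "fps_nth (?A m) n = fps_nth (partition_series * appell_coeff m) n"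
    using assms
  proof (induction n arbitrary: m rule: less_induct)
    case (less n)
    have "partition_series * appell_coeff m = fps_X ^ (m + 1) * (partition_series - partition_series * appell_coeff (m + 3))"
      by (subst appell_coeff_rec) (simp only: algebra_simps mult_1_left)
    then have "fps_nth (partition_series * appell_coeff m) n = (if n < m + 1 then 0 else
        fps_nth partition_series (n - (m + 1)) - fps_nth (partition_series * appell_coeff (m + 3)) (n - (m + 1)))"
      by (simp only: fps_X_power_mult_nth fps_sub_nth)
    moreover have "fps_nth (?A m) n = (if n < m + 1 then 0 else
        fps_nth partition_series (n - (m + 1)) - fps_nth (?A (m + 3)) (n - (m + 1)))"
      by (subst rec[OF less.prems]) (simp only: fps_X_power_mult_nth fps_sub_nth)
    moreover have "fps_nth (?A (m + 3)) (n - (m + 1)) = fps_nth (partition_series * appell_coeff (m + 3)) (n - (m + 1))" if "\<not> n < m + 1"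
      by (rule less.IH) (use that in auto)
    ultimately show ?case
      by presburger
  qed
qed

lemma rank_moment_eq_sum: "rank_moment k n = (\<Sum>P\<in>partitions n. partition_rank P ^ k)"
proof -
  have "rank_moment k n = (\<Sum>m\<in>partition_rank ` partitions n. m ^ k * int (rank_count m n))"
    unfolding rank_moment_def
  proof (rule Sum_any.expand_superset)
    show "finite (partition_rank ` partitions n)"
      by (simp add: finite_partitions)
    show "{m. m ^ k * int (rank_count m n) \<noteq> 0} \<subseteq> partition_rank ` partitions n"
    proof
      fix m assume "m \<in> {m. m ^ k * int (rank_count m n) \<noteq> 0}"
      then have "{P \<in> partitions n. partition_rank P = m} \<noteq> {}"
        by (metis (mono_tags) card.empty mem_Collect_eq mult_zero_right of_nat_0 rank_count_def)
      then show "m \<in> partition_rank ` partitions n"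
        by auto
    qed
  qed
  also have "\<dots> = (\<Sum>m\<in>partition_rank ` partitions n. \<Sum>P\<in>{P \<in> partitions n. partition_rank P = m}. partition_rank P ^ k)"
    by (rule sum.cong) (simp_all add: rank_count_def)
  also have "\<dots> = (\<Sum>P\<in>partitions n. partition_rank P ^ k)"
    by (rule sum.image_gen[OF finite_partitions, symmetric])
  finally show ?thesis .
qed

text \<open>Summation by parts: for even k the power r^k telescopes into the differences m^k -
  (m-1)^k over 1 <= m <= |r|. Positive and negative ranks contribute equally, whence the factor
  2.\<close>

lemma rank_moment_even:
  assumes k: "even k" "k > 0"
  shows "rank_moment k n = 2 * (\<Sum>m=1..n. (int m ^ k - (int m - 1) ^ k) * int (card (rank_ge (int m) n)))"
proof -
  have pw: "r ^ k = (\<Sum>m=1..n. if int m \<le> r then int m ^ k - (int m - 1) ^ k else 0) + (\<Sum>m=1..n. if r \<le> - int m then int m ^ k - (int m - 1) ^ k else 0)"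
    if r: "\<bar>r\<bar> \<le> int n" for r
  proof -
    have tele: "(\<Sum>m=1..n. if m \<le> a then int m ^ k - (int m - 1) ^ k else 0) = int a ^ k" if "a \<le> n" for a :: nat
    proof -
      have "(\<Sum>m=1..n. if m \<le> a then int m ^ k - (int m - 1) ^ k else 0) = (\<Sum>m=1..a. int m ^ k - (int m - 1) ^ k)"
        by (rule sum.mono_neutral_cong_right) (use that in auto)
      also have "\<dots> = int a ^ k"
        by (induction a) (use k in auto)
      finally show ?thesis .
    qed
    show ?thesis
    proof (cases "r \<ge> 0")
      case True
      then obtain a where a: "r = int a" using nonneg_int_cases by blast
      have "(\<Sum>m=1..n. if int a \<le> - int m then int m ^ k - (int m - 1) ^ k else 0) = 0"
        by (rule sum.neutral) auto
      then show ?thesis using tele[of a] r by (simp add: a)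
    next
      case False
      then obtain a where a: "r = - int a" by (metis int_cases2 of_nat_0_le_iff)
      have "(\<Sum>m=1..n. if int m \<le> - int a then int m ^ k - (int m - 1) ^ k else 0) = 0"
        by (rule sum.neutral) auto
      then show ?thesis using tele[of a] r k by (simp add: a)
    qed
  qed
  have bound: "\<bar>partition_rank P\<bar> \<le> int n" if "P \<in> partitions n" for P
  proof (cases "P = {#}")
    case False
    then have "largest_part P \<le> n"
      using that member_le_sum_mset[OF largest_part_in] by (auto simp: partitions_def)
    then show ?thesis using size_partition_le[OF that] by (simp add: partition_rank_eq)
  qed (simp add: partition_rank_eq)
  have cnt: "(\<Sum>P\<in>partitions n. if Q P then c else 0) = c * int (card {P\<in>partitions n. Q P})" for Q and c :: int
    by (simp add: sum.inter_filter[OF finite_partitions, symmetric])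
  have "rank_moment k n = (\<Sum>P\<in>partitions n. (\<Sum>m=1..n. if int m \<le> partition_rank P then int m ^ k - (int m - 1) ^ k else 0)
      + (\<Sum>m=1..n. if partition_rank P \<le> - int m then int m ^ k - (int m - 1) ^ k else 0))"
    unfolding rank_moment_eq_sum by (rule sum.cong) (use pw bound in auto)
  also have "\<dots> = (\<Sum>m=1..n. (int m ^ k - (int m - 1) ^ k) * int (card (rank_ge (int m) n)))
      + (\<Sum>m=1..n. (int m ^ k - (int m - 1) ^ k) * int (card (rank_le (- int m) n)))"
    unfolding sum.distrib by (subst (1 2) sum.swap) (simp only: cnt rank_ge_def rank_le_def)
  also have "\<dots> = 2 * (\<Sum>m=1..n. (int m ^ k - (int m - 1) ^ k) * int (card (rank_ge (int m) n)))"
    by (simp add: card_rank_symmetric)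
  finally show ?thesis .
qed

text \<open>The full sum of w(m) \<open>appell_coeff m\<close> over m >= 1; it may stop at m = N
  because q^N occurs in \<open>appell_coeff m\<close> only for m <= N.\<close>

definition weighted_appell :: "(int \<Rightarrow> int) \<Rightarrow> int fps" where
  "weighted_appell w = Abs_fps (\<lambda>N. \<Sum>m=1..N. w (int m) * fps_nth (appell_coeff m) N)"

lemma appell_coeff_nth_eq_0: "N < m \<Longrightarrow> fps_nth (appell_coeff m) N = 0"
proof -
  assume "N < m"
  then have "{j :: nat. j \<ge> 1 \<and> j * (3 * j - 1) div 2 + m * j = N} = {}"
    using appell_index_bound[of _ m N] not_le by blast
  then show ?thesis
    by (simp only: appell_coeff_def fps_nth_Abs_fps sum.empty)
qed

theorem rank_moment_series:
  assumes k: "even k" "k > 0"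
  shows "Abs_fps (rank_moment k) = 2 * partition_series * weighted_appell (\<lambda>m. m ^ k - (m - 1) ^ k)"
proof (rule fps_ext)
  fix n
  let ?w = "\<lambda>m :: int. m ^ k - (m - 1) ^ k"
  have W: "fps_nth (weighted_appell ?w) i = (\<Sum>m=1..n. ?w (int m) * fps_nth (appell_coeff m) i)" if "i \<le> n" for i
    unfolding weighted_appell_def fps_nth_Abs_fps
    by (rule sum.mono_neutral_left) (use that appell_coeff_nth_eq_0 in auto)
  have "rank_moment k n = 2 * (\<Sum>m=1..n. ?w (int m) * fps_nth (partition_series * appell_coeff m) n)"
    unfolding rank_moment_even[OF k] by (simp flip: rank_ge_series)
  also have "(\<Sum>m=1..n. ?w (int m) * fps_nth (partition_series * appell_coeff m) n)
     = (\<Sum>m=1..n. \<Sum>i=0..n. fps_nth partition_series i * (?w (int m) * fps_nth (appell_coeff m) (n - i)))"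
    by (simp add: fps_mult_nth sum_distrib_left mult_ac)
  also have "\<dots> = (\<Sum>i=0..n. fps_nth partition_series i * (\<Sum>m=1..n. ?w (int m) * fps_nth (appell_coeff m) (n - i)))"
    by (subst sum.swap) (simp add: sum_distrib_left)
  also have "\<dots> = fps_nth (partition_series * weighted_appell ?w) n"
    by (simp add: fps_mult_nth W)
  finally show "fps_nth (Abs_fps (rank_moment k)) n = fps_nth (2 * partition_series * weighted_appell ?w) n"
    by (simp add: mult.assoc numeral_fps_const)
qed

section \<open>Powers of the theta function and their coefficients\<close>

definition tri :: "int \<Rightarrow> int" where
  "tri n = n * (n + 1) div 2"

lemma two_tri: "2 * tri n = n * (n + 1)"
  unfolding tri_def by (rule dvd_mult_div_cancel) simp

lemma tri_add: "tri (m + n) = tri m + tri n + m * n"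
  using two_tri[of m] two_tri[of n] two_tri[of "m + n"] by (simp add: algebra_simps)

lemma tri_bound: "tri n \<le> K \<Longrightarrow> n \<in> {- K - 1..K}"
proof -
  assume "tri n \<le> K"
  moreover have "2 * n \<le> n * (n + 1)" 
  proof (cases "n \<le> 0")
    case True
    have "0 \<le> (n + 1) * n"
      using True by (cases "n = 0") (auto intro: mult_nonpos_nonpos)
    then show ?thesis using True by (simp add: mult.commute)
  next
    case False
    then have "n * 2 \<le> n * (n + 1)" by (intro mult_left_mono) auto
    then show ?thesis by simp
  qed
  moreover have "2 * (- n - 1) \<le> n * (n + 1)"
  proof (cases "n < 0")
    case True
    have "(-n) * (-n - 1) \<ge> 1 * (- n - 1)"
      using True by (intro mult_right_mono) auto
    then have "n * (n + 1) \<ge> - n - 1" by (simp add: algebra_simps)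
    moreover have "n * (n + 1) \<ge> 2 * (- n - 1)" if "n \<le> -2"
    proof -
      have "(-n) * (-n - 1) \<ge> 2 * (- n - 1)"
        using that by (intro mult_right_mono) auto
      then show ?thesis by (simp add: algebra_simps)
    qed
    ultimately show ?thesis using True by (cases "n = -1") auto
  next
    case False
    then have "0 \<le> n * (n + 1)" by auto
    moreover have "2 * (- n - 1) \<le> 0" using False by simp
    ultimately show ?thesis by (rule order_trans[rotated])
  qed
  ultimately show ?thesis using two_tri[of n] by auto
qed

lemma tri_nonneg: "0 \<le> tri n"
  using tri_bound[of n "-1"] by force

definition alt_sign :: "int \<Rightarrow> int" where
  "alt_sign n = (if even n then 1 else - 1)"

lemma alt_sign_add: "alt_sign (m + n) = alt_sign m * alt_sign n"
  by (auto simp: alt_sign_def)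

definition int_nth :: "int fps \<Rightarrow> int \<Rightarrow> int" where
  "int_nth f K = (if K < 0 then 0 else fps_nth f (nat K))"

lemma Sum_any_sum_swap:
  fixes h :: "'b \<Rightarrow> 'c \<Rightarrow> 'a::comm_monoid_add"
  assumes "\<And>n. n \<in> A \<Longrightarrow> finite {s. h s n \<noteq> 0}"
  shows "Sum_any (\<lambda>s. \<Sum>n\<in>A. h s n) = (\<Sum>n\<in>A. Sum_any (\<lambda>s. h s n))"
  using assms
proof (induction A rule: infinite_finite_induct)
  case (insert n A)
  have "{s. (\<Sum>n\<in>A. h s n) \<noteq> 0} \<subseteq> (\<Union>n\<in>A. {s. h s n \<noteq> 0})"
    using sum.not_neutral_contains_not_neutral by fastforce
  moreover have "finite (\<Union>n\<in>A. {s. h s n \<noteq> 0})"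
    using insert by auto
  ultimately have "finite {s. (\<Sum>n\<in>A. h s n) \<noteq> 0}"
    by (rule finite_subset)
  then show ?case
    using insert by (simp add: Sum_any.distrib)
qed auto

lemma Sum_any_shift: "Sum_any (\<lambda>s. h (s + c)) = Sum_any h" for c :: int
  by (rule Sum_any.reindex_cong[symmetric, of "\<lambda>s. s + c"])
     (auto simp: bij_plus_right comp_def)

lemma Sum_any_uminus_shift: "Sum_any (\<lambda>s. h (c - s)) = Sum_any h" for c :: int
  by (rule Sum_any.reindex_cong[symmetric, of "\<lambda>s. c - s"])
     (auto simp: comp_def intro!: bij_betw_byWitness[of _ "\<lambda>s. c - s"])

text \<open>\<open>theta_power g d s K\<close> is the coefficient of \<open>z\<^sup>s q\<^sup>K\<close> in \<open>g(q) (\<Sum>n. (-1)\<^sup>n z\<^sup>n q\<^bsup>n(n+1)/2\<^esup>)\<^sup>d\<close>.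
  Integer exponents of \<open>q\<close> are allowed because quasi-periodicity shifts them in both directions.\<close>

primrec theta_power :: "int fps \<Rightarrow> nat \<Rightarrow> int \<Rightarrow> int \<Rightarrow> int" where
  "theta_power g 0 s K = (if s = 0 then int_nth g K else 0)"
| "theta_power g (Suc d) s K = Sum_any (\<lambda>n. alt_sign n * theta_power g d (s - n) (K - tri n))"

lemma theta_power_neg: "K < 0 \<Longrightarrow> theta_power g d s K = 0"
proof (induction d arbitrary: s K)
  case (Suc d)
  have "theta_power g d (s - n) (K - tri n) = 0" for n
    using Suc tri_nonneg[of n] by simp
  then show ?case by simp
qed (simp add: int_nth_def)

lemma theta_power_Suc_neutral: "alt_sign n * theta_power g d (s - n) (K - tri n) \<noteq> 0 \<Longrightarrow> tri n \<le> K"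
  using theta_power_neg[of "K - tri n"] by (cases "K - tri n < 0") auto

lemma finite_theta_power_Suc: "finite {n. alt_sign n * theta_power g d (s - n) (K - tri n) \<noteq> 0}"
proof (rule finite_subset)
  show "{n. alt_sign n * theta_power g d (s - n) (K - tri n) \<noteq> 0} \<subseteq> {- K - 1..K}"
    using theta_power_Suc_neutral tri_bound by blast
qed simp

lemma theta_power_Suc_sum:
  assumes "finite A" "\<And>n. tri n \<le> K \<Longrightarrow> n \<in> A"
  shows "theta_power g (Suc d) s K = (\<Sum>n\<in>A. alt_sign n * theta_power g d (s - n) (K - tri n))"
  unfolding theta_power.simps
  by (rule Sum_any.expand_superset[OF assms(1)]) (use assms(2) theta_power_Suc_neutral in blast)

text \<open>Cauchy-Schwarz. If s = n_1 + ... + n_d, then 2 s + d is the sum of the 2 n_i + 1, and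
  the squares of these add up to 8 times the sum of the \<open>tri n_i\<close> plus d.\<close>

lemma theta_power_support:
  "theta_power g d s K \<noteq> 0 \<Longrightarrow> (2 * s + int d)\<^sup>2 \<le> int d * (8 * K + int d)"
proof (induction d arbitrary: s K)
  case (Suc d)
  then obtain n where n: "theta_power g d (s - n) (K - tri n) \<noteq> 0"
    unfolding theta_power.simps by (metis (no_types, lifting) Sum_any.not_neutral_obtains_not_neutral mult_zero_right)
  define y Y D L where "y = 2 * n + 1" and "Y = 2 * (s - n) + int d" and "D = int d" and "L = 8 * (K - tri n) + int d"
  have y2: "8 * tri n = y\<^sup>2 - 1"
    using two_tri[of n] by (simp add: y_def power2_eq_square algebra_simps)
  have IH: "Y\<^sup>2 \<le> D * L"
    using Suc.IH[OF n] by (simp add: Y_def D_def L_def)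
  have D0: "D \<ge> 0" by (simp add: D_def)
  have "(Y + y)\<^sup>2 \<le> (D + 1) * (L + y\<^sup>2)"
  proof (cases "D = 0")
    case True
    then have "Y = 0" using IH by simp
    moreover have "s = n" "L = 8 * (K - tri n)" using \<open>Y = 0\<close> True by (auto simp: Y_def D_def L_def)
    moreover have "K - tri n \<ge> 0" using n theta_power_neg by (meson not_less)
    ultimately show ?thesis using True by simp
  next
    case False
    \<comment> \<open>After multiplication by D the defect in Cauchy-Schwarz is a nonnegative
      combination of the inductive defect and a square.\<close>
    have "D * ((D + 1) * (L + y\<^sup>2)) - D * (Y + y)\<^sup>2 = (D + 1) * (D * L - Y\<^sup>2) + (Y - D * y)\<^sup>2"
      by (simp add: power2_eq_square algebra_simps)
    also have "\<dots> \<ge> 0"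
      using IH D0 by simp
    finally have "D * (Y + y)\<^sup>2 \<le> D * ((D + 1) * (L + y\<^sup>2))" by simp
    then show ?thesis using False D0 by (simp add: mult_le_cancel_left)
  qed
  moreover have "2 * s + int (Suc d) = Y + y" "8 * K + int (Suc d) = L + y\<^sup>2" "int (Suc d) = D + 1"
    using y2 by (auto simp: Y_def y_def L_def D_def)
  ultimately show ?case by (simp add: add.commute)
qed (auto split: if_splits)

lemma finite_theta_power: "finite {s. h s * theta_power g d s K \<noteq> 0}"
proof (rule finite_subset)
  let ?B = "int d * (8 * K + int d) + int d"
  show "{s. h s * theta_power g d s K \<noteq> 0} \<subseteq> {- ?B..?B}"
  proof
    fix s assume "s \<in> {s. h s * theta_power g d s K \<noteq> 0}"
    then have "(2 * s + int d)\<^sup>2 \<le> int d * (8 * K + int d)"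
      by (auto intro: theta_power_support)
    moreover have "\<bar>2 * s + int d\<bar> \<le> (2 * s + int d)\<^sup>2"
      using self_le_power[of "\<bar>2 * s + int d\<bar>" 2] by (cases "2 * s + int d = 0") auto
    ultimately show "s \<in> {- ?B..?B}" by auto
  qed
qed simp

text \<open>Quasi-periodicity under z -> q z: replacing n by n + 1 raises \<open>tri n\<close> by n
  + 1 and costs one sign per factor.\<close>

lemma theta_power_shift: "theta_power g d (s + int d) (K + s + int d) = (-1) ^ d * theta_power g d s K"
proof (induction d arbitrary: s K)
  case (Suc d)
  let ?h = "\<lambda>n. alt_sign n * theta_power g d (s + int (Suc d) - n) (K + s + int (Suc d) - tri n)"
  have "theta_power g (Suc d) (s + int (Suc d)) (K + s + int (Suc d)) = Sum_any (\<lambda>n. ?h (n + 1))"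
    unfolding theta_power.simps by (rule Sum_any_shift[of ?h 1, symmetric])
  also have "\<dots> = Sum_any (\<lambda>n. (-1) ^ Suc d * (alt_sign n * theta_power g d (s - n) (K - tri n)))"
  proof (rule arg_cong[where f = Sum_any], rule ext)
    fix n
    have eqs: "s + int (Suc d) - (n + 1) = (s - n) + int d"
      "K + s + int (Suc d) - tri (n + 1) = (K - tri n) + (s - n) + int d"
      "alt_sign (n + 1) = - alt_sign n"
      by (simp_all add: tri_add) (simp_all add: tri_def alt_sign_def)
    show "?h (n + 1) = (-1) ^ Suc d * (alt_sign n * theta_power g d (s - n) (K - tri n))"
      unfolding eqs Suc.IH by simp
  qed
  also have "\<dots> = (-1) ^ Suc d * theta_power g (Suc d) s K"
    by (simp only: theta_power.simps Sum_any_right_distrib[OF finite_theta_power_Suc])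
  finally show ?case .
qed simp

text \<open>The symmetry z -> 1/z: the map n -> - 1 - n fixes \<open>tri n\<close> and changes the
  sign.\<close>

lemma theta_power_symmetric: "theta_power g d (- s - int d) K = (-1) ^ d * theta_power g d s K"
proof (induction d arbitrary: s K)
  case (Suc d)
  let ?h = "\<lambda>n. alt_sign n * theta_power g d (- s - int (Suc d) - n) (K - tri n)"
  have "theta_power g (Suc d) (- s - int (Suc d)) K = Sum_any (\<lambda>n. ?h (- 1 - n))"
    unfolding theta_power.simps by (rule Sum_any_uminus_shift[of ?h "-1", symmetric])
  also have "\<dots> = Sum_any (\<lambda>n. (-1) ^ Suc d * (alt_sign n * theta_power g d (s - n) (K - tri n)))"
  proof (rule arg_cong[where f = Sum_any], rule ext)
    fix n
    have eqs: "- s - int (Suc d) - (- 1 - n) = - (s - n) - int d"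
      "tri (- 1 - n) = tri n" "alt_sign (- 1 - n) = - alt_sign n"
      by (simp_all add: tri_def alt_sign_def algebra_simps)
    show "?h (- 1 - n) = (-1) ^ Suc d * (alt_sign n * theta_power g d (s - n) (K - tri n))"
      unfolding eqs Suc.IH by simp
  qed
  also have "\<dots> = (-1) ^ Suc d * theta_power g (Suc d) s K"
    by (simp only: theta_power.simps Sum_any_right_distrib[OF finite_theta_power_Suc])
  finally show ?case .
qed auto


section \<open>Moments of theta powers as quasimodular forms\<close>

text \<open>With z = exp(2 u) this is the b-th derivative at u = 0 of g(q) (exp(u) theta(exp(2
  u)))^d; the shift 2 s + d centres the exponents.\<close>

definition theta_moment :: "int fps \<Rightarrow> nat \<Rightarrow> nat \<Rightarrow> int fps" where
  "theta_moment g d b = Abs_fps (\<lambda>k. Sum_any (\<lambda>s. (2 * s + int d) ^ b * theta_power g d s (int k)))"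

text \<open>The i-th derivative at u = 0 of the single factor exp(u) theta(exp(2 u)).\<close>

definition theta_deriv :: "nat \<Rightarrow> int fps" where
  "theta_deriv i = Abs_fps (\<lambda>k. \<Sum>n | tri n = int k. alt_sign n * (2 * n + 1) ^ i)"

lemma finite_tri_eq [simp]: "finite {n. tri n = K}"
  by (rule finite_subset[of _ "{- K - 1..K}"]) (use tri_bound in auto)

lemma int_nth_of_nat [simp]: "int_nth f (int k) = fps_nth f k"
  by (simp add: int_nth_def)

lemma theta_moment_int_nth: "int_nth (theta_moment g d b) K = Sum_any (\<lambda>s. (2 * s + int d) ^ b * theta_power g d s K)"
  by (cases "K < 0") (auto simp: int_nth_def theta_moment_def theta_power_neg)

lemma theta_moment_0: "theta_moment g 0 b = (if b = 0 then g else 0)"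
proof (rule fps_ext)
  fix k
  have "(\<lambda>s. (2 * s + int 0) ^ b * theta_power g 0 s (int k)) = (\<lambda>s. if s = 0 then 0 ^ b * fps_nth g k else 0)"
    by auto
  then have "fps_nth (theta_moment g 0 b) k = 0 ^ b * fps_nth g k"
    unfolding theta_moment_def fps_nth_Abs_fps by (simp only: Sum_any.delta)
  then show "fps_nth (theta_moment g 0 b) k = fps_nth (if b = 0 then g else 0) k"
    by (auto simp: power_0_left)
qed

lemma theta_deriv_mult_nth:
  "fps_nth (theta_deriv i * f) k = (\<Sum>n\<in>{- int k - 1..int k}. alt_sign n * (2 * n + 1) ^ i * int_nth f (int k - tri n))"
proof -
  let ?A = "{n\<in>{- int k - 1..int k}. tri n \<le> int k}"
  have "fps_nth (theta_deriv i * f) k = (\<Sum>j\<in>{0..k}. \<Sum>n\<in>{n\<in>?A. nat (tri n) = j}. alt_sign n * (2 * n + 1) ^ i * int_nth f (int k - tri n))"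
    unfolding fps_mult_nth
  proof (rule sum.cong)
    fix j assume j: "j \<in> {0..k}"
    have "{n. tri n = int j} = {n\<in>?A. nat (tri n) = j}"
      using j tri_nonneg tri_bound by (fastforce simp: nat_eq_iff2)
    moreover have "int_nth f (int k - int j) = fps_nth f (k - j)"
      using j by (simp add: int_nth_def nat_diff_distrib')
    ultimately show "fps_nth (theta_deriv i) j * fps_nth f (k - j) =
        (\<Sum>n\<in>{n\<in>?A. nat (tri n) = j}. alt_sign n * (2 * n + 1) ^ i * int_nth f (int k - tri n))"
      using tri_nonneg by (auto simp: theta_deriv_def sum_distrib_right nat_eq_iff2 intro!: sum.cong)
  qed simp
  also have "\<dots> = (\<Sum>n\<in>?A. alt_sign n * (2 * n + 1) ^ i * int_nth f (int k - tri n))"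
    by (rule sum.group) (auto simp: nat_le_iff intro: finite_subset[of _ "{- int k - 1..int k}"])
  also have "\<dots> = (\<Sum>n\<in>{- int k - 1..int k}. alt_sign n * (2 * n + 1) ^ i * int_nth f (int k - tri n))"
    by (rule sum.mono_neutral_left) (auto simp: int_nth_def)
  finally show ?thesis .
qed

text \<open>Leibniz rule for one factor times the product of the remaining d.\<close>

lemma theta_moment_Suc:
  "theta_moment g (Suc d) b = (\<Sum>i\<le>b. of_nat (b choose i) * theta_deriv i * theta_moment g d (b - i))"
proof (rule fps_ext)
  fix k
  let ?K = "int k" let ?A = "{- int k - 1..int k}"
  let ?t = "\<lambda>n s. theta_power g d s (?K - tri n)"
  have fin: "finite {s. h s * (c * theta_power g d (s - n) K) \<noteq> 0}" for h c n K
  proof -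
    have "finite ((\<lambda>s. s + n) ` {s. 1 * theta_power g d s K \<noteq> 0})"
      by (intro finite_imageI finite_theta_power)
    moreover have "{s. h s * (c * theta_power g d (s - n) K) \<noteq> 0} \<subseteq> (\<lambda>s. s + n) ` {s. 1 * theta_power g d s K \<noteq> 0}"
    proof
      fix s assume "s \<in> {s. h s * (c * theta_power g d (s - n) K) \<noteq> 0}"
      then have "s - n \<in> {s. 1 * theta_power g d s K \<noteq> 0}" by auto
      then show "s \<in> (\<lambda>s. s + n) ` {s. 1 * theta_power g d s K \<noteq> 0}"
        by (rule rev_image_eqI) simp
    qed
    ultimately show ?thesis by (rule rev_finite_subset)
  qed
  have "fps_nth (theta_moment g (Suc d) b) k
      = Sum_any (\<lambda>s. (2 * s + int (Suc d)) ^ b * (\<Sum>n\<in>?A. alt_sign n * ?t n (s - n)))"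
    unfolding theta_moment_def fps_nth_Abs_fps
    by (subst theta_power_Suc_sum[of ?A]) (use tri_bound in auto)
  also have "\<dots> = Sum_any (\<lambda>s. \<Sum>n\<in>?A. (2 * s + int (Suc d)) ^ b * (alt_sign n * ?t n (s - n)))"
    by (simp only: sum_distrib_left)
  also have "\<dots> = (\<Sum>n\<in>?A. Sum_any (\<lambda>s. (2 * s + int (Suc d)) ^ b * (alt_sign n * ?t n (s - n))))"
    by (rule Sum_any_sum_swap) (rule fin)
  also have "\<dots> = (\<Sum>n\<in>?A. Sum_any (\<lambda>s. \<Sum>i\<le>b. of_nat (b choose i) * (alt_sign n * (2 * n + 1) ^ i) * ((2 * s + int d) ^ (b - i) * ?t n s)))"
  proof (rule sum.cong)
    fix n
    have "Sum_any (\<lambda>s. (2 * s + int (Suc d)) ^ b * (alt_sign n * ?t n (s - n)))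
        = Sum_any (\<lambda>s. (2 * (s + n) + int (Suc d)) ^ b * (alt_sign n * ?t n (s + n - n)))"
      by (rule Sum_any_shift[symmetric])
    also have "(\<lambda>s. (2 * (s + n) + int (Suc d)) ^ b * (alt_sign n * ?t n (s + n - n)))
        = (\<lambda>s. \<Sum>i\<le>b. of_nat (b choose i) * (alt_sign n * (2 * n + 1) ^ i) * ((2 * s + int d) ^ (b - i) * ?t n s))"
    proof
      fix s
      have "(2 * (s + n) + int (Suc d)) ^ b = ((2 * n + 1) + (2 * s + int d)) ^ b"
        by (simp add: algebra_simps)
      also have "\<dots> = (\<Sum>i\<le>b. of_nat (b choose i) * (2 * n + 1) ^ i * (2 * s + int d) ^ (b - i))"
        by (rule binomial_ring)
      finally show "(2 * (s + n) + int (Suc d)) ^ b * (alt_sign n * ?t n (s + n - n))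
          = (\<Sum>i\<le>b. of_nat (b choose i) * (alt_sign n * (2 * n + 1) ^ i) * ((2 * s + int d) ^ (b - i) * ?t n s))"
        by (simp add: sum_distrib_left sum_distrib_right mult_ac)
    qed
    finally show "Sum_any (\<lambda>s. (2 * s + int (Suc d)) ^ b * (alt_sign n * ?t n (s - n))) = Sum_any \<dots>" .
  qed simp
  also have "\<dots> = (\<Sum>n\<in>?A. \<Sum>i\<le>b. of_nat (b choose i) * (alt_sign n * (2 * n + 1) ^ i) * int_nth (theta_moment g d (b - i)) (?K - tri n))"
  proof (rule sum.cong)
    fix n
    have "Sum_any (\<lambda>s. \<Sum>i\<le>b. of_nat (b choose i) * (alt_sign n * (2 * n + 1) ^ i) * ((2 * s + int d) ^ (b - i) * ?t n s))
        = (\<Sum>i\<le>b. Sum_any (\<lambda>s. of_nat (b choose i) * (alt_sign n * (2 * n + 1) ^ i) * ((2 * s + int d) ^ (b - i) * ?t n s)))"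
      by (rule Sum_any_sum_swap) (simp only: mult.assoc[symmetric], rule finite_theta_power)
    then show "Sum_any (\<lambda>s. \<Sum>i\<le>b. of_nat (b choose i) * (alt_sign n * (2 * n + 1) ^ i) * ((2 * s + int d) ^ (b - i) * ?t n s))
        = (\<Sum>i\<le>b. of_nat (b choose i) * (alt_sign n * (2 * n + 1) ^ i) * int_nth (theta_moment g d (b - i)) (?K - tri n))"
      by (simp only: theta_moment_int_nth Sum_any_right_distrib[OF finite_theta_power])
  qed simp
  also have "\<dots> = (\<Sum>i\<le>b. of_nat (b choose i) * fps_nth (theta_deriv i * theta_moment g d (b - i)) k)"
    unfolding theta_deriv_mult_nth by (subst sum.swap) (simp add: sum_distrib_left mult_ac)
  also have "\<dots> = fps_nth (\<Sum>i\<le>b. of_nat (b choose i) * theta_deriv i * theta_moment g d (b - i)) k"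
    by (simp add: fps_sum_nth mult.assoc)
  finally show "fps_nth (theta_moment g (Suc d) b) k = \<dots>" .
qed

text \<open>The function exp(u) theta(exp(2 u)) is odd in u, by n -> - 1 - n.\<close>

lemma theta_deriv_even: "even i \<Longrightarrow> theta_deriv i = 0"
proof (rule fps_ext)
  fix k assume "even i"
  have "fps_nth (theta_deriv i) k = (\<Sum>n | tri n = int k. alt_sign (- 1 - n) * (2 * (- 1 - n) + 1) ^ i)"
    unfolding theta_deriv_def fps_nth_Abs_fps
    by (rule sum.reindex_bij_witness[of _ "\<lambda>n. - 1 - n" "\<lambda>n. - 1 - n"]) (auto simp: tri_def algebra_simps)
  also have "\<dots> = (\<Sum>n | tri n = int k. - (alt_sign n * (2 * n + 1) ^ i))"
  proof (rule sum.cong)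
    fix n :: int
    have "2 * (- 1 - n) + 1 = - (2 * n + 1)" by simp
    then have "(2 * (- 1 - n) + 1) ^ i = (2 * n + 1) ^ i"
      using \<open>even i\<close> by (simp only: power_minus_even)
    then show "alt_sign (- 1 - n) * (2 * (- 1 - n) + 1) ^ i = - (alt_sign n * (2 * n + 1) ^ i)"
      by (simp add: alt_sign_def)
  qed simp
  also have "\<dots> = - fps_nth (theta_deriv i) k"
    by (simp add: theta_deriv_def sum_negf)
  finally show "fps_nth (theta_deriv i) k = fps_nth 0 k" by simp
qed

text \<open>The terms with n >= 0 and with n < 0 contribute equally, and each half is Jacobi's
  series.\<close>

lemma theta_deriv_1: "theta_deriv 1 = 2 * euler_E ^ 3"
proof (rule fps_ext)
  fix k
  have "fps_nth (theta_deriv 1) k = (\<Sum>n\<in>{n\<in>{n. tri n = int k}. n \<ge> 0} \<union> {n\<in>{n. tri n = int k}. n < 0}. alt_sign n * (2 * n + 1))"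
    unfolding theta_deriv_def fps_nth_Abs_fps by (rule sum.cong) auto
  also have "\<dots> = (\<Sum>n\<in>{n\<in>{n. tri n = int k}. n \<ge> 0}. alt_sign n * (2 * n + 1))
      + (\<Sum>n\<in>{n\<in>{n. tri n = int k}. n < 0}. alt_sign n * (2 * n + 1))"
    by (rule sum.union_disjoint) (auto intro: finite_subset[OF _ finite_tri_eq])
  also have "(\<Sum>n\<in>{n\<in>{n. tri n = int k}. n < 0}. alt_sign n * (2 * n + 1))
      = (\<Sum>n\<in>{n\<in>{n. tri n = int k}. n \<ge> 0}. alt_sign n * (2 * n + 1))"
    by (rule sum.reindex_bij_witness[of _ "\<lambda>n. - 1 - n" "\<lambda>n. - 1 - n"])
       (auto simp: tri_def algebra_simps alt_sign_def)
  also have "(\<Sum>n\<in>{n\<in>{n. tri n = int k}. n \<ge> 0}. alt_sign n * (2 * n + 1))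
      = (\<Sum>j | j * (j + 1) div 2 = k. (-1) ^ j * (2 * int j + 1))"
  proof (rule sum.reindex_bij_witness[of _ int nat])
    fix j assume "j \<in> {j. j * (j + 1) div 2 = k}"
    then have "int (j * (j + 1) div 2) = int k" by simp
    then show "int j \<in> {n\<in>{n. tri n = int k}. n \<ge> 0}"
      by (simp add: tri_def zdiv_int algebra_simps)
  next
    fix n assume n: "n \<in> {n\<in>{n. tri n = int k}. n \<ge> 0}"
    then have "int (nat n * (nat n + 1) div 2) = int k"
      by (simp add: tri_def zdiv_int algebra_simps)
    then show "nat n \<in> {j. j * (j + 1) div 2 = k}"
      by (simp only: of_nat_eq_iff mem_Collect_eq)
    show "(-1) ^ nat n * (2 * int (nat n) + 1) = alt_sign n * (2 * n + 1)"
      using n by (auto simp: alt_sign_def minus_one_power_iff even_nat_iff)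
  qed auto
  finally show "fps_nth (theta_deriv 1) k = fps_nth (2 * euler_E ^ 3) k"
    by (simp add: jacobi_euler_E_cubed numeral_fps_const)
qed

text \<open>The heat equation: (2 n + 1)^2 = 8 \<open>tri n\<close> + 1, so two derivatives in u
  amount to 8 D + 1 in q.\<close>

lemma theta_deriv_add_2: "theta_deriv (i + 2) = 8 * qderiv (theta_deriv i) + theta_deriv i"
proof (rule fps_ext)
  fix k
  have "fps_nth (theta_deriv (i + 2)) k = (\<Sum>n | tri n = int k. (8 * int k + 1) * (alt_sign n * (2 * n + 1) ^ i))"
    unfolding theta_deriv_def fps_nth_Abs_fps
  proof (rule sum.cong)
    fix n assume "n \<in> {n. tri n = int k}"
    then have sq: "(2 * n + 1) ^ 2 = 8 * int k + 1"
      using two_tri[of n] by (simp add: power2_eq_square algebra_simps)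
    show "alt_sign n * (2 * n + 1) ^ (i + 2) = (8 * int k + 1) * (alt_sign n * (2 * n + 1) ^ i)"
      unfolding power_add sq by (simp only: mult_ac)
  qed simp
  then show "fps_nth (theta_deriv (i + 2)) k = fps_nth (8 * qderiv (theta_deriv i) + theta_deriv i) k"
    by (simp add: theta_deriv_def numeral_fps_const sum_distrib_left sum.distrib algebra_simps)
qed

definition fps_of_int_fps :: "int fps \<Rightarrow> rat fps" where
  "fps_of_int_fps f = Abs_fps (\<lambda>n. of_int (fps_nth f n))"

lemma fps_of_int_fps_mult: "fps_of_int_fps (f * g) = fps_of_int_fps f * fps_of_int_fps g"
  by (rule fps_ext) (simp add: fps_of_int_fps_def fps_mult_nth)

lemma fps_of_int_fps_sum: "fps_of_int_fps (sum f A) = (\<Sum>i\<in>A. fps_of_int_fps (f i))"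
  by (rule fps_ext) (simp add: fps_of_int_fps_def fps_sum_nth)

lemma fps_of_int_fps_of_nat: "fps_of_int_fps (of_nat n * f) = fps_const (of_nat n) * fps_of_int_fps f"
  by (rule fps_ext) (simp add: fps_of_int_fps_def)

lemma fps_of_int_fps_eq_iff [simp]: "fps_of_int_fps f = fps_of_int_fps g \<longleftrightarrow> f = g"
  by (auto simp: fps_of_int_fps_def fps_eq_iff)

text \<open>Exponential generating function in u, over the rationals because of the factorials. It
  turns binomial convolutions into products, so that the power rule for derivatives becomes
  available.\<close>

definition egf :: "(nat \<Rightarrow> int fps) \<Rightarrow> rat fps fps" where
  "egf a = Abs_fps (\<lambda>b. fps_const (1 / fact b) * fps_of_int_fps (a b))"

lemma egf_eq_iff: "egf a = egf c \<longleftrightarrow> a = c"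
proof
  assume "egf a = egf c"
  have "a b = c b" for b
  proof -
    have "fps_const (1 / fact b) * fps_of_int_fps (a b) = fps_const (1 / fact b) * fps_of_int_fps (c b)"
      using \<open>egf a = egf c\<close> by (simp add: egf_def fps_eq_iff)
    then have "fps_const (fact b) * (fps_const (1 / fact b) * fps_of_int_fps (a b)) = fps_const (fact b) * (fps_const (1 / fact b) * fps_of_int_fps (c b))"
      by (simp only:)
    then show ?thesis
      by (simp only: mult.assoc[symmetric] fps_const_mult) simp
  qed
  then show "a = c" by blast
qed simp

lemma egf_mult: "egf a * egf c = egf (\<lambda>b. \<Sum>i\<le>b. of_nat (b choose i) * a i * c (b - i))"
proof (rule fps_ext)
  fix b
  have "fps_nth (egf a * egf c) b = (\<Sum>i\<le>b. fps_const (1 / fact b) * (fps_const (of_nat (b choose i)) * (fps_of_int_fps (a i) * fps_of_int_fps (c (b - i)))))"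
    unfolding fps_mult_nth atLeast0AtMost
  proof (rule sum.cong)
    fix i assume "i \<in> {..b}"
    then have "(1 / fact i) * (1 / fact (b - i)) = (1 / fact b) * (of_nat (b choose i) :: rat)"
      by (simp add: binomial_fact)
    then have "fps_const (1 / fact i) * fps_const (1 / fact (b - i)) = fps_const (1 / fact b) * fps_const (of_nat (b choose i) :: rat)"
      by (simp only: fps_const_mult)
    then show "fps_nth (egf a) i * fps_nth (egf c) (b - i) = fps_const (1 / fact b) * (fps_const (of_nat (b choose i)) * (fps_of_int_fps (a i) * fps_of_int_fps (c (b - i))))"
      unfolding egf_def fps_nth_Abs_fps by algebra
  qed simp
  also have "\<dots> = fps_nth (egf (\<lambda>b. \<Sum>i\<le>b. of_nat (b choose i) * a i * c (b - i))) b"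
  proof -
    have "fps_of_int_fps (of_nat n * f * h) = fps_const (of_nat n) * (fps_of_int_fps f * fps_of_int_fps h)" for n f h
      unfolding mult.assoc by (subst fps_of_int_fps_of_nat) (simp only: fps_of_int_fps_mult)
    then show ?thesis
      by (simp only: egf_def fps_nth_Abs_fps fps_of_int_fps_sum sum_distrib_left)
  qed
  finally show "fps_nth (egf a * egf c) b = \<dots>" .
qed

lemma fps_deriv_egf: "fps_deriv (egf a) = egf (\<lambda>b. a (Suc b))"
proof (rule fps_ext)
  fix b
  have "of_nat (Suc b) * fps_const (1 / fact (Suc b)) = (fps_const (1 / fact b) :: rat fps)"
    by (simp only: fps_of_nat[symmetric] fps_const_mult fact_Suc) simp
  then show "fps_nth (fps_deriv (egf a)) b = fps_nth (egf (\<lambda>b. a (Suc b))) b"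
    by (simp only: fps_deriv_nth egf_def fps_nth_Abs_fps mult.assoc[symmetric] Suc_eq_plus1[symmetric])
qed

lemma egf_of_nat_mult: "of_nat d * egf a = egf (\<lambda>b. of_nat d * a b)"
  by (rule fps_ext) (simp only: fps_mult_of_nat_nth egf_def fps_nth_Abs_fps fps_of_int_fps_of_nat fps_of_nat mult_ac)

lemma egf_theta_moment: "egf (theta_moment g d) = egf theta_deriv ^ d * egf (theta_moment g 0)"
proof (induction d)
  case (Suc d)
  have "egf (theta_moment g (Suc d)) = egf theta_deriv * egf (theta_moment g d)"
    unfolding egf_mult by (rule arg_cong[where f = egf]) (simp add: theta_moment_Suc fun_eq_iff)
  then show ?case by (simp add: Suc.IH mult.assoc)
qed simp

text \<open>With \<open>T\<close> the generating function of the derivatives of theta and \<open>F\<close> that of the moments of its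
  \<open>d\<close>-th power, this is the identity \<open>T F' = d T' F\<close>.\<close>

lemma theta_moment_recursion:
  "(\<Sum>i\<le>b. of_nat (b choose i) * theta_deriv i * theta_moment g d (Suc (b - i)))
     = of_nat d * (\<Sum>i\<le>b. of_nat (b choose i) * theta_deriv (Suc i) * theta_moment g d (b - i))"
proof -
  let ?T = "egf theta_deriv" and ?F = "egf (theta_moment g d)"
  have F0: "fps_deriv (egf (theta_moment g 0)) = 0"
    unfolding fps_deriv_egf by (rule fps_ext) (simp add: egf_def theta_moment_0 fps_of_int_fps_def fps_eq_iff)
  have "?T * fps_deriv ?F = of_nat d * (fps_deriv ?T * ?F)"
  proof (cases d)
    case (Suc d')
    have "fps_deriv ?F = of_nat d * ?T ^ d' * fps_deriv ?T * egf (theta_moment g 0)"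
      unfolding egf_theta_moment[of g d] by (simp add: F0 Suc fps_deriv_power' mult_ac del: power_Suc)
    then show ?thesis
      unfolding egf_theta_moment[of g d] by (simp add: Suc mult_ac)
  qed (simp add: F0)
  also have "\<dots> = egf (\<lambda>b. of_nat d * (\<Sum>i\<le>b. of_nat (b choose i) * theta_deriv (Suc i) * theta_moment g d (b - i)))"
    unfolding fps_deriv_egf egf_mult by (rule egf_of_nat_mult)
  finally have "egf (\<lambda>b. \<Sum>i\<le>b. of_nat (b choose i) * theta_deriv i * theta_moment g d (Suc (b - i))) = \<dots>"
    unfolding fps_deriv_egf egf_mult .
  then show ?thesis
    unfolding egf_eq_iff by (rule fun_cong)
qed

text \<open>Each factor vanishes at u = 0, so the d-th power vanishes there to order d.\<close>

lemma theta_moment_less: "b < d \<Longrightarrow> theta_moment g d b = 0"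
proof (induction d arbitrary: b)
  case (Suc d)
  have "theta_deriv i * theta_moment g d (b - i) = 0" if "i \<le> b" for i
    using Suc that by (cases "i = 0") (auto simp: theta_deriv_even)
  then show ?case
    unfolding theta_moment_Suc by (intro sum.neutral) (simp add: mult.assoc)
qed simp

lemma theta_moment_parity: "odd (b + d) \<Longrightarrow> theta_moment g d b = 0"
proof (induction d arbitrary: b)
  case 0
  then have "b \<noteq> 0" by (cases b) auto
  then show ?case by (simp add: theta_moment_0)
next
  case (Suc d)
  have "theta_deriv i * theta_moment g d (b - i) = 0" if "i \<le> b" for i
  proof (cases "even i")
    case False
    then show ?thesis using Suc that by simp
  qed (simp add: theta_deriv_even)
  then show ?case
    unfolding theta_moment_Suc by (intro sum.neutral) (simp add: mult.assoc)
qed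

lemma theta_moment_lowest: "theta_moment g d d = fact d * theta_deriv 1 ^ d * g"
proof (induction d)
  case (Suc d)
  have "(\<Sum>i\<le>Suc d. of_nat (Suc d choose i) * theta_deriv i * theta_moment g d (Suc d - i))
      = (\<Sum>i\<in>{1}. of_nat (Suc d choose i) * theta_deriv i * theta_moment g d (Suc d - i))"
  proof (rule sum.mono_neutral_right)
    show "\<forall>i\<in>{..Suc d} - {1}. of_nat (Suc d choose i) * theta_deriv i * theta_moment g d (Suc d - i) = 0"
    proof
      fix i assume "i \<in> {..Suc d} - {1}"
      then have "i = 0 \<or> Suc d - i < d" by auto
      then show "of_nat (Suc d choose i) * theta_deriv i * theta_moment g d (Suc d - i) = 0"
        by (auto simp: theta_deriv_even theta_moment_less)
    qed
  qed auto
  then show ?case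
    unfolding theta_moment_Suc by (simp add: Suc.IH mult_ac)
qed (simp add: theta_moment_0)

text \<open>In \<open>theta_moment_recursion\<close> only odd derivatives of theta and moments of
  even order at least 8 survive. The term j = 0 has the coefficient (8 + 2 k) - 8 = 2 k and isolates
  the highest moment.\<close>

lemma theta_moment_8_recursion:
  "2 * of_nat k * theta_deriv 1 * theta_moment g 8 (8 + 2 * k) =
     (\<Sum>j\<in>{1..k}. of_int (8 * int ((8 + 2 * k) choose (2 * j)) - int ((8 + 2 * k) choose (2 * j + 1)))
        * theta_deriv (2 * j + 1) * theta_moment g 8 (8 + 2 * (k - j)))"
proof -
  let ?b = "8 + 2 * k"
  let ?f = "\<lambda>i. of_nat (?b choose i) * theta_deriv i * theta_moment g 8 (Suc (?b - i))"
  let ?g = "\<lambda>i. of_nat (?b choose i) * theta_deriv (Suc i) * theta_moment g 8 (?b - i)"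
  have "?f i = 0" if "i \<le> ?b" "i \<notin> (\<lambda>j. 2 * j + 1) ` {..k}" for i
  proof (cases "even i")
    case False
    then obtain j where j: "i = 2 * j + 1" by (elim oddE)
    then have "k < j" using that by auto
    then have "Suc (?b - i) < 8" using j that by linarith
    then show ?thesis by (simp add: theta_moment_less)
  qed (simp add: theta_deriv_even)
  then have "(\<Sum>i\<le>?b. ?f i) = sum ?f ((\<lambda>j. 2 * j + 1) ` {..k})"
    by (intro sum.mono_neutral_right) auto
  also have "\<dots> = (\<Sum>j\<le>k. ?f (2 * j + 1))"
    by (subst sum.reindex) (auto simp: inj_on_def)
  also have "\<dots> = (\<Sum>j\<le>k. of_nat (?b choose (2 * j + 1)) * theta_deriv (2 * j + 1) * theta_moment g 8 (8 + 2 * (k - j)))"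
    by (rule sum.cong) (auto intro!: arg_cong2[where f = times] arg_cong[where f = "theta_moment g 8"])
  finally have f: "(\<Sum>i\<le>?b. ?f i) = \<dots>" .
  have "?g i = 0" if "i \<le> ?b" "i \<notin> (\<lambda>j. 2 * j) ` {..k}" for i
  proof (cases "even i")
    case True
    then obtain j where j: "i = 2 * j" by (elim evenE)
    then have "k < j" using that by auto
    then have "?b - i < 8" using j that by linarith
    then show ?thesis by (simp add: theta_moment_less)
  qed (simp add: theta_deriv_even)
  then have "(\<Sum>i\<le>?b. ?g i) = sum ?g ((\<lambda>j. 2 * j) ` {..k})"
    by (intro sum.mono_neutral_right) auto
  also have "\<dots> = (\<Sum>j\<le>k. ?g (2 * j))"
    by (subst sum.reindex) (auto simp: inj_on_def)
  also have "\<dots> = (\<Sum>j\<le>k. of_nat (?b choose (2 * j)) * theta_deriv (2 * j + 1) * theta_moment g 8 (8 + 2 * (k - j)))"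
    by (rule sum.cong) (auto intro!: arg_cong2[where f = times] arg_cong[where f = "theta_moment g 8"])
  finally have g: "(\<Sum>i\<le>?b. ?g i) = \<dots>" .
  have "(\<Sum>j\<le>k. of_nat (?b choose (2 * j + 1)) * theta_deriv (2 * j + 1) * theta_moment g 8 (8 + 2 * (k - j)))
      = 8 * (\<Sum>j\<le>k. of_nat (?b choose (2 * j)) * theta_deriv (2 * j + 1) * theta_moment g 8 (8 + 2 * (k - j)))"
    using theta_moment_recursion[of ?b g 8] unfolding f g by simp
  then have "(\<Sum>j\<le>k. of_int (8 * int (?b choose (2 * j)) - int (?b choose (2 * j + 1)))
        * theta_deriv (2 * j + 1) * theta_moment g 8 (8 + 2 * (k - j))) = 0"
    by (simp add: sum_distrib_left sum_subtractf left_diff_distrib mult.assoc)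
  then show ?thesis
    by (simp add: atMost_atLeast0 sum.atLeast_Suc_atMost algebra_simps)
qed

definition qderiv24 :: "int fps \<Rightarrow> int fps" where
  "qderiv24 f = 24 * qderiv f"

lemma qderiv24_simps [simp]:
  "qderiv24 (f + g) = qderiv24 f + qderiv24 g"
  "qderiv24 (f - g) = qderiv24 f - qderiv24 g"
  "qderiv24 (- f) = - qderiv24 f"
  "qderiv24 (numeral w) = 0" "qderiv24 1 = 0"
  "qderiv24 (f * g) = qderiv24 f * g + f * qderiv24 g"
  "qderiv24 (f ^ n) = of_nat n * f ^ (n - 1) * qderiv24 f"
  by (simp_all add: qderiv24_def qderiv_mult qderiv_power algebra_simps)

lemma qderiv24_E:
  "qderiv24 euler_E = (eisenstein_E2 - 1) * euler_E"
  "qderiv24 eisenstein_E2 = 2 * (eisenstein_E2 ^ 2 - eisenstein_E4)"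
  "qderiv24 eisenstein_E4 = 8 * (eisenstein_E2 * eisenstein_E4 - eisenstein_E6)"
  "qderiv24 eisenstein_E6 = 12 * (eisenstein_E2 * eisenstein_E6 - eisenstein_E4 ^ 2)"
  using qderiv_euler_E' ramanujan_E2 ramanujan_E4 ramanujan_E6 unfolding qderiv24_def by algebra+

text \<open>Three times the heat operator 8 D + 1 is 24 D + 3. On E^3 the operator 24 D acts as
  multiplication by 3 (E2 - 1), and the constants cancel.\<close>

lemma theta_deriv_step:
  assumes "3 ^ j * theta_deriv (2 * j + 1) = 2 * euler_E ^ 3 * s"
    and "qderiv24 s + 3 * eisenstein_E2 * s = s'"
  shows "3 ^ Suc j * theta_deriv (2 * Suc j + 1) = 2 * euler_E ^ 3 * s'"
proof -
  have "3 ^ Suc j * theta_deriv (2 * Suc j + 1) = 3 ^ Suc j * (8 * qderiv (theta_deriv (2 * j + 1)) + theta_deriv (2 * j + 1))"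
    using theta_deriv_add_2[of "2 * j + 1"] by simp
  also have "\<dots> = qderiv24 (3 ^ j * theta_deriv (2 * j + 1)) + 3 * (3 ^ j * theta_deriv (2 * j + 1))"
    by (simp add: qderiv24_def qderiv_mult qderiv_power algebra_simps)
  also have "\<dots> = 2 * euler_E ^ 3 * (qderiv24 s + 3 * eisenstein_E2 * s)"
    unfolding assms(1) by (simp add: qderiv24_E algebra_simps power3_eq_cube power2_eq_square)
  finally show ?thesis
    by (simp only: assms(2))
qed

text \<open>Iterate \<open>theta_deriv_step\<close> from s = 1; the polynomial attached to the
  derivative of order 2 j + 1 has weight 2 j.\<close>

lemma theta_deriv_quasimodular:
  shows theta_deriv_1_eq: "3 ^ 0 * theta_deriv 1 = 2 * euler_E ^ 3 * (1)"
  and theta_deriv_3_eq: "3 ^ 1 * theta_deriv 3 = 2 * euler_E ^ 3 * (3 * eisenstein_E2)"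
  and theta_deriv_5_eq: "3 ^ 2 * theta_deriv 5 = 2 * euler_E ^ 3 * (15 * eisenstein_E2 ^ 2 - 6 * eisenstein_E4)"
  and theta_deriv_7_eq: "3 ^ 3 * theta_deriv 7 = 2 * euler_E ^ 3 * (105 * eisenstein_E2 ^ 3 - 126 * eisenstein_E2 * eisenstein_E4 + 48 * eisenstein_E6)"
  and theta_deriv_9_eq: "3 ^ 4 * theta_deriv 9 = 2 * euler_E ^ 3 * (945 * eisenstein_E2 ^ 4 - 2268 * eisenstein_E2 ^ 2 * eisenstein_E4 + 1728 * eisenstein_E2 * eisenstein_E6 - 324 * eisenstein_E4 ^ 2)"
  and theta_deriv_11_eq: "3 ^ 5 * theta_deriv 11 = 2 * euler_E ^ 3 * (10395 * eisenstein_E2 ^ 5 - 41580 * eisenstein_E2 ^ 3 * eisenstein_E4 + 47520 * eisenstein_E2 ^ 2 * eisenstein_E6 - 17820 * eisenstein_E2 * eisenstein_E4 ^ 2 + 1728 * eisenstein_E4 * eisenstein_E6)"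
  and theta_deriv_13_eq: "3 ^ 6 * theta_deriv 13 = 2 * euler_E ^ 3 * (135135 * eisenstein_E2 ^ 6 - 810810 * eisenstein_E2 ^ 4 * eisenstein_E4 + 1235520 * eisenstein_E2 ^ 3 * eisenstein_E6 - 694980 * eisenstein_E2 ^ 2 * eisenstein_E4 ^ 2 + 134784 * eisenstein_E2 * eisenstein_E4 * eisenstein_E6 + 14904 * eisenstein_E4 ^ 3 - 13824 * eisenstein_E6 ^ 2)"
proof -
  show t0: "3 ^ 0 * theta_deriv 1 = 2 * euler_E ^ 3 * (1)"
    using theta_deriv_1 by simp
  show t1: "3 ^ 1 * theta_deriv 3 = 2 * euler_E ^ 3 * (3 * eisenstein_E2)"
    using theta_deriv_step[of 0 "1", OF _ refl] t0
    by (simp add: qderiv24_E eval_nat_numeral algebra_simps)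
  show t2: "3 ^ 2 * theta_deriv 5 = 2 * euler_E ^ 3 * (15 * eisenstein_E2 ^ 2 - 6 * eisenstein_E4)"
    using theta_deriv_step[of 1 "3 * eisenstein_E2", OF _ refl] t1
    by (simp add: qderiv24_E eval_nat_numeral algebra_simps)
  show t3: "3 ^ 3 * theta_deriv 7 = 2 * euler_E ^ 3 * (105 * eisenstein_E2 ^ 3 - 126 * eisenstein_E2 * eisenstein_E4 + 48 * eisenstein_E6)"
    using theta_deriv_step[of 2 "15 * eisenstein_E2 ^ 2 - 6 * eisenstein_E4", OF _ refl] t2
    by (simp add: qderiv24_E eval_nat_numeral algebra_simps)
  show t4: "3 ^ 4 * theta_deriv 9 = 2 * euler_E ^ 3 * (945 * eisenstein_E2 ^ 4 - 2268 * eisenstein_E2 ^ 2 * eisenstein_E4 + 1728 * eisenstein_E2 * eisenstein_E6 - 324 * eisenstein_E4 ^ 2)"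
    using theta_deriv_step[of 3 "105 * eisenstein_E2 ^ 3 - 126 * eisenstein_E2 * eisenstein_E4 + 48 * eisenstein_E6", OF _ refl] t3
    by (simp add: qderiv24_E eval_nat_numeral algebra_simps)
  show t5: "3 ^ 5 * theta_deriv 11 = 2 * euler_E ^ 3 * (10395 * eisenstein_E2 ^ 5 - 41580 * eisenstein_E2 ^ 3 * eisenstein_E4 + 47520 * eisenstein_E2 ^ 2 * eisenstein_E6 - 17820 * eisenstein_E2 * eisenstein_E4 ^ 2 + 1728 * eisenstein_E4 * eisenstein_E6)"
    using theta_deriv_step[of 4 "945 * eisenstein_E2 ^ 4 - 2268 * eisenstein_E2 ^ 2 * eisenstein_E4 + 1728 * eisenstein_E2 * eisenstein_E6 - 324 * eisenstein_E4 ^ 2", OF _ refl] t4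
    by (simp add: qderiv24_E eval_nat_numeral algebra_simps)
  show t6: "3 ^ 6 * theta_deriv 13 = 2 * euler_E ^ 3 * (135135 * eisenstein_E2 ^ 6 - 810810 * eisenstein_E2 ^ 4 * eisenstein_E4 + 1235520 * eisenstein_E2 ^ 3 * eisenstein_E6 - 694980 * eisenstein_E2 ^ 2 * eisenstein_E4 ^ 2 + 134784 * eisenstein_E2 * eisenstein_E4 * eisenstein_E6 + 14904 * eisenstein_E4 ^ 3 - 13824 * eisenstein_E6 ^ 2)"
    using theta_deriv_step[of 5 "10395 * eisenstein_E2 ^ 5 - 41580 * eisenstein_E2 ^ 3 * eisenstein_E4 + 47520 * eisenstein_E2 ^ 2 * eisenstein_E6 - 17820 * eisenstein_E2 * eisenstein_E4 ^ 2 + 1728 * eisenstein_E4 * eisenstein_E6", OF _ refl] t5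
    by (simp add: qderiv24_E eval_nat_numeral algebra_simps)
qed

text \<open>The start is 8! (2 E^3)^8 E^8 from \<open>theta_moment_lowest\<close>; each further
  moment comes from \<open>theta_moment_8_recursion\<close>. The powers of 3 provide the left sides
  of the formulas for \<open>theta_deriv\<close>, and the common factor with E^3 is cancelled at the
  end.\<close>

lemma theta_moment_quasimodular:
  shows theta_moment_8_eq: "theta_moment (euler_E ^ 8) 8 8 = 2 ^ 8 * euler_E ^ 32 * (40320)"
  and theta_moment_10_eq: "theta_moment (euler_E ^ 8) 8 10 = 2 ^ 10 * euler_E ^ 32 * (1209600 * eisenstein_E2)"
  and theta_moment_12_eq: "theta_moment (euler_E ^ 8) 8 12 = 2 ^ 12 * euler_E ^ 32 * (26611200 * eisenstein_E2 ^ 2 - 1330560 * eisenstein_E4)"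
  and theta_moment_14_eq: "theta_moment (euler_E ^ 8) 8 14 = 2 ^ 14 * euler_E ^ 32 * (538137600 * eisenstein_E2 ^ 3 - 80720640 * eisenstein_E2 * eisenstein_E4 + 3843840 * eisenstein_E6)"
  and theta_moment_16_eq: "theta_moment (euler_E ^ 8) 8 16 = 2 ^ 16 * euler_E ^ 32 * (10762752000 * eisenstein_E2 ^ 4 - 3228825600 * eisenstein_E2 ^ 2 * eisenstein_E4 + 307507200 * eisenstein_E2 * eisenstein_E6 + 63423360 * eisenstein_E4 ^ 2)"
  and theta_moment_18_eq: "theta_moment (euler_E ^ 8) 8 18 = 2 ^ 18 * euler_E ^ 32 * (219560140800 * eisenstein_E2 ^ 5 - 109780070400 * eisenstein_E2 ^ 3 * eisenstein_E4 + 15682867200 * eisenstein_E2 ^ 2 * eisenstein_E6 + 6469182720 * eisenstein_E2 * eisenstein_E4 ^ 2 - 677214720 * eisenstein_E4 * eisenstein_E6)"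
  and theta_moment_20_eq: "theta_moment (euler_E ^ 8) 8 20 = 2 ^ 20 * euler_E ^ 32 * (4635158528000 * eisenstein_E2 ^ 6 - 3476368896000 * eisenstein_E2 ^ 4 * eisenstein_E4 + 662165504000 * eisenstein_E2 ^ 3 * eisenstein_E6 + 409714905600 * eisenstein_E2 ^ 2 * eisenstein_E4 ^ 2 - 85780531200 * eisenstein_E2 * eisenstein_E4 * eisenstein_E6 - 3650881920 * eisenstein_E4 ^ 3 + 2054796800 * eisenstein_E6 ^ 2)"
proof -
  note t = theta_deriv_quasimodular
  have E0: "euler_E \<noteq> 0"
    using euler_E_0 by (metis fps_zero_nth zero_neq_one)
  have sets: "{1..1} = {1::nat}" "{1..2} = {1, 2::nat}" "{1..3} = {1, 2, 3::nat}" "{1..4} = {1, 2, 3, 4::nat}"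
      "{1..5} = {1, 2, 3, 4, 5::nat}" "{1..6} = {1, 2, 3, 4, 5, 6::nat}"
    by auto
  show m0: "theta_moment (euler_E ^ 8) 8 8 = 2 ^ 8 * euler_E ^ 32 * (40320)"
    using theta_moment_lowest[of "euler_E ^ 8" 8] unfolding theta_deriv_1
    by (simp add: power_mult_distrib fact_numeral mult_ac flip: power_mult power_add)
  have "2 * theta_deriv 1 * theta_moment (euler_E ^ 8) 8 10 = 240 * theta_deriv 3 * theta_moment (euler_E ^ 8) 8 8"
    using theta_moment_8_recursion[of 1 "euler_E ^ 8"]
    unfolding sets by (simp add: binomial_fact' fact_numeral)
  then have r1: "3 ^ 1 * (2 * theta_deriv 1 * theta_moment (euler_E ^ 8) 8 10) = 3 ^ 1 * (240 * theta_deriv 3 * theta_moment (euler_E ^ 8) 8 8)"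
    by (rule arg_cong)
  have "6 * (3 ^ 0 * theta_deriv 1) * theta_moment (euler_E ^ 8) 8 10 = 3 ^ 1 * (2 * theta_deriv 1 * theta_moment (euler_E ^ 8) 8 10)"
    by simp
  also have "\<dots> = 240 * (3 ^ 1 * theta_deriv 3) * theta_moment (euler_E ^ 8) 8 8"
    unfolding r1 by (simp add: algebra_simps)
  finally have "6 * (2 * euler_E ^ 3 * 1) * theta_moment (euler_E ^ 8) 8 10 = 6 * (2 * euler_E ^ 3 * 1) * (2 ^ 10 * euler_E ^ 32 * (1209600 * eisenstein_E2))"
    unfolding t m0 by algebra
  then show m1: "theta_moment (euler_E ^ 8) 8 10 = 2 ^ 10 * euler_E ^ 32 * (1209600 * eisenstein_E2)"
    by (rule mult_left_cancel[THEN iffD1, rotated]) (use E0 in simp)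
  have "4 * theta_deriv 1 * theta_moment (euler_E ^ 8) 8 12 = 308 * theta_deriv 3 * theta_moment (euler_E ^ 8) 8 10 + 3168 * theta_deriv 5 * theta_moment (euler_E ^ 8) 8 8"
    using theta_moment_8_recursion[of 2 "euler_E ^ 8"]
    unfolding sets by (simp add: binomial_fact' fact_numeral)
  then have r2: "3 ^ 2 * (4 * theta_deriv 1 * theta_moment (euler_E ^ 8) 8 12) = 3 ^ 2 * (308 * theta_deriv 3 * theta_moment (euler_E ^ 8) 8 10 + 3168 * theta_deriv 5 * theta_moment (euler_E ^ 8) 8 8)"
    by (rule arg_cong)
  have "36 * (3 ^ 0 * theta_deriv 1) * theta_moment (euler_E ^ 8) 8 12 = 3 ^ 2 * (4 * theta_deriv 1 * theta_moment (euler_E ^ 8) 8 12)"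
    by simp
  also have "\<dots> = 924 * (3 ^ 1 * theta_deriv 3) * theta_moment (euler_E ^ 8) 8 10 + 3168 * (3 ^ 2 * theta_deriv 5) * theta_moment (euler_E ^ 8) 8 8"
    unfolding r2 by (simp add: algebra_simps)
  finally have "36 * (2 * euler_E ^ 3 * 1) * theta_moment (euler_E ^ 8) 8 12 = 36 * (2 * euler_E ^ 3 * 1) * (2 ^ 12 * euler_E ^ 32 * (26611200 * eisenstein_E2 ^ 2 - 1330560 * eisenstein_E4))"
    unfolding t m0 m1 by algebra
  then show m2: "theta_moment (euler_E ^ 8) 8 12 = 2 ^ 12 * euler_E ^ 32 * (26611200 * eisenstein_E2 ^ 2 - 1330560 * eisenstein_E4)"
    by (rule mult_left_cancel[THEN iffD1, rotated]) (use E0 in simp)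
  have "6 * theta_deriv 1 * theta_moment (euler_E ^ 8) 8 14 = 364 * theta_deriv 3 * theta_moment (euler_E ^ 8) 8 12 + 6006 * theta_deriv 5 * theta_moment (euler_E ^ 8) 8 10 + 20592 * theta_deriv 7 * theta_moment (euler_E ^ 8) 8 8"
    using theta_moment_8_recursion[of 3 "euler_E ^ 8"]
    unfolding sets by (simp add: binomial_fact' fact_numeral)
  then have r3: "3 ^ 3 * (6 * theta_deriv 1 * theta_moment (euler_E ^ 8) 8 14) = 3 ^ 3 * (364 * theta_deriv 3 * theta_moment (euler_E ^ 8) 8 12 + 6006 * theta_deriv 5 * theta_moment (euler_E ^ 8) 8 10 + 20592 * theta_deriv 7 * theta_moment (euler_E ^ 8) 8 8)"
    by (rule arg_cong)
  have "162 * (3 ^ 0 * theta_deriv 1) * theta_moment (euler_E ^ 8) 8 14 = 3 ^ 3 * (6 * theta_deriv 1 * theta_moment (euler_E ^ 8) 8 14)"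
    by simp
  also have "\<dots> = 3276 * (3 ^ 1 * theta_deriv 3) * theta_moment (euler_E ^ 8) 8 12 + 18018 * (3 ^ 2 * theta_deriv 5) * theta_moment (euler_E ^ 8) 8 10 + 20592 * (3 ^ 3 * theta_deriv 7) * theta_moment (euler_E ^ 8) 8 8"
    unfolding r3 by (simp add: algebra_simps)
  finally have "162 * (2 * euler_E ^ 3 * 1) * theta_moment (euler_E ^ 8) 8 14 = 162 * (2 * euler_E ^ 3 * 1) * (2 ^ 14 * euler_E ^ 32 * (538137600 * eisenstein_E2 ^ 3 - 80720640 * eisenstein_E2 * eisenstein_E4 + 3843840 * eisenstein_E6))"
    unfolding t m0 m1 m2 by algebra
  then show m3: "theta_moment (euler_E ^ 8) 8 14 = 2 ^ 14 * euler_E ^ 32 * (538137600 * eisenstein_E2 ^ 3 - 80720640 * eisenstein_E2 * eisenstein_E4 + 3843840 * eisenstein_E6)"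
    by (rule mult_left_cancel[THEN iffD1, rotated]) (use E0 in simp)
  have "8 * theta_deriv 1 * theta_moment (euler_E ^ 8) 8 16 = 400 * theta_deriv 3 * theta_moment (euler_E ^ 8) 8 14 + 10192 * theta_deriv 5 * theta_moment (euler_E ^ 8) 8 12 + 52624 * theta_deriv 7 * theta_moment (euler_E ^ 8) 8 10 + 91520 * theta_deriv 9 * theta_moment (euler_E ^ 8) 8 8"
    using theta_moment_8_recursion[of 4 "euler_E ^ 8"]
    unfolding sets by (simp add: binomial_fact' fact_numeral)
  then have r4: "3 ^ 4 * (8 * theta_deriv 1 * theta_moment (euler_E ^ 8) 8 16) = 3 ^ 4 * (400 * theta_deriv 3 * theta_moment (euler_E ^ 8) 8 14 + 10192 * theta_deriv 5 * theta_moment (euler_E ^ 8) 8 12 + 52624 * theta_deriv 7 * theta_moment (euler_E ^ 8) 8 10 + 91520 * theta_deriv 9 * theta_moment (euler_E ^ 8) 8 8)"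
    by (rule arg_cong)
  have "648 * (3 ^ 0 * theta_deriv 1) * theta_moment (euler_E ^ 8) 8 16 = 3 ^ 4 * (8 * theta_deriv 1 * theta_moment (euler_E ^ 8) 8 16)"
    by simp
  also have "\<dots> = 10800 * (3 ^ 1 * theta_deriv 3) * theta_moment (euler_E ^ 8) 8 14 + 91728 * (3 ^ 2 * theta_deriv 5) * theta_moment (euler_E ^ 8) 8 12 + 157872 * (3 ^ 3 * theta_deriv 7) * theta_moment (euler_E ^ 8) 8 10 + 91520 * (3 ^ 4 * theta_deriv 9) * theta_moment (euler_E ^ 8) 8 8"
    unfolding r4 by (simp add: algebra_simps)
  finally have "648 * (2 * euler_E ^ 3 * 1) * theta_moment (euler_E ^ 8) 8 16 = 648 * (2 * euler_E ^ 3 * 1) * (2 ^ 16 * euler_E ^ 32 * (10762752000 * eisenstein_E2 ^ 4 - 3228825600 * eisenstein_E2 ^ 2 * eisenstein_E4 + 307507200 * eisenstein_E2 * eisenstein_E6 + 63423360 * eisenstein_E4 ^ 2))"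
    unfolding t m0 m1 m2 m3 by algebra
  then show m4: "theta_moment (euler_E ^ 8) 8 16 = 2 ^ 16 * euler_E ^ 32 * (10762752000 * eisenstein_E2 ^ 4 - 3228825600 * eisenstein_E2 ^ 2 * eisenstein_E4 + 307507200 * eisenstein_E2 * eisenstein_E6 + 63423360 * eisenstein_E4 ^ 2)"
    by (rule mult_left_cancel[THEN iffD1, rotated]) (use E0 in simp)
  have "10 * theta_deriv 1 * theta_moment (euler_E ^ 8) 8 18 = 408 * theta_deriv 3 * theta_moment (euler_E ^ 8) 8 16 + 15912 * theta_deriv 5 * theta_moment (euler_E ^ 8) 8 14 + 116688 * theta_deriv 7 * theta_moment (euler_E ^ 8) 8 12 + 301444 * theta_deriv 9 * theta_moment (euler_E ^ 8) 8 10 + 318240 * theta_deriv 11 * theta_moment (euler_E ^ 8) 8 8"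
    using theta_moment_8_recursion[of 5 "euler_E ^ 8"]
    unfolding sets by (simp add: binomial_fact' fact_numeral)
  then have r5: "3 ^ 5 * (10 * theta_deriv 1 * theta_moment (euler_E ^ 8) 8 18) = 3 ^ 5 * (408 * theta_deriv 3 * theta_moment (euler_E ^ 8) 8 16 + 15912 * theta_deriv 5 * theta_moment (euler_E ^ 8) 8 14 + 116688 * theta_deriv 7 * theta_moment (euler_E ^ 8) 8 12 + 301444 * theta_deriv 9 * theta_moment (euler_E ^ 8) 8 10 + 318240 * theta_deriv 11 * theta_moment (euler_E ^ 8) 8 8)"
    by (rule arg_cong)
  have "2430 * (3 ^ 0 * theta_deriv 1) * theta_moment (euler_E ^ 8) 8 18 = 3 ^ 5 * (10 * theta_deriv 1 * theta_moment (euler_E ^ 8) 8 18)"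
    by simp
  also have "\<dots> = 33048 * (3 ^ 1 * theta_deriv 3) * theta_moment (euler_E ^ 8) 8 16 + 429624 * (3 ^ 2 * theta_deriv 5) * theta_moment (euler_E ^ 8) 8 14 + 1050192 * (3 ^ 3 * theta_deriv 7) * theta_moment (euler_E ^ 8) 8 12 + 904332 * (3 ^ 4 * theta_deriv 9) * theta_moment (euler_E ^ 8) 8 10 + 318240 * (3 ^ 5 * theta_deriv 11) * theta_moment (euler_E ^ 8) 8 8"
    unfolding r5 by (simp add: algebra_simps)
  finally have "2430 * (2 * euler_E ^ 3 * 1) * theta_moment (euler_E ^ 8) 8 18 = 2430 * (2 * euler_E ^ 3 * 1) * (2 ^ 18 * euler_E ^ 32 * (219560140800 * eisenstein_E2 ^ 5 - 109780070400 * eisenstein_E2 ^ 3 * eisenstein_E4 + 15682867200 * eisenstein_E2 ^ 2 * eisenstein_E6 + 6469182720 * eisenstein_E2 * eisenstein_E4 ^ 2 - 677214720 * eisenstein_E4 * eisenstein_E6))"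
    unfolding t m0 m1 m2 m3 m4 by algebra
  then show m5: "theta_moment (euler_E ^ 8) 8 18 = 2 ^ 18 * euler_E ^ 32 * (219560140800 * eisenstein_E2 ^ 5 - 109780070400 * eisenstein_E2 ^ 3 * eisenstein_E4 + 15682867200 * eisenstein_E2 ^ 2 * eisenstein_E6 + 6469182720 * eisenstein_E2 * eisenstein_E4 ^ 2 - 677214720 * eisenstein_E4 * eisenstein_E6)"
    by (rule mult_left_cancel[THEN iffD1, rotated]) (use E0 in simp)
  have "12 * theta_deriv 1 * theta_moment (euler_E ^ 8) 8 20 = 380 * theta_deriv 3 * theta_moment (euler_E ^ 8) 8 18 + 23256 * theta_deriv 5 * theta_moment (euler_E ^ 8) 8 16 + 232560 * theta_deriv 7 * theta_moment (euler_E ^ 8) 8 14 + 839800 * theta_deriv 9 * theta_moment (euler_E ^ 8) 8 12 + 1310088 * theta_deriv 11 * theta_moment (euler_E ^ 8) 8 10 + 930240 * theta_deriv 13 * theta_moment (euler_E ^ 8) 8 8"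
    using theta_moment_8_recursion[of 6 "euler_E ^ 8"]
    unfolding sets by (simp add: binomial_fact' fact_numeral)
  then have r6: "3 ^ 6 * (12 * theta_deriv 1 * theta_moment (euler_E ^ 8) 8 20) = 3 ^ 6 * (380 * theta_deriv 3 * theta_moment (euler_E ^ 8) 8 18 + 23256 * theta_deriv 5 * theta_moment (euler_E ^ 8) 8 16 + 232560 * theta_deriv 7 * theta_moment (euler_E ^ 8) 8 14 + 839800 * theta_deriv 9 * theta_moment (euler_E ^ 8) 8 12 + 1310088 * theta_deriv 11 * theta_moment (euler_E ^ 8) 8 10 + 930240 * theta_deriv 13 * theta_moment (euler_E ^ 8) 8 8)"
    by (rule arg_cong)
  have "8748 * (3 ^ 0 * theta_deriv 1) * theta_moment (euler_E ^ 8) 8 20 = 3 ^ 6 * (12 * theta_deriv 1 * theta_moment (euler_E ^ 8) 8 20)"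
    by simp
  also have "\<dots> = 92340 * (3 ^ 1 * theta_deriv 3) * theta_moment (euler_E ^ 8) 8 18 + 1883736 * (3 ^ 2 * theta_deriv 5) * theta_moment (euler_E ^ 8) 8 16 + 6279120 * (3 ^ 3 * theta_deriv 7) * theta_moment (euler_E ^ 8) 8 14 + 7558200 * (3 ^ 4 * theta_deriv 9) * theta_moment (euler_E ^ 8) 8 12 + 3930264 * (3 ^ 5 * theta_deriv 11) * theta_moment (euler_E ^ 8) 8 10 + 930240 * (3 ^ 6 * theta_deriv 13) * theta_moment (euler_E ^ 8) 8 8"
    unfolding r6 by (simp add: algebra_simps)
  finally have "8748 * (2 * euler_E ^ 3 * 1) * theta_moment (euler_E ^ 8) 8 20 = 8748 * (2 * euler_E ^ 3 * 1) * (2 ^ 20 * euler_E ^ 32 * (4635158528000 * eisenstein_E2 ^ 6 - 3476368896000 * eisenstein_E2 ^ 4 * eisenstein_E4 + 662165504000 * eisenstein_E2 ^ 3 * eisenstein_E6 + 409714905600 * eisenstein_E2 ^ 2 * eisenstein_E4 ^ 2 - 85780531200 * eisenstein_E2 * eisenstein_E4 * eisenstein_E6 - 3650881920 * eisenstein_E4 ^ 3 + 2054796800 * eisenstein_E6 ^ 2))"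
    unfolding t m0 m1 m2 m3 m4 m5 by algebra
  then show m6: "theta_moment (euler_E ^ 8) 8 20 = 2 ^ 20 * euler_E ^ 32 * (4635158528000 * eisenstein_E2 ^ 6 - 3476368896000 * eisenstein_E2 ^ 4 * eisenstein_E4 + 662165504000 * eisenstein_E2 ^ 3 * eisenstein_E6 + 409714905600 * eisenstein_E2 ^ 2 * eisenstein_E4 ^ 2 - 85780531200 * eisenstein_E2 * eisenstein_E4 * eisenstein_E6 - 3650881920 * eisenstein_E4 ^ 3 + 2054796800 * eisenstein_E6 ^ 2)"
    by (rule mult_left_cancel[THEN iffD1, rotated]) (use E0 in simp)
qed

section \<open>The eighth power of theta and residue classes modulo 11\<close>

text \<open>The shift by 4 centres the exponent of z, since 2 (mu - 4) + 8 = 2 mu. The exponent 8 =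
  10 - 2 is chosen so that a polynomial of degree 10 meets only the moments of orders 8 and
  10.\<close>

definition theta8 :: "int \<Rightarrow> int \<Rightarrow> int" where
  "theta8 \<mu> K = theta_power (euler_E ^ 8) 8 (\<mu> - 4) K"

definition theta8_moment :: "nat \<Rightarrow> int fps" where
  "theta8_moment b = Abs_fps (\<lambda>k. Sum_any (\<lambda>\<mu>. \<mu> ^ b * theta8 \<mu> (int k)))"

lemma theta8_neg: "K < 0 \<Longrightarrow> theta8 \<mu> K = 0"
  by (simp add: theta8_def theta_power_neg)

lemma theta8_support: "theta8 \<mu> K \<noteq> 0 \<Longrightarrow> \<mu>\<^sup>2 \<le> 16 * (K + 1)"
  using theta_power_support[of "euler_E ^ 8" 8 "\<mu> - 4" K]
  by (simp add: theta8_def power2_eq_square algebra_simps)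

lemma theta8_uminus: "theta8 (- \<mu>) K = theta8 \<mu> K"
proof -
  have "- \<mu> - 4 = - (\<mu> - 4) - int 8" by simp
  then show ?thesis
    unfolding theta8_def by (simp only: theta_power_symmetric) simp
qed

lemma theta8_bound: "theta8 \<mu> K \<noteq> 0 \<Longrightarrow> \<bar>\<mu>\<bar> \<le> 16 * (K + 1)"
proof -
  assume "theta8 \<mu> K \<noteq> 0"
  then have "\<mu>\<^sup>2 \<le> 16 * (K + 1)" by (rule theta8_support)
  moreover have "\<bar>\<mu>\<bar> \<le> \<mu>\<^sup>2"
  proof (cases "\<mu> = 0")
    case False
    then have "1 \<le> \<bar>\<mu>\<bar>" by simp
    then show ?thesis using self_le_power[of "\<bar>\<mu>\<bar>" 2] by simp
  qed simp
  ultimately show ?thesis by (rule order_trans[rotated])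
qed

text \<open>Quasi-periodicity applied n times; the signs cancel because 8 is even.\<close>

lemma theta8_shift: "theta8 (\<mu> + 8 * int n) (K + int n * \<mu> + 4 * (int n)\<^sup>2) = theta8 \<mu> K"
proof (induction n)
  case (Suc n)
  have "theta8 (\<mu> + 8 * int (Suc n)) (K + int (Suc n) * \<mu> + 4 * (int (Suc n))\<^sup>2)
      = theta_power (euler_E ^ 8) 8 ((\<mu> + 8 * int n - 4) + int 8)
         ((K + int n * \<mu> + 4 * (int n)\<^sup>2) + (\<mu> + 8 * int n - 4) + int 8)"
    unfolding theta8_def by (rule arg_cong2[where f = "theta_power (euler_E ^ 8) 8"]) (simp_all add: power2_eq_square algebra_simps)
  also have "\<dots> = theta8 (\<mu> + 8 * int n) (K + int n * \<mu> + 4 * (int n)\<^sup>2)"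
    unfolding theta_power_shift by (simp add: theta8_def)
  finally show ?case using Suc by simp
qed simp

lemma theta8_moment_eq: "2 ^ b * theta8_moment b = theta_moment (euler_E ^ 8) 8 b"
proof (rule fps_ext)
  fix k
  have fin: "finite {\<mu>. \<mu> ^ b * theta8 \<mu> (int k) \<noteq> 0}"
  proof (rule finite_subset)
    show "{\<mu>. \<mu> ^ b * theta8 \<mu> (int k) \<noteq> 0} \<subseteq> (\<lambda>s. s + 4) ` {s. 1 * theta_power (euler_E ^ 8) 8 s (int k) \<noteq> 0}"
    proof
      fix \<mu> assume "\<mu> \<in> {\<mu>. \<mu> ^ b * theta8 \<mu> (int k) \<noteq> 0}"
      then have "\<mu> - 4 \<in> {s. 1 * theta_power (euler_E ^ 8) 8 s (int k) \<noteq> 0}"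
        by (auto simp: theta8_def)
      then show "\<mu> \<in> (\<lambda>s. s + 4) ` {s. 1 * theta_power (euler_E ^ 8) 8 s (int k) \<noteq> 0}"
        by (rule rev_image_eqI) simp
    qed
  qed (intro finite_imageI finite_theta_power)
  have "fps_nth (theta_moment (euler_E ^ 8) 8 b) k = Sum_any (\<lambda>\<mu>. (2 * (\<mu> + - 4) + int 8) ^ b * theta_power (euler_E ^ 8) 8 (\<mu> + - 4) (int k))"
    unfolding theta_moment_def fps_nth_Abs_fps by (rule Sum_any_shift[symmetric])
  also have "\<dots> = Sum_any (\<lambda>\<mu>. 2 ^ b * (\<mu> ^ b * theta8 \<mu> (int k)))"
  proof (rule arg_cong[where f = Sum_any], rule ext)
    fix \<mu> :: int
    have "2 * (\<mu> + - 4) + int 8 = 2 * \<mu>" by simp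
    then show "(2 * (\<mu> + - 4) + int 8) ^ b * theta_power (euler_E ^ 8) 8 (\<mu> + - 4) (int k) = 2 ^ b * (\<mu> ^ b * theta8 \<mu> (int k))"
      by (simp only: power_mult_distrib theta8_def mult.assoc diff_conv_add_uminus)
  qed
  also have "\<dots> = 2 ^ b * fps_nth (theta8_moment b) k"
    unfolding theta8_moment_def fps_nth_Abs_fps by (rule Sum_any_right_distrib[symmetric]) (rule fin)
  finally show "fps_nth (2 ^ b * theta8_moment b) k = fps_nth (theta_moment (euler_E ^ 8) 8 b) k"
    by (simp add: numeral_fps_const)
qed

lemma theta8_moment_eqI: "theta_moment (euler_E ^ 8) 8 b = 2 ^ b * f \<Longrightarrow> theta8_moment b = f"
  using theta8_moment_eq[of b] by simp

lemma theta8_box: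
  assumes "0 \<le> K"
  shows "Sum_any (\<lambda>\<mu>. h \<mu> * theta8 \<mu> K) = (\<Sum>\<mu>\<in>{- 16 * (K + 1)..16 * (K + 1)}. h \<mu> * theta8 \<mu> K)"
proof (rule Sum_any.expand_superset)
  show "{\<mu>. h \<mu> * theta8 \<mu> K \<noteq> 0} \<subseteq> {- 16 * (K + 1)..16 * (K + 1)}"
  proof
    fix \<mu> assume "\<mu> \<in> {\<mu>. h \<mu> * theta8 \<mu> K \<noteq> 0}"
    then have "theta8 \<mu> K \<noteq> 0" by auto
    from theta8_bound[OF this] show "\<mu> \<in> {- 16 * (K + 1)..16 * (K + 1)}"
      unfolding atLeastAtMost_iff by linarith
  qed
qed simp

lemma finite_theta8: "finite {\<mu>. h \<mu> * theta8 \<mu> K \<noteq> 0}"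
proof (rule finite_subset)
  show "{\<mu>. h \<mu> * theta8 \<mu> K \<noteq> 0} \<subseteq> {- 16 * (K + 1)..16 * (K + 1)}"
  proof
    fix \<mu> assume "\<mu> \<in> {\<mu>. h \<mu> * theta8 \<mu> K \<noteq> 0}"
    then have "theta8 \<mu> K \<noteq> 0" by auto
    from theta8_bound[OF this] show "\<mu> \<in> {- 16 * (K + 1)..16 * (K + 1)}"
      unfolding atLeastAtMost_iff by linarith
  qed
qed simp

text \<open>Every integer is \<open>r + 11 i\<close> with a unique \<open>r\<close> between \<open>-5\<close> and \<open>5\<close>.\<close>

lemma Sum_any_residues:
  fixes h :: "int \<Rightarrow> int"
  assumes "finite {\<mu>. h \<mu> \<noteq> 0}"
  shows "Sum_any h = (\<Sum>r\<in>{-5..5}. Sum_any (\<lambda>i. h (r + 11 * i)))"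
proof -
  define B where "B = Max (insert 0 (abs ` {\<mu>. h \<mu> \<noteq> 0}))"
  have B: "\<bar>\<mu>\<bar> \<le> B" if "h \<mu> \<noteq> 0" for \<mu>
    unfolding B_def using assms that by (intro Max_ge) auto
  have i: "i \<in> {- B - 5..B + 5}" if "h (r + 11 * i) \<noteq> 0" "r \<in> {-5..5}" for r i
    using B[OF that(1)] that(2) by auto
  have dm: "(r + 11 * i + 5) mod 11 - 5 = r" "(r + 11 * i + 5) div 11 = i" if "r \<in> {-5..5}" for r i :: int
  proof -
    have "r + 11 * i + 5 = (r + 5) + i * 11" by simp
    then show "(r + 11 * i + 5) mod 11 - 5 = r" "(r + 11 * i + 5) div 11 = i"
      using that by (simp_all only: mod_mult_self1 div_mult_self1) auto
  qed
  have "Sum_any h = sum h {- 11 * (B + 5) - 5..11 * (B + 5) + 5}"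
    by (rule Sum_any.expand_superset) (use B in force)+
  also have "\<dots> = (\<Sum>(r, i)\<in>{-5..5} \<times> {- B - 5..B + 5}. h (r + 11 * i))"
    by (rule sum.reindex_bij_witness[where i = "\<lambda>(r, i). r + 11 * i" and j = "\<lambda>\<mu>. ((\<mu> + 5) mod 11 - 5, (\<mu> + 5) div 11)"])
       (auto simp: minus_mod_eq_mult_div[symmetric] dm)
  also have "\<dots> = (\<Sum>r\<in>{-5..5}. \<Sum>i\<in>{- B - 5..B + 5}. h (r + 11 * i))"
    by (rule sum.cartesian_product[symmetric])
  also have "\<dots> = (\<Sum>r\<in>{-5..5}. Sum_any (\<lambda>i. h (r + 11 * i)))"
    by (intro sum.cong refl Sum_any.expand_superset[symmetric]) (use i in auto)
  finally show ?thesis .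
qed

lemma residue_power_10: "r \<in> {-5..5} \<Longrightarrow> r \<noteq> 0 \<Longrightarrow> [r ^ 10 = 1] (mod 11)" for r :: int
proof -
  assume "r \<in> {-5..5}" "r \<noteq> 0"
  then have "r = -5 \<or> r = -4 \<or> r = -3 \<or> r = -2 \<or> r = -1 \<or> r = 1 \<or> r = 2 \<or> r = 3 \<or> r = 4 \<or> r = 5"
    unfolding atLeastAtMost_iff by presburger
  then show ?thesis by (elim disjE) (simp_all add: cong_def)
qed

text \<open>The coefficientwise form of 24 D (E^32) = 32 (E2 - 1) E^32. It makes the tenth moment a
  multiple of the eighth, coefficient by coefficient modulo 11.\<close>

lemma euler_E_32_E2: "(24 * int k + 32) * fps_nth (euler_E ^ 32) k = 32 * fps_nth (euler_E ^ 32 * eisenstein_E2) k"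
proof -
  have "qderiv24 (euler_E ^ 32) + 32 * euler_E ^ 32 = 32 * (euler_E ^ 32 * eisenstein_E2)"
  proof -
    have p: "euler_E ^ 32 = euler_E ^ 31 * euler_E"
      using power_add[of euler_E 31 1] by simp
    have "qderiv24 (euler_E ^ 32) = 32 * euler_E ^ 31 * ((eisenstein_E2 - 1) * euler_E)"
      by (simp add: qderiv24_E)
    then show ?thesis
      unfolding p by (simp add: algebra_simps)
  qed
  then have "fps_nth (qderiv24 (euler_E ^ 32) + 32 * euler_E ^ 32) k = fps_nth (32 * (euler_E ^ 32 * eisenstein_E2)) k"
    by (simp only:)
  moreover have "fps_nth (numeral w * f) k = numeral w * fps_nth f k" for w and f :: "int fps"
    by (simp add: numeral_fps_const)
  ultimately show ?thesis
    by (simp only: qderiv24_def fps_add_nth qderiv_nth) (simp add: algebra_simps)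
qed

lemma theta8_moment_low:
  "b < 8 \<or> b = 9 \<Longrightarrow> theta8_moment b = 0"
  "theta8_moment 8 = 40320 * euler_E ^ 32"
  "theta8_moment 10 = 1209600 * (euler_E ^ 32 * eisenstein_E2)"
proof -
  show "b < 8 \<or> b = 9 \<Longrightarrow> theta8_moment b = 0"
    by (rule theta8_moment_eqI) (auto simp: theta_moment_less theta_moment_parity)
  show "theta8_moment 8 = 40320 * euler_E ^ 32"
    by (rule theta8_moment_eqI) (simp add: theta_moment_8_eq)
  show "theta8_moment 10 = 1209600 * (euler_E ^ 32 * eisenstein_E2)"
    by (rule theta8_moment_eqI) (simp add: theta_moment_10_eq)
qed

text \<open>The indicator of a class modulo 11 has degree 10, so only the moments of orders 8 and 10
  enter, and both reduce to the K-th coefficient of E^32. The resulting factor is quadratic in y = x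
  + 3 n and linear in K; the relation between K, n and x removes every term but 6 x^2.\<close>

lemma theta8_residue_class:
  assumes "[2 * (K + 5) + 3 * n\<^sup>2 + 2 * x * n = 0] (mod 11)"
  shows "[Sum_any (\<lambda>i. theta8 (x + 3 * n + 11 * i) K) = 6 * x\<^sup>2 * int_nth (euler_E ^ 32) K] (mod 11)"
proof (cases "K < 0")
  case True
  then show ?thesis by (simp add: theta8_neg int_nth_def)
next
  case False
  then obtain k where k: "K = int k" using nonneg_int_cases by (metis not_less)
  define y where "y = x + 3 * n"
  \<comment> \<open>By Fermat, 1 - (mu - y)^10 is 1 modulo 11 on the class of y and 0 on the other
    classes.\<close>
  define h where "h \<mu> = (1 - (\<mu> - y) ^ 10) * theta8 \<mu> K" for \<mu>
  define e where "e = fps_nth (euler_E ^ 32) k"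
  define e2 where "e2 = fps_nth (euler_E ^ 32 * eisenstein_E2) k"
  let ?M = "\<lambda>b. fps_nth (theta8_moment b) k"
  have M: "?M b = (\<Sum>\<mu>\<in>{- 16 * (K + 1)..16 * (K + 1)}. \<mu> ^ b * theta8 \<mu> K)" for b
    unfolding theta8_moment_def fps_nth_Abs_fps k by (rule theta8_box) simp
  have Mv: "b < 8 \<or> b = 9 \<Longrightarrow> ?M b = 0" "?M 8 = 40320 * e" "?M 10 = 1209600 * e2" for b
    using theta8_moment_low by (simp_all add: e_def e2_def numeral_fps_const)
  have "finite {\<mu>. h \<mu> \<noteq> 0}"
    unfolding h_def by (rule finite_theta8)
  then have "finite ((\<lambda>\<mu>. \<mu> - y) ` {\<mu>. h \<mu> \<noteq> 0})"
    by (rule finite_imageI)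
  moreover have "{\<nu>. h (\<nu> + y) \<noteq> 0} \<subseteq> (\<lambda>\<mu>. \<mu> - y) ` {\<mu>. h \<mu> \<noteq> 0}"
    by (force simp: image_iff)
  ultimately have fin: "finite {\<nu>. h (\<nu> + y) \<noteq> 0}"
    by (rule rev_finite_subset)
  have cg: "[Sum_any (\<lambda>i. h (r + 11 * i + y)) = (if r = 0 then Sum_any (\<lambda>i. theta8 (y + 11 * i) K) else 0)] (mod 11)"
    if r: "r \<in> {-5..5}" for r
  proof -
    define A where "A = {- 16 * (K + 1) - \<bar>y\<bar> - 5..16 * (K + 1) + \<bar>y\<bar> + 5}"
    have A: "i \<in> A" if "theta8 (r + 11 * i + y) K \<noteq> 0" for i
      using theta8_bound[OF that] r by (auto simp: A_def)
    have "Sum_any (\<lambda>i. h (r + 11 * i + y)) = (\<Sum>i\<in>A. (1 - (r + 11 * i) ^ 10) * theta8 (r + 11 * i + y) K)"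
      unfolding h_def by (subst Sum_any.expand_superset[of A]) (use A in \<open>auto simp: A_def\<close>)
    moreover have "[\<dots> = (\<Sum>i\<in>A. (if r = 0 then 1 else 0) * theta8 (r + 11 * i + y) K)] (mod 11)"
    proof (intro cong_sum cong_mult cong_refl)
      fix i
      have "[(r + 11 * i) ^ 10 = r ^ 10] (mod 11)"
        by (intro cong_pow) (simp add: cong_def)
      then show "[1 - (r + 11 * i) ^ 10 = (if r = 0 then 1 else 0)] (mod 11)"
        using residue_power_10[OF r] cong_diff[OF cong_refl, of "(r + 11 * i) ^ 10" "r ^ 10" 11 1]
          cong_diff[OF cong_refl, of "r ^ 10" 1 11 1] by (auto intro: cong_trans)
    qed
    moreover have "(\<Sum>i\<in>A. theta8 (11 * i + y) K) = Sum_any (\<lambda>i. theta8 (y + 11 * i) K)" if "r = 0"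
      by (subst Sum_any.expand_superset[of A]) (use A that in \<open>auto simp: A_def add.commute\<close>)
    ultimately show ?thesis
      by (cases "r = 0") simp_all
  qed
  have "Sum_any h = Sum_any (\<lambda>\<nu>. h (\<nu> + y))"
    by (rule Sum_any_shift[symmetric])
  also have "\<dots> = (\<Sum>r\<in>{-5..5}. Sum_any (\<lambda>i. h (r + 11 * i + y)))"
    using fin by (rule Sum_any_residues)
  finally have "[Sum_any h = (\<Sum>r\<in>{-5..5::int}. if r = 0 then Sum_any (\<lambda>i. theta8 (y + 11 * i) K) else 0)] (mod 11)"
    using cg by (simp only:) (rule cong_sum)
  then have 1: "[Sum_any h = Sum_any (\<lambda>i. theta8 (y + 11 * i) K)] (mod 11)"
    by simp
  have "Sum_any h = (\<Sum>\<mu>\<in>{- 16 * (K + 1)..16 * (K + 1)}. (1 - (\<mu> - y) ^ 10) * theta8 \<mu> K)"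
    unfolding h_def by (rule theta8_box) (use False in simp)
  also have "\<dots> = (\<Sum>\<mu>\<in>{- 16 * (K + 1)..16 * (K + 1)}. \<mu> ^ 0 * theta8 \<mu> K - (\<Sum>b\<le>10. of_nat (10 choose b) * (- y) ^ (10 - b) * (\<mu> ^ b * theta8 \<mu> K)))"
  proof (rule sum.cong)
    fix \<mu>
    have "(\<mu> - y) ^ 10 = (\<Sum>b\<le>10. of_nat (10 choose b) * \<mu> ^ b * (- y) ^ (10 - b))"
      using binomial_ring[of \<mu> "- y" 10] by simp
    then show "(1 - (\<mu> - y) ^ 10) * theta8 \<mu> K = \<mu> ^ 0 * theta8 \<mu> K - (\<Sum>b\<le>10. of_nat (10 choose b) * (- y) ^ (10 - b) * (\<mu> ^ b * theta8 \<mu> K))"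
      by (simp only: left_diff_distrib sum_distrib_right) (simp add: mult_ac)
  qed simp
  also have "\<dots> = ?M 0 - (\<Sum>b\<le>10. of_nat (10 choose b) * (- y) ^ (10 - b) * ?M b)"
    unfolding M sum_subtractf by (subst sum.swap) (simp only: sum_distrib_left)
  also have "(\<Sum>b\<le>10. of_nat (10 choose b) * (- y) ^ (10 - b) * ?M b) = (\<Sum>b\<in>{8, 10}. of_nat (10 choose b) * (- y) ^ (10 - b) * ?M b)"
  proof (rule sum.mono_neutral_right)
    show "\<forall>b\<in>{..10} - {8, 10}. of_nat (10 choose b) * (- y) ^ (10 - b) * ?M b = 0"
    proof
      fix b :: nat assume "b \<in> {..10} - {8, 10}"
      then have "b < 8 \<or> b = 9" by auto
      then show "of_nat (10 choose b) * (- y) ^ (10 - b) * ?M b = 0"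
        by (simp only: Mv(1) mult_zero_right)
    qed
  qed auto
  also have "?M 0 - \<dots> = - (45 * 40320) * y\<^sup>2 * e - 1209600 * e2"
    by (simp add: Mv binomial_fact' fact_numeral)
  finally have 2: "Sum_any h = - (45 * 40320) * y\<^sup>2 * e - 1209600 * e2" .
  have E2: "(24 * int k + 32) * e = 32 * e2"
    using euler_E_32_E2[of k] by (simp add: e_def e2_def)
  obtain c where c: "2 * (K + 5) + 3 * n\<^sup>2 + 2 * x * n = 11 * c"
    using assms by (auto simp: cong_0_iff)
  have "11 dvd (- (45 * 40320) * y\<^sup>2 * e - 1209600 * e2 - 6 * x\<^sup>2 * e)"
  proof -
    \<comment> \<open>Since 32 is -1 modulo 11, writing \<open>e2\<close> as 33 \<open>e2\<close> -
      32 \<open>e2\<close> expresses it through e up to a multiple of 11; K is then eliminated by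
      the hypothesis.\<close>
    have e2: "e2 = 33 * e2 - (24 * K + 32) * e"
      using E2 by (simp add: k)
    have "24 * K = 12 * (11 * c) - 36 * n\<^sup>2 - 24 * x * n - 120"
      using c by simp
    then have "- (45 * 40320) * y\<^sup>2 * e - 1209600 * e2 - 6 * x\<^sup>2 * e =
      - (45 * 40320) * y\<^sup>2 * e - 1209600 * (33 * e2 - (12 * (11 * c) - 36 * n\<^sup>2 - 24 * x * n - 120 + 32) * e) - 6 * x\<^sup>2 * e"
      using e2 by simp
    also have "\<dots> = 11 * ((-1209600 * 3) * e2 + 1209600 * (12 * c - 8) * e
        - ((45 * 40320 + 6) div 11) * x\<^sup>2 * e - ((45 * 40320 * 6 + 1209600 * 24) div 11) * x * n * e - ((45 * 40320 * 9 + 1209600 * 36) div 11) * n\<^sup>2 * e)"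
      by (simp add: y_def power2_eq_square algebra_simps)
    finally have eq: "- (45 * 40320) * y\<^sup>2 * e - 1209600 * e2 - 6 * x\<^sup>2 * e = \<dots>" .
    show ?thesis unfolding eq by (rule dvd_triv_left)
  qed
  then have "[Sum_any h = 6 * x\<^sup>2 * e] (mod 11)"
    unfolding 2 by (simp only: cong_iff_dvd_diff)
  from cong_trans[OF cong_sym[OF 1] this] show ?thesis
    by (simp only: y_def e_def k int_nth_of_nat)
qed

section \<open>The double sum and its congruence modulo 121\<close>

text \<open>The exponent n(3n-1)/2 + m n equals 3 \<open>tri n\<close> - 2 n + n m. Indices n or m
  beyond N give exponents above N, so any bounds R and S from N on will do.\<close>

lemma weighted_appell_mult_nth:
  fixes R S :: int
  assumes R: "int N \<le> R" and S: "int N \<le> S"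
  shows "fps_nth (f * weighted_appell w) N =
    (\<Sum>n\<in>{1..R}. \<Sum>m\<in>{1..S}. - alt_sign n * w m * int_nth f (int N - 3 * tri n + 2 * n - n * m))"
proof -
  define ex :: "nat \<Rightarrow> nat \<Rightarrow> nat" where "ex n m = n * (3 * n - 1) div 2 + m * n" for n m
  let ?F = "\<lambda>n m. - alt_sign n * w m * int_nth f (int N - 3 * tri n + 2 * n - n * m)"
  have ex: "int (ex n m) = 3 * tri (int n) - 2 * int n + int n * int m" if "n \<ge> 1" for n m
  proof -
    have "even (n * (3 * n - 1))" using that by (cases "even n") auto
    then obtain c where c: "n * (3 * n - 1) = 2 * c" by (elim evenE)
    have "int n * (3 * int n - 1) = 2 * int c"
      using arg_cong[OF c, of int] that by (simp add: of_nat_diff)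
    then have "2 * int c = 2 * (3 * tri (int n) - 2 * int n)"
      using two_tri[of "int n"] by (simp add: algebra_simps)
    then show ?thesis unfolding ex_def c by simp
  qed
  have W: "fps_nth (weighted_appell w) j = (\<Sum>m\<in>{1..nat S}. \<Sum>n\<in>{1..nat R}. if ex n m = j then (-1) ^ (n - 1) * w (int m) else 0)"
    if j: "j \<le> N" for j
  proof -
    have "fps_nth (weighted_appell w) j = (\<Sum>m\<in>{1..nat S}. w (int m) * fps_nth (appell_coeff m) j)"
      unfolding weighted_appell_def fps_nth_Abs_fps
      by (rule sum.mono_neutral_left) (use j S appell_coeff_nth_eq_0 in auto)
    also have "\<dots> = (\<Sum>m\<in>{1..nat S}. \<Sum>n\<in>{1..nat R}. if ex n m = j then (-1) ^ (n - 1) * w (int m) else 0)"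
    proof (rule sum.cong)
      fix m
      have "{n. n \<ge> 1 \<and> n * (3 * n - 1) div 2 + m * n = j} = {n\<in>{1..nat R}. ex n m = j}"
        using appell_index_bound[of _ m j] j R by (force simp: ex_def)
      then have "fps_nth (appell_coeff m) j = (\<Sum>n\<in>{n\<in>{1..nat R}. ex n m = j}. (-1) ^ (n - 1))"
        unfolding appell_coeff_def fps_nth_Abs_fps by (rule arg_cong)
      also have "\<dots> = (\<Sum>n\<in>{1..nat R}. if ex n m = j then (-1) ^ (n - 1) else 0)"
        by (rule sum.inter_filter) simp
      finally show "w (int m) * fps_nth (appell_coeff m) j = (\<Sum>n\<in>{1..nat R}. if ex n m = j then (-1) ^ (n - 1) * w (int m) else 0)"
        by (simp add: sum_distrib_left mult.commute if_distrib cong: if_cong)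
    qed simp
    finally show ?thesis .
  qed
  have "fps_nth (f * weighted_appell w) N = (\<Sum>j=0..N. fps_nth (weighted_appell w) j * fps_nth f (N - j))"
    by (subst mult.commute) (rule fps_mult_nth)
  also have "\<dots> = (\<Sum>j=0..N. \<Sum>m\<in>{1..nat S}. \<Sum>n\<in>{1..nat R}. if ex n m = j then (-1) ^ (n - 1) * w (int m) * fps_nth f (N - j) else 0)"
    by (intro sum.cong refl) (simp add: W sum_distrib_right if_distrib[of "\<lambda>x. x * _"] cong: if_cong)
  also have "\<dots> = (\<Sum>m\<in>{1..nat S}. \<Sum>j=0..N. \<Sum>n\<in>{1..nat R}. if ex n m = j then (-1) ^ (n - 1) * w (int m) * fps_nth f (N - j) else 0)"
    by (rule sum.swap)
  also have "\<dots> = (\<Sum>m\<in>{1..nat S}. \<Sum>n\<in>{1..nat R}. \<Sum>j=0..N. if ex n m = j then (-1) ^ (n - 1) * w (int m) * fps_nth f (N - j) else 0)"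
    by (rule sum.cong[OF refl]) (rule sum.swap)
  also have "\<dots> = (\<Sum>m\<in>{1..nat S}. \<Sum>n\<in>{1..nat R}. ?F (int n) (int m))"
  proof (intro sum.cong refl)
    fix m n :: nat assume n: "n \<in> {1..nat R}"
    have "(\<Sum>j=0..N. if ex n m = j then (-1) ^ (n - 1) * w (int m) * fps_nth f (N - j) else 0)
        = (-1) ^ (n - 1) * w (int m) * int_nth f (int N - int (ex n m))"
      by (auto simp: int_nth_def nat_diff_distrib')
    moreover have "(-1) ^ (n - 1) = - alt_sign (int n)"
      using n by (cases n) (auto simp: alt_sign_def minus_one_power_iff)
    moreover have "int N - int (ex n m) = int N - 3 * tri (int n) + 2 * int n - int n * int m"
      using ex n by simp
    ultimately show "(\<Sum>j=0..N. if ex n m = j then (-1) ^ (n - 1) * w (int m) * fps_nth f (N - j) else 0) = ?F (int n) (int m)"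
      by (simp only:)
  qed
  also have "\<dots> = (\<Sum>n\<in>{1..nat R}. \<Sum>m\<in>{1..nat S}. ?F (int n) (int m))"
    by (rule sum.swap)
  also have "\<dots> = (\<Sum>n\<in>{1..R}. \<Sum>m\<in>{1..nat S}. ?F n (int m))"
    by (rule sum.reindex_bij_witness[of _ nat int]) auto
  also have "\<dots> = (\<Sum>n\<in>{1..R}. \<Sum>m\<in>{1..S}. ?F n m)"
    by (intro sum.cong refl, rule sum.reindex_bij_witness[of _ nat int]) auto
  finally show ?thesis .
qed

text \<open>The involution \<open>n \<mapsto> 2 k - 1 - n\<close> fixes \<open>tri n - n k\<close> and changes the sign.\<close>

lemma alt_sum_pair:
  fixes G :: "int \<Rightarrow> int" and N B R k :: int
  assumes G: "\<And>y. y > N \<Longrightarrow> G y = 0" and "N \<ge> 0" and k: "\<bar>k\<bar> \<le> B" and R: "R \<ge> 2 * N + 2 * B + 8"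
  shows "(\<Sum>n\<in>{1..R}. - alt_sign n * G (tri n - n * k)) + (\<Sum>n\<in>{1..R}. - alt_sign n * G (tri n - n * (1 - k))) = G 0"
proof -
  define h where "h n = alt_sign n * G (tri n - n * k)" for n
  have supp: "{n. h n \<noteq> 0} \<subseteq> {- R..R}"
  proof
    fix n assume "n \<in> {n. h n \<noteq> 0}"
    then have le: "tri n - n * k \<le> N"
      using G by (force simp: h_def not_le)
    have eq: "2 * (tri n - n * k) = n * (n + 1 - 2 * k)"
      using two_tri[of n] by (simp add: algebra_simps)
    have "n \<le> R"
    proof (rule ccontr)
      assume "\<not> n \<le> R"
      then have "1 * (2 * N + 8) \<le> n * (n + 1 - 2 * k)"
        using k R \<open>N \<ge> 0\<close> by (intro mult_mono) auto
      then have "2 * N + 8 \<le> n * (n + 1 - 2 * k)"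
        by (simp only: mult_1_left)
      then show False using le unfolding eq[symmetric] by (auto dest: order_trans)
    qed
    moreover have "- R \<le> n"
    proof (rule ccontr)
      assume "\<not> - R \<le> n"
      then have "1 * (2 * N + 8) \<le> (- n) * (- n - 1 + 2 * k)"
        using k R \<open>N \<ge> 0\<close> by (intro mult_mono) auto
      then have "2 * N + 8 \<le> (- n) * (- n - 1 + 2 * k)"
        by (simp only: mult_1_left)
      also have "\<dots> = n * (n + 1 - 2 * k)" by (simp add: algebra_simps)
      finally show False using le unfolding eq[symmetric] by (auto dest: order_trans)
    qed
    ultimately show "n \<in> {- R..R}" by simp
  qed
  have S: "Sum_any h = sum h {- R..R}"
    using supp by (intro Sum_any.expand_superset) auto
  have "h (2 * k - 1 - n) = - h n" for n
  proof -
    have "2 * (tri (2 * k - 1 - n) - (2 * k - 1 - n) * k) = 2 * (tri n - n * k)"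
      unfolding right_diff_distrib two_tri by (simp add: algebra_simps)
    then have "tri (2 * k - 1 - n) - (2 * k - 1 - n) * k = tri n - n * k"
      by (rule mult_left_cancel[THEN iffD1, rotated]) simp
    moreover have "alt_sign (2 * k - 1 - n) = - alt_sign n"
      by (simp add: alt_sign_def)
    ultimately show ?thesis by (simp add: h_def)
  qed
  then have "Sum_any h = Sum_any (\<lambda>n. - h n)"
    using Sum_any_uminus_shift[of h "2 * k - 1"] by simp
  also have "\<dots> = (\<Sum>n\<in>{- R..R}. - h n)"
    using supp by (intro Sum_any.expand_superset) auto
  finally have 0: "sum h {- R..R} = 0"
    by (simp add: S sum_negf)
  have "R \<ge> 0" using R k \<open>N \<ge> 0\<close> by linarith
  then have "{- R..R} = {1..R} \<union> ({- R..-1} \<union> {0})" by auto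
  then have "sum h {- R..R} = sum h {1..R} + (sum h {- R..-1} + h 0)"
    by (simp add: sum.union_disjoint)
  \<comment> \<open>Because \<open>tri (- n)\<close> = \<open>tri n\<close> - n, the negative half
    of the vanishing total is the second sum of the claim, and the term n = 0 is G 0.\<close>
  also have "sum h {- R..-1} = (\<Sum>n\<in>{1..R}. alt_sign n * G (tri n - n * (1 - k)))"
  proof (rule sum.reindex_bij_witness[of _ uminus uminus])
    fix n
    have "tri (- n) - (- n) * k = tri n - n * (1 - k)"
      using two_tri[of n] two_tri[of "- n"] by (simp add: algebra_simps)
    moreover have "alt_sign (- n) = alt_sign n"
      by (simp add: alt_sign_def)
    moreover have "tri n - n * k = tri (- n) - (- n) * (1 - k)"
      using two_tri[of n] two_tri[of "- n"] by (simp add: algebra_simps)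
    ultimately show "alt_sign (- n) * G (tri (- n) - (- n) * (1 - k)) = h n"
      by (simp add: h_def)
  qed auto
  also have "h 0 = G 0"
    by (simp add: h_def alt_sign_def tri_def)
  finally show ?thesis
    using 0 by (simp add: h_def sum_negf)
qed

text \<open>Raising the shift J by one changes the inner sum over t by a single boundary term. The
  changes at J + 1 and at - J form a pair as in \<open>alt_sum_pair\<close>, so each of the |I|
  steps contributes G 0, with the sign of I.\<close>

lemma alt_sum_telescope:
  fixes G :: "int \<Rightarrow> int" and N B R T I :: int
  assumes G: "\<And>y. y > N \<Longrightarrow> G y = 0" and N: "N \<ge> 0" and I: "\<bar>I\<bar> \<le> B" and R: "R \<ge> 2 * N + 2 * B + 10" and T: "T \<ge> N + B + 1"
  shows "(\<Sum>n\<in>{1..R}. - alt_sign n * (\<Sum>t\<in>{0..T}. G (tri n + n * (t - I))))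
    - (\<Sum>n\<in>{1..R}. - alt_sign n * (\<Sum>t\<in>{0..T}. G (tri n + n * (t + I)))) = I * G 0"
proof -
  define D where "D J = (\<Sum>n\<in>{1..R}. - alt_sign n * (\<Sum>t\<in>{0..T}. G (tri n + n * (t - J))))" for J
  have T0: "T \<ge> 0" using T N I by linarith
  have step: "D (J + 1) - D J = (\<Sum>n\<in>{1..R}. - alt_sign n * G (tri n - n * (J + 1)))" if J: "J < B" for J
  proof -
    have "(\<Sum>t\<in>{0..T}. G (tri n + n * (t - (J + 1)))) - (\<Sum>t\<in>{0..T}. G (tri n + n * (t - J))) = G (tri n - n * (J + 1))"
      if n: "n \<in> {1..R}" for n
    proof -
      have "T - J \<le> n * (T - J)"
        using n J T N mult_right_mono[of 1 n "T - J"] by (simp only: mult_1_left) auto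
      then have "N < tri n + n * (T - J)"
        using tri_nonneg[of n] J T by linarith
      then have big: "G (tri n + n * (T - J)) = 0"
        by (rule G)
      \<comment> \<open>Shift t by one: the new lower end t = -1 is the boundary term, while the
        lost upper end t = T vanishes by \<open>big\<close>.\<close>
      have "(\<Sum>t\<in>{0..T}. G (tri n + n * (t - (J + 1)))) = (\<Sum>t\<in>{-1..T - 1}. G (tri n + n * (t - J)))"
        by (rule sum.reindex_bij_witness[of _ "\<lambda>t. t + 1" "\<lambda>t. t - 1"]) (auto simp: algebra_simps)
      also have "{-1..T - 1} = insert (-1) {0..T - 1}"
        using T0 by auto
      finally have 1: "(\<Sum>t\<in>{0..T}. G (tri n + n * (t - (J + 1)))) = G (tri n - n * (J + 1)) + (\<Sum>t\<in>{0..T - 1}. G (tri n + n * (t - J)))"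
        by (simp add: algebra_simps)
      have "{0..T} = insert T {0..T - 1}"
        using T0 by auto
      then have "(\<Sum>t\<in>{0..T}. G (tri n + n * (t - J))) = (\<Sum>t\<in>{0..T - 1}. G (tri n + n * (t - J)))"
        by (simp add: big)
      with 1 show ?thesis by simp
    qed
    then show ?thesis
      unfolding D_def sum_subtractf[symmetric] right_diff_distrib[symmetric] by (intro sum.cong refl) simp
  qed
  have pos: "D (int i) - D (- int i) = int i * G 0" if "int i \<le> B" for i
    using that
  proof (induction i)
    case (Suc i)
    have "D (int i + 1) - D (int i) = (\<Sum>n\<in>{1..R}. - alt_sign n * G (tri n - n * (int i + 1)))"
      using Suc.prems by (intro step) simp
    moreover have "D (- 1 - int i + 1) - D (- 1 - int i) = (\<Sum>n\<in>{1..R}. - alt_sign n * G (tri n - n * (- 1 - int i + 1)))"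
      using Suc.prems by (intro step) simp
    moreover have "(\<Sum>n\<in>{1..R}. - alt_sign n * G (tri n - n * (int i + 1)))
        + (\<Sum>n\<in>{1..R}. - alt_sign n * G (tri n - n * (1 - (int i + 1)))) = G 0"
      by (rule alt_sum_pair[where N = N and B = B]) (use G N Suc.prems R in auto)
    moreover have "- 1 - int i + 1 = 1 - (int i + 1)" "- 1 - int i + 1 = - int i" "int (Suc i) = int i + 1" "- int (Suc i) = - 1 - int i"
      by simp_all
    moreover have "D (int i) - D (- int i) = int i * G 0"
      using Suc by simp
    ultimately show ?case
      by (simp add: algebra_simps)
  qed simp
  have "D I - D (- I) = I * G 0"
  proof (cases "I \<ge> 0")
    case True
    then show ?thesis using pos[of "nat I"] I by simp
  next
    case False
    then show ?thesis using pos[of "nat (- I)"] I by simp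
  qed
  then show ?thesis by (simp add: D_def)
qed


lemma sum_residues_upto:
  fixes F :: "int \<Rightarrow> int"
  assumes "T \<ge> 0"
  shows "(\<Sum>m\<in>{1..11 * (T + 1)}. F m) = (\<Sum>t\<in>{0..T}. \<Sum>r\<in>{-5..5}. F (r + 11 * t + 6))"
proof -
  have dm: "(5 + (r + 11 * t)) mod 11 - 5 = r" "(5 + (r + 11 * t)) div 11 = t" if "r \<in> {-5..5}" for r t :: int
  proof -
    have "5 + (r + 11 * t) = (r + 5) + t * 11" by simp
    then show "(5 + (r + 11 * t)) mod 11 - 5 = r" "(5 + (r + 11 * t)) div 11 = t"
      using that by (simp_all only: mod_mult_self1 div_mult_self1) auto
  qed
  have "(\<Sum>m\<in>{1..11 * (T + 1)}. F m) = (\<Sum>(t, r)\<in>{0..T} \<times> {-5..5}. F (r + 11 * t + 6))"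
    by (rule sum.reindex_bij_witness[where i = "\<lambda>(t, r). r + 11 * t + 6" and j = "\<lambda>m. ((m - 1) div 11, (m - 1) mod 11 - 5)"])
       (auto simp: minus_mod_eq_mult_div[symmetric] dm)
  then show ?thesis
    by (simp only: sum.cartesian_product)
qed

lemma power_cong_121: "[(r + 11 * i) ^ k = r ^ k + 11 * int k * i * r ^ (k - 1)] (mod 121)" for r i :: int
proof (induction k)
  case (Suc k)
  have "[(r + 11 * i) ^ Suc k = (r + 11 * i) * (r ^ k + 11 * int k * i * r ^ (k - 1))] (mod 121)"
    unfolding power_Suc by (intro cong_mult cong_refl Suc.IH)
  also have "(r + 11 * i) * (r ^ k + 11 * int k * i * r ^ (k - 1)) = (r ^ Suc k + 11 * int (Suc k) * i * r ^ (Suc k - 1)) + 121 * (int k * i\<^sup>2 * r ^ (k - 1))"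
    by (cases k) (simp_all add: power2_eq_square algebra_simps)
  also have "[\<dots> = r ^ Suc k + 11 * int (Suc k) * i * r ^ (Suc k - 1)] (mod 121)"
    by (simp add: cong_iff_dvd_diff)
  finally show ?case .
qed simp

text \<open>First order expansion in 11 i. The linear coefficient is b r^(b-1) - (b + 10) r^(b+9),
  which modulo 11 is - 10 r^(b-1) = r^(b-1) by Fermat, or 0 when r = 0.\<close>

lemma power_diff_cong_121:
  fixes r i :: int
  assumes r: "r \<in> {-5..5}" and b: "b \<ge> 2"
  shows "[(r + 11 * i) ^ b - (r + 11 * i) ^ (b + 10) = r ^ b * (1 - r ^ 10) + 11 * (r ^ (b - 1) * i)] (mod 121)"
proof -
  obtain c where c: "b = Suc (Suc c)" using b by (metis Suc_le_D numeral_2_eq_2 Suc_le_mono)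
  have "11 dvd r ^ Suc c * (int b - (int b + 10) * r ^ 10 - 1)"
  proof (cases "r = 0")
    case False
    then have "11 dvd r ^ 10 - 1"
      using residue_power_10[OF r] by (simp add: cong_iff_dvd_diff)
    moreover have "int b - (int b + 10) * r ^ 10 - 1 = - (int b + 10) * (r ^ 10 - 1) + 11 * (- 1)"
      by (simp add: algebra_simps)
    ultimately have "11 dvd int b - (int b + 10) * r ^ 10 - 1"
      by (simp only: dvd_add dvd_mult dvd_triv_left)
    then show ?thesis by (rule dvd_mult)
  qed simp
  then obtain d where d: "r ^ Suc c * (int b - (int b + 10) * r ^ 10 - 1) = 11 * d" ..
  have "[(r + 11 * i) ^ b - (r + 11 * i) ^ (b + 10) = (r ^ b + 11 * int b * i * r ^ (b - 1)) - (r ^ (b + 10) + 11 * int (b + 10) * i * r ^ (b + 10 - 1))] (mod 121)"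
    by (intro cong_diff power_cong_121)
  also have "(r ^ b + 11 * int b * i * r ^ (b - 1)) - (r ^ (b + 10) + 11 * int (b + 10) * i * r ^ (b + 10 - 1))
      = (r ^ b * (1 - r ^ 10) + 11 * (r ^ (b - 1) * i)) + 11 * i * (r ^ Suc c * (int b - (int b + 10) * r ^ 10 - 1))"
    by (simp add: c power_add algebra_simps eval_nat_numeral)
  also have "\<dots> = (r ^ b * (1 - r ^ 10) + 11 * (r ^ (b - 1) * i)) + 121 * (i * d)"
    unfolding d by simp
  also have "[\<dots> = r ^ b * (1 - r ^ 10) + 11 * (r ^ (b - 1) * i)] (mod 121)"
    by (simp add: cong_iff_dvd_diff)
  finally show ?thesis .
qed

text \<open>Off the class \<open>x \<equiv> 0\<close> the coefficients of \<open>E\<^sup>3\<^sup>2\<close> are traded for sums of coefficients of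
  \<open>theta8\<close>; quasi-periodicity then makes the double sum telescope to \<open>\<Sum> r\<^sup>a\<^sup>-\<^sup>2 i theta8 (r + 11 i)\<close>,
  and \<open>i\<close> is recovered from \<open>r + 11 i\<close> by comparing powers modulo \<open>121\<close>.\<close>

theorem weighted_appell_cong:
  assumes N: "N mod 11 = 6" and a: "odd a" "a \<ge> 3" and dvd: "11 dvd fps_nth (euler_E ^ 32) N"
  shows "[11 * fps_nth (euler_E ^ 32 * weighted_appell (\<lambda>m. (m - 6) ^ a)) N
    = fps_nth (theta8_moment (a - 1)) N - fps_nth (theta8_moment (a + 9)) N] (mod 121)"
proof -
  \<comment> \<open>B bounds the relevant i (see \<open>supp\<close>); R and T are the cut-offs that
    \<open>alt_sum_telescope\<close> asks for.\<close>
  define B R T where "B = int N + 5" and "R = 2 * int N + 2 * (int N + 5) + 10" and "T = int N + (int N + 5) + 1"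
  define c where "c = a - 2"
  define e where "e = int_nth (euler_E ^ 32)"
  define G where "G \<mu> y = theta8 \<mu> (int N - 11 * y)" for \<mu> y
  define D where "D \<mu> J = (\<Sum>n\<in>{1..R}. - alt_sign n * (\<Sum>t\<in>{0..T}. G \<mu> (tri n + n * (t - J))))" for \<mu> J
  define W where "W = fps_nth (euler_E ^ 32 * weighted_appell (\<lambda>m. (m - 6) ^ a)) N"
  obtain N' where N': "int N = 11 * N' + 6"
    using N by (metis of_nat_mod mult_div_mod_eq of_nat_numeral)
  have c: "odd c" "c \<ge> 1" "a = c + 2" using a by (auto simp: c_def)
  have W_eq: "W = (\<Sum>n\<in>{1..R}. \<Sum>t\<in>{0..T}. \<Sum>r\<in>{-5..5}. - alt_sign n * (r + 11 * t) ^ a * e (int N - 3 * tri n + 2 * n - n * (r + 11 * t + 6)))"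
  proof -
    have "W = (\<Sum>n\<in>{1..R}. \<Sum>m\<in>{1..11 * (T + 1)}. - alt_sign n * (m - 6) ^ a * e (int N - 3 * tri n + 2 * n - n * m))"
      unfolding W_def e_def by (rule weighted_appell_mult_nth) (simp_all add: R_def T_def)
    also have "\<dots> = (\<Sum>n\<in>{1..R}. \<Sum>t\<in>{0..T}. \<Sum>r\<in>{-5..5}. - alt_sign n * (r + 11 * t + 6 - 6) ^ a * e (int N - 3 * tri n + 2 * n - n * (r + 11 * t + 6)))"
      by (intro sum.cong refl sum_residues_upto) (simp add: T_def)
    finally show ?thesis by simp
  qed
  \<comment> \<open>The support bound for \<open>theta8\<close> becomes 33 i^2 + 88 (n - i)^2 + r^2
    + 22 r i <= 16 N + 16, which bounds i because the quadratic form is definite.\<close>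
  have supp: "i \<in> {- B..B}" if "G (r + 11 * i) (tri n + n * (t - i)) \<noteq> 0" "n \<ge> 0" "t \<ge> 0" "r \<in> {-5..5}" for r i n t
  proof (rule ccontr)
    assume "i \<notin> {- B..B}"
    then have i: "\<bar>i\<bar> \<ge> int N + 6" by (auto simp: B_def)
    have "(r + 11 * i)\<^sup>2 \<le> 16 * (int N - 11 * (tri n + n * (t - i)) + 1)"
      using that(1) unfolding G_def by (rule theta8_support)
    also have "\<dots> = 16 * int N + 16 - 88 * n\<^sup>2 - 88 * n - 176 * (n * t) + 176 * n * i"
      using two_tri[of n] by (simp add: power2_eq_square algebra_simps)
    also have "\<dots> \<le> 16 * int N + 16 - 88 * n\<^sup>2 + 176 * n * i"
      using that mult_nonneg_nonneg[of n t] by linarith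
    finally have "33 * i\<^sup>2 + 88 * (n - i)\<^sup>2 + r\<^sup>2 + 22 * (r * i) \<le> 16 * int N + 16"
      by (simp add: power2_eq_square algebra_simps)
    moreover have "0 \<le> 88 * (n - i)\<^sup>2" "0 \<le> r\<^sup>2" by simp_all
    moreover have "\<bar>r * i\<bar> \<le> 5 * \<bar>i\<bar>"
      unfolding abs_mult using that(4) by (intro mult_right_mono) auto
    moreover have "\<bar>i\<bar> * 6 \<le> i\<^sup>2"
      unfolding power2_eq_square abs_mult_self_eq[of i, symmetric] using i by (intro mult_left_mono) auto
    ultimately have "33 * (\<bar>i\<bar> * 6) - 110 * \<bar>i\<bar> \<le> 16 * int N + 16"
      by linarith
    then show False using i by linarith
  qed
  have termwise: "[(r + 11 * t) ^ a * e (int N - 3 * tri n + 2 * n - n * (r + 11 * t + 6))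
      = 2 * r ^ c * (\<Sum>i\<in>{- B..B}. G (r + 11 * i) (tri n + n * (t - i)))] (mod 11)"
    if n: "n \<in> {1..R}" and t: "t \<in> {0..T}" and r: "r \<in> {-5..5}" for n t r
  proof -
    define x where "x = r + 11 * t"
    define K where "K = int N - 3 * tri n + 2 * n - n * (x + 6)"
    have n0: "n = int (nat n)" using n by simp
    have "2 * (K + 5) + 3 * n\<^sup>2 + 2 * x * n = 11 * (2 * N' + 2 - n)"
      using two_tri[of n] by (simp add: K_def N' power2_eq_square algebra_simps)
    then have "[2 * (K + 5) + 3 * n\<^sup>2 + 2 * x * n = 0] (mod 11)"
      by (simp only: cong_0_iff dvd_triv_left)
    then have L: "[Sum_any (\<lambda>i. theta8 (x + 3 * n + 11 * i) K) = 6 * x\<^sup>2 * e K] (mod 11)"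
      unfolding e_def by (rule theta8_residue_class)
    have "theta8 (x + 3 * n + 11 * i) K = G (r + 11 * (i + (t + n))) (tri n + n * (t - (i + (t + n))))" for i
    proof -
      \<comment> \<open>The shift by 8 n completes 3 n to 11 n. The exponent of q then becomes N
        minus a multiple of 11 for all n and t, so the terms can be compared.\<close>
      have "theta8 (x + 3 * n + 11 * i) K = theta8 (x + 3 * n + 11 * i + 8 * n) (K + n * (x + 3 * n + 11 * i) + 4 * n\<^sup>2)"
        by (subst (1 2 3) n0) (rule theta8_shift[symmetric])
      moreover have "x + 3 * n + 11 * i + 8 * n = r + 11 * (i + (t + n))"
        by (simp add: x_def)
      moreover have "K + n * (x + 3 * n + 11 * i) + 4 * n\<^sup>2 = int N - 11 * (tri n + n * (t - (i + (t + n))))"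
        using two_tri[of n] by (simp add: K_def x_def power2_eq_square algebra_simps)
      ultimately show ?thesis by (simp add: G_def)
    qed
    then have "Sum_any (\<lambda>i. theta8 (x + 3 * n + 11 * i) K) = Sum_any (\<lambda>i. G (r + 11 * (i + (t + n))) (tri n + n * (t - (i + (t + n)))))"
      by (simp only:)
    also have "\<dots> = Sum_any (\<lambda>i. G (r + 11 * i) (tri n + n * (t - i)))"
      by (rule Sum_any_shift)
    also have "\<dots> = (\<Sum>i\<in>{- B..B}. G (r + 11 * i) (tri n + n * (t - i)))"
      by (rule Sum_any.expand_superset) (use supp n t r in auto)
    finally have S: "Sum_any (\<lambda>i. theta8 (x + 3 * n + 11 * i) K) = \<dots>" .
    \<comment> \<open>The factor 2 inverts the 6 of \<open>theta8_residue_class\<close>, as 12 is 1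
      modulo 11.\<close>
    have "2 * x ^ c * (6 * x\<^sup>2 * e K) = 12 * (x ^ a * e K)"
      by (simp add: c(3) power_add power2_eq_square)
    moreover have "[p = 12 * p] (mod 11)" for p :: int
      by (simp add: cong_iff_dvd_diff)
    ultimately have "[x ^ a * e K = 2 * x ^ c * (6 * x\<^sup>2 * e K)] (mod 11)"
      by (simp only:)
    also have "[2 * x ^ c * (6 * x\<^sup>2 * e K) = 2 * r ^ c * (\<Sum>i\<in>{- B..B}. G (r + 11 * i) (tri n + n * (t - i)))] (mod 11)"
      using cong_sym[OF L] unfolding S
      by (intro cong_mult cong_refl cong_pow) (auto simp: x_def cong_iff_dvd_diff)
    finally show ?thesis
      by (simp only: x_def K_def)
  qed
  \<comment> \<open>As \<open>theta8\<close> is even in the exponent, (r, i) -> (- r, - i) turns D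
    at i into D at - i. With c odd this changes the sign, so twice the sum becomes a sum of the
    differences that telescope.\<close>
  have flip: "(\<Sum>r\<in>{-5..5}. \<Sum>i\<in>{- B..B}. r ^ c * D (r + 11 * i) i) = (\<Sum>r\<in>{-5..5}. \<Sum>i\<in>{- B..B}. (- r) ^ c * D (r + 11 * i) (- i))"
  proof (rule sum.reindex_bij_witness[of _ uminus uminus])
    fix r :: int
    have D: "D (- r + 11 * (- i)) i = D (r + 11 * i) i" for i
      using theta8_uminus[of "r + 11 * i"] by (simp add: D_def G_def)
    have "(\<Sum>i\<in>{- B..B}. (- (- r)) ^ c * D (- r + 11 * i) (- i)) = (\<Sum>i\<in>{- B..B}. r ^ c * D (- r + 11 * (- i)) i)"
      by (rule sum.reindex_bij_witness[of _ uminus uminus]) auto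
    also have "\<dots> = (\<Sum>i\<in>{- B..B}. r ^ c * D (r + 11 * i) i)"
      by (simp only: D)
    finally show "(\<Sum>i\<in>{- B..B}. (- (- r)) ^ c * D (- r + 11 * i) (- i)) = (\<Sum>i\<in>{- B..B}. r ^ c * D (r + 11 * i) i)"
      by simp
  qed auto
  have "[W = (\<Sum>n\<in>{1..R}. \<Sum>t\<in>{0..T}. \<Sum>r\<in>{-5..5}. - alt_sign n * (2 * r ^ c * (\<Sum>i\<in>{- B..B}. G (r + 11 * i) (tri n + n * (t - i)))))] (mod 11)"
    unfolding W_eq mult.assoc[of "- alt_sign _"] by (intro cong_sum cong_mult cong_refl termwise)
  also have "(\<Sum>n\<in>{1..R}. \<Sum>t\<in>{0..T}. \<Sum>r\<in>{-5..5}. - alt_sign n * (2 * r ^ c * (\<Sum>i\<in>{- B..B}. G (r + 11 * i) (tri n + n * (t - i)))))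
      = (\<Sum>n\<in>{1..R}. \<Sum>t\<in>{0..T}. \<Sum>r\<in>{-5..5}. \<Sum>i\<in>{- B..B}. 2 * r ^ c * (- alt_sign n * G (r + 11 * i) (tri n + n * (t - i))))"
    by (simp add: sum_distrib_left mult_ac sum_negf)
  also have "\<dots> = (\<Sum>n\<in>{1..R}. \<Sum>r\<in>{-5..5}. \<Sum>t\<in>{0..T}. \<Sum>i\<in>{- B..B}. 2 * r ^ c * (- alt_sign n * G (r + 11 * i) (tri n + n * (t - i))))"
    by (rule sum.cong[OF refl]) (rule sum.swap)
  also have "\<dots> = (\<Sum>r\<in>{-5..5}. \<Sum>n\<in>{1..R}. \<Sum>t\<in>{0..T}. \<Sum>i\<in>{- B..B}. 2 * r ^ c * (- alt_sign n * G (r + 11 * i) (tri n + n * (t - i))))"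
    by (rule sum.swap)
  also have "\<dots> = (\<Sum>r\<in>{-5..5}. \<Sum>n\<in>{1..R}. \<Sum>i\<in>{- B..B}. \<Sum>t\<in>{0..T}. 2 * r ^ c * (- alt_sign n * G (r + 11 * i) (tri n + n * (t - i))))"
    by (rule sum.cong[OF refl], rule sum.cong[OF refl]) (rule sum.swap)
  also have "\<dots> = (\<Sum>r\<in>{-5..5}. \<Sum>i\<in>{- B..B}. \<Sum>n\<in>{1..R}. \<Sum>t\<in>{0..T}. 2 * r ^ c * (- alt_sign n * G (r + 11 * i) (tri n + n * (t - i))))"
    by (rule sum.cong[OF refl]) (rule sum.swap)
  also have "\<dots> = (\<Sum>r\<in>{-5..5}. \<Sum>i\<in>{- B..B}. r ^ c * D (r + 11 * i) i) + (\<Sum>r\<in>{-5..5}. \<Sum>i\<in>{- B..B}. r ^ c * D (r + 11 * i) i)"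
    by (simp add: D_def sum_distrib_left sum.distrib[symmetric] mult_ac sum_negf)
  also have "(\<Sum>r\<in>{-5..5}. \<Sum>i\<in>{- B..B}. r ^ c * D (r + 11 * i) i) + (\<Sum>r\<in>{-5..5}. \<Sum>i\<in>{- B..B}. r ^ c * D (r + 11 * i) i)
      = (\<Sum>r\<in>{-5..5}. \<Sum>i\<in>{- B..B}. r ^ c * (D (r + 11 * i) i - D (r + 11 * i) (- i)))"
  proof -
    have "(\<Sum>r\<in>{-5..5}. \<Sum>i\<in>{- B..B}. r ^ c * D (r + 11 * i) i) + (\<Sum>r\<in>{-5..5}. \<Sum>i\<in>{- B..B}. r ^ c * D (r + 11 * i) i) = (\<Sum>r\<in>{-5..5}. \<Sum>i\<in>{- B..B}. (- r) ^ c * D (r + 11 * i) (- i)) + (\<Sum>r\<in>{-5..5}. \<Sum>i\<in>{- B..B}. r ^ c * D (r + 11 * i) i)"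
      using flip by simp
    also have "\<dots> = (\<Sum>r\<in>{-5..5}. \<Sum>i\<in>{- B..B}. r ^ c * (D (r + 11 * i) i - D (r + 11 * i) (- i)))"
      using c(1) by (simp add: sum.distrib[symmetric] algebra_simps)
    finally show ?thesis .
  qed
  also have "\<dots> = (\<Sum>r\<in>{-5..5}. \<Sum>i\<in>{- B..B}. r ^ c * i * theta8 (r + 11 * i) (int N))"
  proof (intro sum.cong refl)
    fix r i assume i: "i \<in> {- B..B}"
    have "D (r + 11 * i) i - D (r + 11 * i) (- i) = i * G (r + 11 * i) 0"
      unfolding D_def diff_minus_eq_add
      by (rule alt_sum_telescope[where N = "int N" and B = B])
         (use i in \<open>auto simp: G_def B_def R_def T_def theta8_neg\<close>)
    then show "r ^ c * (D (r + 11 * i) i - D (r + 11 * i) (- i)) = r ^ c * i * theta8 (r + 11 * i) (int N)"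
      by (simp add: G_def)
  qed
  finally have W: "[W = (\<Sum>r\<in>{-5..5}. \<Sum>i\<in>{- B..B}. r ^ c * i * theta8 (r + 11 * i) (int N))] (mod 11)" .
  then have W11: "[11 * W = 11 * (\<Sum>r\<in>{-5..5}. \<Sum>i\<in>{- B..B}. r ^ c * i * theta8 (r + 11 * i) (int N))] (mod 121)"
    using cong_cmult_leftI[of W _ 11 11] by simp
  have suppN: "i \<in> {- B..B}" if "theta8 (r + 11 * i) (int N) \<noteq> 0" "r \<in> {-5..5}" for r i
    using supp[of r i 0 0] that by (simp add: G_def tri_def)
  have moment: "fps_nth (theta8_moment b) N = (\<Sum>r\<in>{-5..5}. \<Sum>i\<in>{- B..B}. (r + 11 * i) ^ b * theta8 (r + 11 * i) (int N))" for b
  proof -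
    have "fps_nth (theta8_moment b) N = (\<Sum>r\<in>{-5..5}. Sum_any (\<lambda>i. (r + 11 * i) ^ b * theta8 (r + 11 * i) (int N)))"
      unfolding theta8_moment_def fps_nth_Abs_fps by (rule Sum_any_residues) (rule finite_theta8)
    also have "\<dots> = (\<Sum>r\<in>{-5..5}. \<Sum>i\<in>{- B..B}. (r + 11 * i) ^ b * theta8 (r + 11 * i) (int N))"
      by (intro sum.cong refl Sum_any.expand_superset) (use suppN in auto)
    finally show ?thesis .
  qed
  have inner: "[(\<Sum>i\<in>{- B..B}. ((r + 11 * i) ^ (a - 1) - (r + 11 * i) ^ (a + 9)) * theta8 (r + 11 * i) (int N))
      = 11 * (\<Sum>i\<in>{- B..B}. r ^ c * i * theta8 (r + 11 * i) (int N))] (mod 121)" if r: "r \<in> {-5..5}" for r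
  proof -
    \<comment> \<open>The leading term r^(a-1) (1 - r^10) is divisible by 11 only once. The second
      factor 11 comes from U, which is 6 r^2 times the N-th coefficient of E^32 modulo 11.\<close>
    define U where "U = (\<Sum>i\<in>{- B..B}. theta8 (r + 11 * i) (int N))"
    have "Sum_any (\<lambda>i. theta8 (r + 3 * 0 + 11 * i) (int N)) = U"
      unfolding U_def by (subst Sum_any.expand_superset[of "{- B..B}"]) (use suppN r in auto)
    moreover have "[2 * (int N + 5) + 3 * 0\<^sup>2 + 2 * r * 0 = 0] (mod 11)"
      by (simp add: N' cong_0_iff)
    ultimately have "[U = 6 * r\<^sup>2 * int_nth (euler_E ^ 32) (int N)] (mod 11)"
      using theta8_residue_class[of "int N" 0 r] by simp
    then have U: "11 dvd U"
      using dvd by (auto simp: cong_dvd_iff)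
    have P: "11 dvd r ^ (a - 1) * (1 - r ^ 10)"
    proof (cases "r = 0")
      case False
      then have "11 dvd 1 - r ^ 10"
        using cong_sym[OF residue_power_10[OF r]] by (simp add: cong_iff_dvd_diff)
      then show ?thesis by (rule dvd_mult)
    qed (use a in \<open>simp add: power_0_left\<close>)
    have a': "(a - 1) + 10 = a + 9" "a - 1 \<ge> 2" "a - 1 - 1 = c" using a c by auto
    have "[(r + 11 * i) ^ (a - 1) - (r + 11 * i) ^ (a + 9) = r ^ (a - 1) * (1 - r ^ 10) + 11 * (r ^ c * i)] (mod 121)" for i
      using power_diff_cong_121[OF r a'(2)] unfolding a' .
    then have "[(\<Sum>i\<in>{- B..B}. ((r + 11 * i) ^ (a - 1) - (r + 11 * i) ^ (a + 9)) * theta8 (r + 11 * i) (int N))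
      = (\<Sum>i\<in>{- B..B}. (r ^ (a - 1) * (1 - r ^ 10) + 11 * (r ^ c * i)) * theta8 (r + 11 * i) (int N))] (mod 121)"
      by (intro cong_sum cong_mult cong_refl)
    also have "(\<Sum>i\<in>{- B..B}. (r ^ (a - 1) * (1 - r ^ 10) + 11 * (r ^ c * i)) * theta8 (r + 11 * i) (int N))
      = r ^ (a - 1) * (1 - r ^ 10) * U + 11 * (\<Sum>i\<in>{- B..B}. r ^ c * i * theta8 (r + 11 * i) (int N))"
      unfolding U_def sum_distrib_left sum.distrib[symmetric] by (intro sum.cong refl) (simp add: algebra_simps)
    also have "[\<dots> = 11 * (\<Sum>i\<in>{- B..B}. r ^ c * i * theta8 (r + 11 * i) (int N))] (mod 121)"
      using mult_dvd_mono[OF P U] by (simp add: cong_iff_dvd_diff)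
    finally show ?thesis .
  qed
  let ?P = "\<Sum>r\<in>{-5..5}. \<Sum>i\<in>{- B..B}. r ^ c * i * theta8 (r + 11 * i) (int N)"
  have M: "fps_nth (theta8_moment (a - 1)) N - fps_nth (theta8_moment (a + 9)) N
      = (\<Sum>r\<in>{-5..5}. \<Sum>i\<in>{- B..B}. ((r + 11 * i) ^ (a - 1) - (r + 11 * i) ^ (a + 9)) * theta8 (r + 11 * i) (int N))"
    unfolding moment by (simp add: sum_subtractf left_diff_distrib)
  have S: "11 * ?P = (\<Sum>r\<in>{-5..5}. 11 * (\<Sum>i\<in>{- B..B}. r ^ c * i * theta8 (r + 11 * i) (int N)))"
    by (rule sum_distrib_left)
  have "[(\<Sum>r\<in>{-5..5}. \<Sum>i\<in>{- B..B}. ((r + 11 * i) ^ (a - 1) - (r + 11 * i) ^ (a + 9)) * theta8 (r + 11 * i) (int N)) = 11 * ?P] (mod 121)"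
    unfolding S by (rule cong_sum) (rule inner)
  from cong_trans[OF W11 cong_sym[OF this]] show ?thesis
    unfolding W_def M .
qed

section \<open>The Eisenstein series of weight 10 and the discriminant\<close>

text \<open>The product of the two invariants a^2 - a b + b^2 and (a b (a - b))^2 gives the
  difference - 6 a^3 b^3 (a^2 + b^2).\<close>

lemma sigma_series_3_5: "5040 * (sigma_series 3 * sigma_series 5) = 10 * sigma_series 3 - 21 * sigma_series 5 + 11 * sigma_series 9"
proof (rule fps_ext)
  fix n
  define q :: "int \<Rightarrow> int \<Rightarrow> int" where "q a b = (a\<^sup>2 - a * b + b\<^sup>2) * (a * b * (a - b))\<^sup>2" for a b
  have below: "420 * (\<Sum>b\<in>{1..<d}. q (int d) (int b)) = 11 * int d ^ 9 - 21 * int d ^ 5 + 10 * int d ^ 3" for d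
  proof (cases "d = 0")
    case False
    have "420 * (\<Sum>b\<in>{1..<d}. q (int d) (int b)) = 70 * int d ^ 6 * (6 * (\<Sum>b\<in>{1..<d}. int b ^ 2)) - 315 * int d ^ 5 * (4 * (\<Sum>b\<in>{1..<d}. int b ^ 3)) + 56 * int d ^ 4 * (30 * (\<Sum>b\<in>{1..<d}. int b ^ 4)) - 105 * int d ^ 3 * (12 * (\<Sum>b\<in>{1..<d}. int b ^ 5)) + 10 * int d ^ 2 * (42 * (\<Sum>b\<in>{1..<d}. int b ^ 6))"
      by (simp add: q_def sum.distrib sum_subtractf sum_distrib_left algebra_simps eval_nat_numeral)
    also have "\<dots> = 11 * int d ^ 9 - 21 * int d ^ 5 + 10 * int d ^ 3"
      unfolding sum_power_below using False by (simp add: of_nat_diff algebra_simps eval_nat_numeral)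
    finally show ?thesis .
  qed simp
  show "fps_nth (5040 * (sigma_series 3 * sigma_series 5)) n = fps_nth (10 * sigma_series 3 - 21 * sigma_series 5 + 11 * sigma_series 9) n"
  proof (cases "n = 0")
    case False
    have *: "5040 * fps_nth (sigma_series 3 * sigma_series 5) n = 2520 * fps_nth (sigma_series 3 * sigma_series 5) n + 2520 * fps_nth (sigma_series 5 * sigma_series 3) n"
      by (simp add: mult.commute)
    have "5040 * fps_nth (sigma_series 3 * sigma_series 5) n = - 420 * (\<Sum>(a, b, x, y)\<in>bilin_reps n. q (int a) (int b) - q (int a + int b) (int b))"
      unfolding * unfolding sigma_series_mult_nth
      by (simp add: sum_distrib_left sum.distrib[symmetric] case_prod_unfold q_def algebra_simps eval_nat_numeral)
    also have "\<dots> = (\<Sum>d | d dvd n. 420 * (\<Sum>b\<in>{1..<d}. q (int d) (int b)) - 420 * (int (n div d) - 1) * q (int d) (int d))"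
      by (subst bilin_reps_sum) (use False in \<open>auto simp: q_def sum_distrib_left algebra_simps eval_nat_numeral sum_negf[symmetric] simp del: sum_negf intro!: sum.cong\<close>)
    also have "\<dots> = (\<Sum>d | d dvd n. 11 * int d ^ 9 - 21 * int d ^ 5 + 10 * int d ^ 3)"
      by (rule sum.cong) (use below in \<open>simp_all add: q_def algebra_simps eval_nat_numeral\<close>)
    also have "\<dots> = fps_nth (10 * sigma_series 3 - 21 * sigma_series 5 + 11 * sigma_series 9) n"
      using False by (simp add: sigma_series_nth qderiv_sigma_series_nth sum.distrib sum_subtractf sum_distrib_left del: qderiv_nth)
    finally show ?thesis
      by (simp add: power2_eq_square numeral_fps_const)
  qed (simp add: sigma_series_nth fps_mult_nth numeral_fps_const power2_eq_square)
qed


lemma eisenstein_E4_E6: "eisenstein_E4 * eisenstein_E6 = 1 - 264 * sigma_series 9"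
  using sigma_series_3_5 unfolding eisenstein_eq by algebra

text \<open>The equation D h = E2 h reads (n - 1) h_n = a combination of earlier coefficients. Hence
  h_0 = 0, h_1 is free, and all others are determined.\<close>

lemma fps_eq_by_qderiv:
  assumes f: "qderiv f = eisenstein_E2 * f" and g: "qderiv g = eisenstein_E2 * g"
    and 1: "fps_nth f 1 = fps_nth g 1"
  shows "f = g"
proof (rule fps_ext)
  fix n
  define h where "h = f - g"
  have h: "qderiv h = eisenstein_E2 * h"
    by (simp add: h_def f g algebra_simps)
  have "fps_nth h n = 0"
  proof (induction n rule: less_induct)
    case (less n)
    show ?case
    proof (cases "n = 1")
      case False
      have "int n * fps_nth h n = fps_nth (eisenstein_E2 * h) n"
        using arg_cong[OF h, of "\<lambda>f. fps_nth f n"] by simp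
      also have "\<dots> = (\<Sum>i\<in>{0}. fps_nth eisenstein_E2 i * fps_nth h (n - i))"
        unfolding fps_mult_nth by (rule sum.mono_neutral_right) (use less in auto)
      finally have "(int n - 1) * fps_nth h n = 0"
        by (simp add: algebra_simps)
      then show ?thesis using False by simp
    qed (use 1 in \<open>simp add: h_def\<close>)
  qed
  then show "fps_nth f n = fps_nth g n"
    by (simp add: h_def)
qed

text \<open>Both sides solve D f = E2 f, by \<open>qderiv_euler_E'\<close> and Ramanujan's
  equations; the first coefficients are both 1728.\<close>

lemma eisenstein_discriminant: "1728 * (fps_X * euler_E ^ 24) = eisenstein_E4 ^ 3 - eisenstein_E6 ^ 2"
proof (rule fps_eq_by_qderiv)
  have "24 * qderiv (euler_E ^ 24) = 24 * ((eisenstein_E2 - 1) * euler_E ^ 24)"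
  proof -
    have "24 * qderiv (euler_E ^ 24) = 24 * euler_E ^ 23 * (24 * qderiv euler_E)"
      by (simp add: qderiv_power)
    also have "\<dots> = 24 * ((eisenstein_E2 - 1) * (euler_E ^ 23 * euler_E))"
      unfolding qderiv_euler_E' by (simp only: mult_ac)
    also have "euler_E ^ 23 * euler_E = euler_E ^ 24"
      using power_add[of euler_E 23 1] by simp
    finally show ?thesis .
  qed
  then have q: "qderiv (euler_E ^ 24) = (eisenstein_E2 - 1) * euler_E ^ 24"
    by (rule mult_left_cancel[THEN iffD1, rotated]) simp
  have "qderiv (1728 * (fps_X * euler_E ^ 24)) = 1728 * (fps_X * euler_E ^ 24 + fps_X * qderiv (euler_E ^ 24))"
    by (simp add: qderiv_mult qderiv_def[of fps_X])
  then show "qderiv (1728 * (fps_X * euler_E ^ 24)) = eisenstein_E2 * (1728 * (fps_X * euler_E ^ 24))"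
    unfolding q by (simp add: algebra_simps)
  have "6 * qderiv (eisenstein_E4 ^ 3 - eisenstein_E6 ^ 2) = 6 * (eisenstein_E2 * (eisenstein_E4 ^ 3 - eisenstein_E6 ^ 2))"
    using ramanujan_E4 ramanujan_E6 by (simp add: qderiv_power) algebra
  then show "qderiv (eisenstein_E4 ^ 3 - eisenstein_E6 ^ 2) = eisenstein_E2 * (eisenstein_E4 ^ 3 - eisenstein_E6 ^ 2)"
    by (rule mult_left_cancel[THEN iffD1, rotated]) simp
  have "divisor_sigma j 1 = 1" for j
    by (simp add: divisor_sigma_def)
  then have "fps_nth (sigma_series j) 1 = 1" "fps_nth (sigma_series j) 0 = 0" for j
    by (simp_all add: sigma_series_def)
  then show "fps_nth (1728 * (fps_X * euler_E ^ 24)) 1 = fps_nth (eisenstein_E4 ^ 3 - eisenstein_E6 ^ 2) 1"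
    unfolding eisenstein_eq by (simp add: numeral_fps_const fps_mult_nth power2_eq_square power3_eq_cube fps_nth_power_0 numeral_2_eq_2)
qed

section \<open>Power series modulo 11 and extraction of the class 6\<close>

text \<open>Coefficients lie in the numeral type \<open>11\<close>, the integers modulo 11, so that
  congruences become equations in characteristic 11.\<close>

definition mod11 :: "int fps \<Rightarrow> 11 fps" where
  "mod11 f = Abs_fps (\<lambda>n. of_int (fps_nth f n))"

lemma mod11_add [simp]: "mod11 (f + g) = mod11 f + mod11 g"
  and mod11_diff [simp]: "mod11 (f - g) = mod11 f - mod11 g"
  and mod11_uminus [simp]: "mod11 (- f) = - mod11 f"
  and mod11_mult [simp]: "mod11 (f * g) = mod11 f * mod11 g"
  and mod11_0 [simp]: "mod11 0 = 0"
  and mod11_1 [simp]: "mod11 1 = 1"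
  and mod11_X [simp]: "mod11 fps_X = fps_X"
  and mod11_qderiv: "mod11 (qderiv f) = qderiv (mod11 f)"
  by (rule fps_ext; simp add: mod11_def fps_mult_nth fps_X_def)+

lemma mod11_power [simp]: "mod11 (f ^ n) = mod11 f ^ n"
  by (induction n) simp_all

lemma mod11_numeral [simp]: "mod11 (numeral w) = numeral w"
  by (rule fps_ext) (simp add: mod11_def numeral_fps_const)

lemma mod11_eq_iff: "mod11 f = mod11 g \<longleftrightarrow> (\<forall>n. [fps_nth f n = fps_nth g n] (mod 11))"
proof -
  have "(of_int a = (of_int b :: 11)) \<longleftrightarrow> [a = b] (mod 11)" for a b
    using of_int_eq_0_iff_char_dvd[of "a - b", where 'a = 11] by (simp add: cong_iff_dvd_diff)
  then show ?thesis
    by (simp add: mod11_def fps_eq_iff)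
qed

lemma fps_cong_11_iff: "fps_cong 11 f g \<longleftrightarrow> mod11 f = mod11 g"
  by (simp add: fps_cong_def mod11_eq_iff)

lemma eleven_eq_0: "(11 :: 11 fps) = 0"
  by (rule fps_ext) (simp add: numeral_fps_const)

lemma frobenius_11: "(f + g :: 11 fps) ^ 11 = f ^ 11 + g ^ 11"
  by (rule freshmans_dream) simp_all

lemma power_11_type: "c ^ 11 = c" for c :: 11
proof -
  have "c = 0 \<or> c = 1 \<or> c = 2 \<or> c = 3 \<or> c = 4 \<or> c = 5 \<or> c = 6 \<or> c = 7 \<or> c = 8 \<or> c = 9 \<or> c = 10"
  proof (cases c)
    case (of_int z)
    then have "0 \<le> z" "z < 11"
      by simp_all
    then have "z = 0 \<or> z = 1 \<or> z = 2 \<or> z = 3 \<or> z = 4 \<or> z = 5 \<or> z = 6 \<or> z = 7 \<or> z = 8 \<or> z = 9 \<or> z = 10"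
      by presburger
    then show ?thesis unfolding of_int by (elim disjE) simp_all
  qed
  then show ?thesis by (elim disjE) (simp_all add: eval_nat_numeral)
qed

lemma power_11_cong: "[x ^ 11 = x] (mod 11)" for x :: int
proof -
  have "(of_int (x ^ 11) :: 11) = of_int x"
    by (simp add: power_11_type)
  then show ?thesis
    using of_int_eq_0_iff_char_dvd[of "x ^ 11 - x", where 'a = 11] by (simp add: cong_iff_dvd_diff)
qed

text \<open>Frobenius: f(q)^11 = f(q^11), as c^11 = c for constants. The power is computed on a
  polynomial truncation; the remainder starts beyond index n.\<close>

lemma power_11_nth: "fps_nth ((f :: 11 fps) ^ 11) n = (if 11 dvd n then fps_nth f (n div 11) else 0)"
proof -
  define g where "g = (\<Sum>i\<le>n. fps_const (fps_nth f i) * fps_X ^ i)"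
  have g: "fps_nth g i = (if i \<le> n then fps_nth f i else 0)" for i
    by (simp add: g_def fps_sum_nth if_distrib cong: if_cong)
  define h where "h = fps_shift (Suc n) (f - g)"
  have fg: "f = g + fps_X ^ Suc n * h"
    by (rule fps_ext) (auto simp: h_def g fps_X_power_mult_nth not_less_eq_eq simp del: power_Suc)
  have "g ^ 11 = (\<Sum>i\<le>n. (fps_const (fps_nth f i) * fps_X ^ i) ^ 11)"
    unfolding g_def by (rule freshmans_dream_sum) simp_all
  also have "\<dots> = (\<Sum>i\<le>n. fps_const (fps_nth f i) * fps_X ^ (11 * i))"
    by (simp add: power_mult_distrib fps_const_power power_11_type mult.commute flip: power_mult)
  finally have "fps_nth (g ^ 11) n = (\<Sum>i\<le>n. if n = 11 * i then fps_nth f i else 0)"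
    by (simp add: fps_sum_nth if_distrib cong: if_cong)
  also have "\<dots> = (if 11 dvd n then fps_nth f (n div 11) else 0)"
    by (auto elim!: dvdE intro!: sum.neutral)
  finally have gn: "fps_nth (g ^ 11) n = (if 11 dvd n then fps_nth f (n div 11) else 0)" .
  have "f ^ 11 = g ^ 11 + fps_X ^ Suc n * (fps_X ^ (10 * Suc n) * h ^ 11)"
  proof -
    have "(fps_X ^ Suc n * h) ^ 11 = fps_X ^ (Suc n * 11) * h ^ 11"
      by (simp only: power_mult_distrib power_mult)
    also have "Suc n * 11 = Suc n + 10 * Suc n" by simp
    also have "fps_X ^ \<dots> * h ^ 11 = fps_X ^ Suc n * (fps_X ^ (10 * Suc n) * h ^ 11)"
      by (simp only: power_add mult.assoc)
    finally show ?thesis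
      by (subst fg) (simp only: frobenius_11)
  qed
  then have "fps_nth (f ^ 11) n = fps_nth (g ^ 11) n"
    by (simp only: fps_add_nth fps_X_power_mult_nth) simp
  then show ?thesis by (simp only: gn)
qed

definition class6 :: "11 fps \<Rightarrow> 11 fps" where
  "class6 f = Abs_fps (\<lambda>n. fps_nth f (11 * n + 6))"

lemma class6_nth [simp]: "fps_nth (class6 f) n = fps_nth f (11 * n + 6)"
  by (simp add: class6_def)

lemma class6_linear [simp]:
  "class6 (f + g) = class6 f + class6 g" "class6 (f - g) = class6 f - class6 g" "class6 (- f) = - class6 f"
  "class6 (numeral w * f) = numeral w * class6 f"
  by (rule fps_ext; simp add: numeral_fps_const)+

text \<open>An 11th power is a series in q^11, so it does not mix classes and comes out as
  g(q).\<close>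

lemma class6_mult_power_11: "class6 (f * g ^ 11) = class6 f * g"
proof (rule fps_ext)
  fix n
  have "fps_nth (f * g ^ 11) (11 * n + 6) = (\<Sum>i=0..11 * n + 6. fps_nth (g ^ 11) i * fps_nth f (11 * n + 6 - i))"
    by (subst mult.commute) (rule fps_mult_nth)
  also have "\<dots> = (\<Sum>i\<in>(\<lambda>j. 11 * j) ` {0..n}. fps_nth (g ^ 11) i * fps_nth f (11 * n + 6 - i))"
  proof (rule sum.mono_neutral_right)
    show "\<forall>i\<in>{0..11 * n + 6} - (\<lambda>j. 11 * j) ` {0..n}. fps_nth (g ^ 11) i * fps_nth f (11 * n + 6 - i) = 0"
      by (auto simp: power_11_nth elim!: dvdE)
  qed auto
  also have "\<dots> = (\<Sum>j=0..n. fps_nth g j * fps_nth f (11 * (n - j) + 6))"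
    by (subst sum.reindex) (auto simp: inj_on_def power_11_nth algebra_simps intro!: sum.cong)
  finally show "fps_nth (class6 (f * g ^ 11)) n = fps_nth (class6 f * g) n"
    by (subst (2) mult.commute) (simp add: fps_mult_nth)
qed

text \<open>Compare coefficients at 11 n + 11, where D H contributes nothing because the index is 0
  modulo 11.\<close>

lemma class6_eqI:
  assumes "fps_X ^ 5 * f = (fps_X * h) ^ 11 + qderiv H"
  shows "class6 f = h"
proof (rule fps_ext)
  fix n
  have q: "(of_nat (11 * n + 11) :: 11) = 0"
    by (simp add: of_nat_eq_0_iff_char_dvd del: of_nat_add of_nat_mult)
  have "fps_nth (fps_X ^ 5 * f) (11 * n + 11) = fps_nth ((fps_X * h) ^ 11 + qderiv H) (11 * n + 11)"
    by (simp only: assms)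
  then show "fps_nth (class6 f) n = fps_nth h n"
    by (simp only: fps_add_nth qderiv_nth q power_11_nth fps_X_power_mult_nth) (simp add: algebra_simps)
qed

text \<open>Indices prime to 11 are invertible, so f is a series in q^11 and therefore an 11th
  power.\<close>

lemma qderiv_eq_0_imp_power_11:
  assumes "qderiv (f :: 11 fps) = 0"
  shows "\<exists>g. f = g ^ 11"
proof
  show "f = Abs_fps (\<lambda>n. fps_nth f (11 * n)) ^ 11"
  proof (rule fps_ext)
    fix n
    have n0: "(of_nat n :: 11) * fps_nth f n = 0"
      using arg_cong[OF assms, of "\<lambda>f. fps_nth f n"] by simp
    have inv: "\<exists>d. d * (of_nat n :: 11) = 1" if "\<not> 11 dvd n"
    proof -
      have "coprime n 11"
        using that prime_imp_coprime[of 11 n] by (simp add: coprime_commute)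
      then obtain m where "[n * m = 1] (mod 11)"
        using cong_solve_coprime_nat[of n 11] by auto
      then have "(of_nat (n * m) :: 11) = of_nat 1"
        by (subst of_nat_eq_iff_cong_CHAR) simp
      then show ?thesis by (auto simp: mult.commute)
    qed
    have "fps_nth f n = 0" if n: "\<not> 11 dvd n"
    proof -
      obtain d where "d * (of_nat n :: 11) = 1"
        using inv[OF n] by blast
      then have "fps_nth f n = d * (of_nat n * fps_nth f n)"
        by (simp only: mult.assoc[symmetric] mult_1_left)
      then show ?thesis
        by (simp only: n0 mult_zero_right)
    qed
    then show "fps_nth f n = fps_nth (Abs_fps (\<lambda>n. fps_nth f (11 * n)) ^ 11) n"
      by (auto simp: power_11_nth)
  qed
qed

section \<open>Eisenstein series modulo 11\<close>

text \<open>Modulo 11, E4 is inverse to y = E6. The forms used below become powers of y times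
  polynomials in u = E4^5, and u^k may be absorbed into y^(5k).\<close>

definition eis_u :: "11 fps" where
  "eis_u = mod11 eisenstein_E4 ^ 5"

abbreviation "eis_y \<equiv> mod11 eisenstein_E6"

lemma eleven_mult_eq_0: "11 * f = (0 :: 11 fps)"
  by (simp add: eleven_eq_0)

text \<open>The product E4 E6 is the series of weight 10, and its coefficient 264 is 11 times
  24.\<close>

lemma E4_E6_mod11: "mod11 eisenstein_E4 * eis_y = 1"
proof -
  have "mod11 eisenstein_E4 * eis_y = 1 - 11 * (24 * mod11 (sigma_series 9))"
    using arg_cong[OF eisenstein_E4_E6, of mod11] by simp
  then show ?thesis by (simp only: eleven_mult_eq_0 diff_zero)
qed

lemma eis_y_u: "eis_y ^ (5 * k + m) * eis_u ^ k = eis_y ^ m"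
proof -
  have "eis_y ^ 5 * eis_u = (mod11 eisenstein_E4 * eis_y) ^ 5"
    by (simp add: eis_u_def power_mult_distrib mult.commute)
  then have "(eis_y ^ 5 * eis_u) ^ k = 1"
    by (simp add: E4_E6_mod11)
  moreover have "eis_y ^ (5 * k + m) * eis_u ^ k = (eis_y ^ 5 * eis_u) ^ k * eis_y ^ m"
    by (simp only: power_add power_mult power_mult_distrib) (simp only: mult_ac)
  ultimately show ?thesis by simp
qed

lemma eis_u_y: "eis_u * eis_y ^ k = mod11 eisenstein_E4 ^ (5 - k)" if "k \<le> 5"
proof -
  obtain j where j: "5 = k + j" using \<open>k \<le> 5\<close> le_Suc_ex by blast
  have "eis_u * eis_y ^ k = (mod11 eisenstein_E4 * eis_y) ^ k * mod11 eisenstein_E4 ^ j"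
    unfolding eis_u_def j by (simp add: power_add power_mult_distrib mult_ac)
  then show ?thesis by (simp add: E4_E6_mod11 j)
qed

lemma eis_E4_powers:
  "mod11 eisenstein_E4 = eis_u * eis_y ^ 4" "mod11 eisenstein_E4 ^ 2 = eis_u * eis_y ^ 3"
  "mod11 eisenstein_E4 ^ 3 = eis_u * eis_y ^ 2" "mod11 eisenstein_E4 ^ 4 = eis_u * eis_y"
  using eis_u_y[of 4] eis_u_y[of 3] eis_u_y[of 2] eis_u_y[of 1] by simp_all

lemma numeral_mod11_eq_0:
  "(11 :: 11 fps) = 0" "(22 :: 11 fps) = 0" "(33 :: 11 fps) = 0" "(44 :: 11 fps) = 0" "(55 :: 11 fps) = 0"
  by (rule fps_ext; simp add: numeral_fps_const)+

lemma numeral_mod11: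
  "(12 :: 11 fps) = 1" "(18 :: 11 fps) = 7" "(24 :: 11 fps) = 2" "(27 :: 11 fps) = 5" "(45 :: 11 fps) = 1"
  "(30 :: 11 fps) = 8" "(25 :: 11 fps) = 3" "(20 :: 11 fps) = 9" "(1728 :: 11 fps) = 1"
  by (rule fps_ext; simp add: numeral_fps_const)+

lemma eis_y_u6: "eis_u * eis_y ^ 6 = eis_y"
  using eis_y_u[of 1 1] by (simp add: mult.commute)

lemma ramanujan_mod11:
  "3 * qderiv (mod11 eisenstein_E4) = mod11 eisenstein_E2 * mod11 eisenstein_E4 - eis_y"
  "2 * qderiv eis_y = mod11 eisenstein_E2 * eis_y - mod11 eisenstein_E4 ^ 2"
  using arg_cong[OF ramanujan_E4, of mod11] arg_cong[OF ramanujan_E6, of mod11]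
  by (simp_all add: mod11_qderiv)

text \<open>Differentiating E4 E6 = 1 and inserting Ramanujan's equations leaves 5 E2 = 2 y^2 + 3 u
  y^2; multiplying by 9 inverts the 5.\<close>

lemma eis_E2_u: "mod11 eisenstein_E2 = eis_y ^ 2 * (7 + 5 * eis_u)"
proof -
  let ?x = "mod11 eisenstein_E4" and ?e = "mod11 eisenstein_E2"
  have "2 * eis_y * (3 * qderiv ?x) + 3 * ?x * (2 * qderiv eis_y) = 6 * qderiv (?x * eis_y)"
    by (simp add: qderiv_mult algebra_simps)
  also have "\<dots> = 0"
    by (simp add: E4_E6_mod11)
  finally have "2 * eis_y * (3 * qderiv ?x) + 3 * ?x * (2 * qderiv eis_y) = 0" .
  moreover have "2 * eis_y * (3 * qderiv ?x) + 3 * ?x * (2 * qderiv eis_y) = 5 * ?e * (?x * eis_y) - (2 * eis_y ^ 2 + 3 * ?x ^ 3)"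
    unfolding ramanujan_mod11 by (simp add: algebra_simps power2_eq_square power3_eq_cube)
  ultimately have e5: "5 * ?e = 2 * eis_y ^ 2 + 3 * (eis_u * eis_y ^ 2)"
    by (simp add: E4_E6_mod11 eis_E4_powers(3))
  have "?e = 45 * ?e"
    by (simp add: numeral_mod11)
  also have "\<dots> = 9 * (5 * ?e)"
    by simp
  also have "\<dots> = 18 * eis_y ^ 2 + 27 * (eis_u * eis_y ^ 2)"
    unfolding e5 by simp
  finally show ?thesis
    by (simp only: numeral_mod11) (simp add: algebra_simps)
qed

lemma qderiv_eis_y: "qderiv eis_y = 2 * eis_y ^ 3 * (eis_u - 1)"
proof -
  have "qderiv eis_y = 12 * qderiv eis_y"
    by (simp add: numeral_mod11)
  also have "\<dots> = 6 * (2 * qderiv eis_y)"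
    by simp
  also have "\<dots> = 42 * eis_y ^ 3 + 24 * (eis_u * eis_y ^ 3)"
    unfolding ramanujan_mod11 eis_E2_u eis_E4_powers(2) by (simp add: algebra_simps power2_eq_square power3_eq_cube)
  also have "(42 :: 11 fps) = - 2"
    by (rule fps_ext) (simp add: numeral_fps_const)
  finally show ?thesis
    by (simp only: numeral_mod11) (simp add: algebra_simps)
qed

lemma qderiv_eis_u: "qderiv eis_u = eis_y ^ 2 * eis_u * (eis_u - 1)"
proof -
  let ?x = "mod11 eisenstein_E4"
  have "mod11 eisenstein_E2 * ?x = 7 * eis_y ^ 2 * ?x + 5 * eis_u * eis_y ^ 2 * ?x"
    unfolding eis_E2_u by (simp add: algebra_simps)
  also have "7 * eis_y ^ 2 * ?x = 7 * eis_y * (?x * eis_y)"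
    by (simp add: power2_eq_square mult_ac)
  also have "5 * eis_u * eis_y ^ 2 * ?x = 5 * (eis_u * eis_y * (?x * eis_y))"
    by (simp add: power2_eq_square mult_ac)
  finally have dx: "3 * qderiv ?x = 6 * eis_y + 5 * (eis_u * eis_y)"
    unfolding ramanujan_mod11 E4_E6_mod11 by simp
  have du: "qderiv eis_u = 5 * (eis_u * eis_y) * qderiv ?x"
    by (simp add: eis_u_def qderiv_power) (simp add: eis_E4_powers(4) eis_u_def)
  have "qderiv eis_u = 12 * qderiv eis_u"
    by (simp add: numeral_mod11)
  also have "\<dots> = 20 * (eis_u * eis_y) * (3 * qderiv ?x)"
    unfolding du by (simp add: mult_ac)
  also have "\<dots> = 20 * (eis_u * eis_y) * (6 * eis_y + 5 * (eis_u * eis_y))"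
    by (simp only: dx)
  also have "\<dots> = 120 * (eis_u * eis_y ^ 2) + 100 * (eis_u * (eis_u * eis_y ^ 2))"
    by (simp add: algebra_simps power2_eq_square)
  finally have "qderiv eis_u = 120 * (eis_u * eis_y ^ 2) + 100 * (eis_u * (eis_u * eis_y ^ 2))" .
  moreover have "(120 :: 11 fps) = - 1" "(100 :: 11 fps) = 1"
    by (rule fps_ext; simp add: numeral_fps_const)+
  ultimately show ?thesis
    by (simp only:) (simp add: algebra_simps)
qed

lemma discriminant_mod11: "fps_X * mod11 euler_E ^ 24 = eis_y ^ 2 * (eis_u - 1)"
proof -
  have "fps_X * mod11 euler_E ^ 24 = 1728 * (fps_X * mod11 euler_E ^ 24)"
    by (simp add: numeral_mod11)
  also have "\<dots> = mod11 eisenstein_E4 ^ 3 - eis_y ^ 2"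
    using arg_cong[OF eisenstein_discriminant, of mod11] by simp
  finally show ?thesis
    unfolding eis_E4_powers(3) by (simp add: algebra_simps)
qed

text \<open>Since D y = 2 y^3 (u - 1) and D u = y^2 u (u - 1), D maps y^m times polynomials in u to
  y^(m+2) times such polynomials. The search for antiderivatives thus becomes polynomial algebra in
  u.\<close>

lemma qderiv_eis_form:
  assumes "qderiv h = h' * qderiv eis_u"
  shows "qderiv (eis_y ^ m * h) = eis_y ^ (m + 2) * ((eis_u - 1) * (2 * of_nat m * h + eis_u * h'))"
proof (cases m)
  case 0
  then show ?thesis
    using assms by (simp add: qderiv_eis_u power2_eq_square algebra_simps)
next
  case (Suc k)
  have "qderiv (eis_y ^ m * h) = of_nat m * eis_y ^ k * qderiv eis_y * h + eis_y ^ m * qderiv h"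
    unfolding qderiv_mult qderiv_power by (simp add: Suc)
  also have "\<dots> = of_nat m * eis_y ^ (k + 3) * 2 * (eis_u - 1) * h + eis_y ^ (k + 3) * h' * eis_u * (eis_u - 1)"
    unfolding assms qderiv_eis_y qderiv_eis_u Suc
    by (simp only: power_add power_Suc power2_eq_square power3_eq_cube mult_ac)
  also have "\<dots> = eis_y ^ (k + 3) * ((eis_u - 1) * (2 * of_nat m * h + eis_u * h'))"
    by (simp only: distrib_left mult_ac)
  also have "k + 3 = m + 2" using Suc by simp
  finally show ?thesis .
qed

text \<open>Multiplying by (E^8)^11 raises E^32 to E^120 = (E^24)^5, and q E^24 is y^2 (u - 1) by
  \<open>discriminant_mod11\<close>. This puts the claim into the form of \<open>class6_eqI\<close>;
  the extra E^8 is cancelled with \<open>partition_series\<close>.\<close>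

lemma class6_euler_32:
  assumes "eis_y ^ 10 * (eis_u - 1) ^ 5 * f = (eis_y ^ 2 * (eis_u - 1) * g) ^ 11 + qderiv H"
  shows "class6 (mod11 euler_E ^ 32 * f) = mod11 euler_E ^ 16 * g"
proof -
  let ?e = "mod11 euler_E" and ?p = "mod11 partition_series"
  have pe: "?p * ?e = 1"
    using arg_cong[OF partition_series_euler_E, of mod11] by simp
  have "class6 (?e ^ 32 * f) * ?e ^ 8 = class6 (?e ^ 32 * f * (?e ^ 8) ^ 11)"
    by (simp only: class6_mult_power_11)
  also have "?e ^ 32 * f * (?e ^ 8) ^ 11 = ?e ^ 120 * f"
    by (simp add: mult_ac flip: power_mult power_add)
  also have "class6 (?e ^ 120 * f) = ?e ^ 24 * g"
  proof (rule class6_eqI)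
    have "fps_X ^ 5 * (?e ^ 120 * f) = (fps_X * ?e ^ 24) ^ 5 * f"
      by (simp add: power_mult_distrib flip: power_mult)
    also have "\<dots> = eis_y ^ 10 * (eis_u - 1) ^ 5 * f"
      unfolding discriminant_mod11 by (simp add: power_mult_distrib flip: power_mult)
    also have "\<dots> = (fps_X * (?e ^ 24 * g)) ^ 11 + qderiv H"
      unfolding assms discriminant_mod11[symmetric] by (simp only: mult.assoc)
    finally show "fps_X ^ 5 * (?e ^ 120 * f) = (fps_X * (?e ^ 24 * g)) ^ 11 + qderiv H" .
  qed
  finally have "class6 (?e ^ 32 * f) * ?e ^ 8 = ?e ^ 24 * g" .
  then have "class6 (?e ^ 32 * f) * ?e ^ 8 * ?p ^ 8 = ?e ^ (16 + 8) * g * ?p ^ 8"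
    by simp
  then have "class6 (?e ^ 32 * f) * (?p * ?e) ^ 8 = ?e ^ 16 * (?p * ?e) ^ 8 * g"
    by (simp only: power_mult_distrib power_add mult_ac)
  then show ?thesis by (simp add: pe)
qed

lemma eis_u_minus_1_power_11: "(eis_u - 1) ^ 11 = eis_u ^ 11 - 1"
  using frobenius_11[of eis_u "-1"] by simp

section \<open>Explicit antiderivatives for each weight\<close>

text \<open>Modulo 11, q^5 E^120 lies in the image of D. This yields the divisibility assumed in
  \<open>weighted_appell_cong\<close>.\<close>

lemma class6_euler_32_eq_0: "class6 (mod11 euler_E ^ 32) = 0"
proof -
  \<comment> \<open>The coefficients of \<open>h\<close> solve the linear congruences expressing
    that D (y^8 h(u)) is the required series; \<open>h'\<close> is the derivative of
    \<open>h\<close> in u. The following lemmas use the same scheme, dropping from \<open>h'\<close>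
    the terms divisible by 11.\<close>
  define h where "h = - 2 + 3 * eis_u + 4 * eis_u ^ 2 + 5 * eis_u ^ 3 + 5 * eis_u ^ 4 - 4 * eis_u ^ 6"
  define h' where "h' = 3 + 8 * eis_u + 15 * eis_u ^ 2 + 20 * eis_u ^ 3 - 24 * eis_u ^ 5"
  have "qderiv h = h' * qderiv eis_u"
    unfolding h_def h'_def by (simp add: qderiv_mult qderiv_power numeral_mod11_eq_0 algebra_simps)
  then have H: "qderiv (eis_y ^ 8 * h) = eis_y ^ 10 * ((eis_u - 1) * (16 * h + eis_u * h'))"
    using qderiv_eis_form[of h h' 8] by simp
  define v where "v = eisenstein_E4 ^ 5"
  have v: "mod11 v = eis_u"
    by (simp add: v_def eis_u_def)
  \<comment> \<open>The congruence is certified as an identity over the integers with an explicit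
    multiple of 11, which \<open>mod11\<close> then removes.\<close>
  have "1 * ((v - 1) ^ 5 * (1)) =
      (0) * (v ^ 11 - 1) + (v - 1) * (16 * (- 2 + 3 * v + 4 * v ^ 2 + 5 * v ^ 3 + 5 * v ^ 4 - 4 * v ^ 6) + v * (3 + 8 * v + 15 * v ^ 2 + 20 * v ^ 3 - 24 * v ^ 5)) + 11 * (- 3 + 8 * v + v ^ 2 + 3 * v ^ 3 - 9 * v ^ 5 - 8 * v ^ 6 + 8 * v ^ 7)"
    by algebra
  from arg_cong[OF this, of mod11] have core: "1 * ((eis_u - 1) ^ 5 * (1)) =
      (0) * (eis_u ^ 11 - 1) + (eis_u - 1) * (16 * h + eis_u * h')"
    unfolding h_def h'_def
    by (simp only: mod11_add mod11_diff mod11_uminus mod11_mult mod11_power mod11_numeral mod11_1 mod11_0 v eleven_mult_eq_0 add_0_right)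
  have g: "(eis_y ^ 2 * (eis_u - 1) * 0) ^ 11 = eis_y ^ 10 * ((0) * (eis_u ^ 11 - 1))"
    by simp
  have "eis_y ^ 10 * (eis_u - 1) ^ 5 * 1 = eis_y ^ 10 * ((eis_u - 1) ^ 5 * (1))"
    by simp
  also have "\<dots> = eis_y ^ 10 * (1 * ((eis_u - 1) ^ 5 * (1)))"
    by simp
  also have "\<dots> = (eis_y ^ 2 * (eis_u - 1) * 0) ^ 11 + qderiv (eis_y ^ 8 * h)"
    unfolding core g H by (simp only: distrib_left)
  finally show ?thesis
    using class6_euler_32 by fastforce
qed

text \<open>The certificate is again a pure derivative, so weight 4 contributes nothing. The power
  y^14 is rewritten as y^24 u^2 to match D (y^22 h).\<close>

lemma class6_weight_4: "class6 (mod11 euler_E ^ 32 * (eis_y ^ 4 * (- 4 + 3 * eis_u + 2 * eis_u ^ 2))) = mod11 euler_E ^ 16 * 0"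
proof -
  define h where "h = - 5 - 2 * eis_u ^ 2 - eis_u ^ 3 - 3 * eis_u ^ 4 + 3 * eis_u ^ 5 + 3 * eis_u ^ 6 + 4 * eis_u ^ 7 + 3 * eis_u ^ 8 - 2 * eis_u ^ 11"
  define h' where "h' = - 4 * eis_u - 3 * eis_u ^ 2 - 12 * eis_u ^ 3 + 15 * eis_u ^ 4 + 18 * eis_u ^ 5 + 28 * eis_u ^ 6 + 24 * eis_u ^ 7"
  have "qderiv h = h' * qderiv eis_u"
    unfolding h_def h'_def by (simp add: qderiv_mult qderiv_power numeral_mod11_eq_0 algebra_simps)
  then have H: "qderiv (eis_y ^ 22 * h) = eis_y ^ 24 * ((eis_u - 1) * (44 * h + eis_u * h'))"
    using qderiv_eis_form[of h h' 22] by simp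
  define v where "v = eisenstein_E4 ^ 5"
  have v: "mod11 v = eis_u"
    by (simp add: v_def eis_u_def)
  have "v ^ 2 * ((v - 1) ^ 5 * (- 4 + 3 * v + 2 * v ^ 2)) =
      (0) * (v ^ 11 - 1) + (v - 1) * (44 * (- 5 - 2 * v ^ 2 - v ^ 3 - 3 * v ^ 4 + 3 * v ^ 5 + 3 * v ^ 6 + 4 * v ^ 7 + 3 * v ^ 8 - 2 * v ^ 11) + v * (- 4 * v - 3 * v ^ 2 - 12 * v ^ 3 + 15 * v ^ 4 + 18 * v ^ 5 + 28 * v ^ 6 + 24 * v ^ 7)) + 11 * (- 20 + 20 * v - 8 * v ^ 2 + 2 * v ^ 3 - 4 * v ^ 4 + 21 * v ^ 5 + 3 * v ^ 6 + 5 * v ^ 7 - 5 * v ^ 8 - 14 * v ^ 9 - 8 * v ^ 11 + 8 * v ^ 12)"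
    by algebra
  from arg_cong[OF this, of mod11] have core: "eis_u ^ 2 * ((eis_u - 1) ^ 5 * (- 4 + 3 * eis_u + 2 * eis_u ^ 2)) =
      (0) * (eis_u ^ 11 - 1) + (eis_u - 1) * (44 * h + eis_u * h')"
    unfolding h_def h'_def
    by (simp only: mod11_add mod11_diff mod11_uminus mod11_mult mod11_power mod11_numeral mod11_1 mod11_0 v eleven_mult_eq_0 add_0_right)
  have y: "eis_y ^ 14 = eis_y ^ 24 * eis_u ^ 2"
    using eis_y_u[of 2 14] by simp
  have g: "(eis_y ^ 2 * (eis_u - 1) * 0) ^ 11 = eis_y ^ 24 * ((0) * (eis_u ^ 11 - 1))"
    by simp
  have yw: "eis_y ^ 10 * eis_y ^ 4 = eis_y ^ 14"
    by (simp flip: power_add)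
  have "eis_y ^ 10 * (eis_u - 1) ^ 5 * (eis_y ^ 4 * (- 4 + 3 * eis_u + 2 * eis_u ^ 2)) = eis_y ^ 14 * ((eis_u - 1) ^ 5 * (- 4 + 3 * eis_u + 2 * eis_u ^ 2))"
    by (simp only: yw[symmetric] mult_ac)
  also have "\<dots> = eis_y ^ 24 * (eis_u ^ 2 * ((eis_u - 1) ^ 5 * (- 4 + 3 * eis_u + 2 * eis_u ^ 2)))"
    unfolding y by (simp only: mult.assoc)
  also have "\<dots> = (eis_y ^ 2 * (eis_u - 1) * 0) ^ 11 + qderiv (eis_y ^ 22 * h)"
    unfolding core g H by (simp only: distrib_left)
  finally show ?thesis
    using class6_euler_32 by blast
qed

text \<open>Here the 11th power is not zero: modulo derivatives the form is (y^2 (u - 1) E4)^11, and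
  y^66 u^11 reduces to y^16 u.\<close>

lemma class6_weight_6: "class6 (mod11 euler_E ^ 32 * (eis_y ^ 6 * (- 4 + 2 * eis_u + 2 * eis_u ^ 2 + 3 * eis_u ^ 3))) = mod11 euler_E ^ 16 * mod11 eisenstein_E4"
proof -
  define h where "h = 3 + 4 * eis_u + 3 * eis_u ^ 2 + 2 * eis_u ^ 4 + 5 * eis_u ^ 5 + eis_u ^ 7 - 4 * eis_u ^ 8 - 3 * eis_u ^ 9 + 2 * eis_u ^ 10 - 2 * eis_u ^ 11"
  define h' where "h' = 4 + 6 * eis_u + 8 * eis_u ^ 3 + 25 * eis_u ^ 4 + 7 * eis_u ^ 6 - 32 * eis_u ^ 7 - 27 * eis_u ^ 8 + 20 * eis_u ^ 9"
  have "qderiv h = h' * qderiv eis_u"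
    unfolding h_def h'_def by (simp add: qderiv_mult qderiv_power numeral_mod11_eq_0 algebra_simps)
  then have H: "qderiv (eis_y ^ 14 * h) = eis_y ^ 16 * ((eis_u - 1) * (28 * h + eis_u * h'))"
    using qderiv_eis_form[of h h' 14] by simp
  define v where "v = eisenstein_E4 ^ 5"
  have v: "mod11 v = eis_u"
    by (simp add: v_def eis_u_def)
  have "1 * ((v - 1) ^ 5 * (- 4 + 2 * v + 2 * v ^ 2 + 3 * v ^ 3)) =
      (v) * (v ^ 11 - 1) + (v - 1) * (28 * (3 + 4 * v + 3 * v ^ 2 + 2 * v ^ 4 + 5 * v ^ 5 + v ^ 7 - 4 * v ^ 8 - 3 * v ^ 9 + 2 * v ^ 10 - 2 * v ^ 11) + v * (4 + 6 * v + 8 * v ^ 3 + 25 * v ^ 4 + 7 * v ^ 6 - 32 * v ^ 7 - 27 * v ^ 8 + 20 * v ^ 9)) + 11 * (8 + v + 2 * v ^ 2 - 13 * v ^ 3 + 9 * v ^ 4 + 7 * v ^ 5 - 13 * v ^ 6 + 2 * v ^ 7 - 16 * v ^ 8 + 3 * v ^ 9 + 17 * v ^ 10 - 12 * v ^ 11 + 5 * v ^ 12)"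
    by algebra
  from arg_cong[OF this, of mod11] have core: "1 * ((eis_u - 1) ^ 5 * (- 4 + 2 * eis_u + 2 * eis_u ^ 2 + 3 * eis_u ^ 3)) =
      (eis_u) * (eis_u ^ 11 - 1) + (eis_u - 1) * (28 * h + eis_u * h')"
    unfolding h_def h'_def
    by (simp only: mod11_add mod11_diff mod11_uminus mod11_mult mod11_power mod11_numeral mod11_1 mod11_0 v eleven_mult_eq_0 add_0_right)
  have "(eis_y ^ 2 * (eis_u - 1) * mod11 eisenstein_E4) ^ 11 = eis_y ^ 66 * eis_u ^ 11 * (eis_u - 1) ^ 11"
    unfolding eis_E4_powers(1) by (simp add: power_mult_distrib mult_ac flip: power_mult power_add)
  also have "eis_y ^ 66 * eis_u ^ 11 = eis_y ^ 16 * eis_u"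
    using eis_y_u[of 10 16] power_add[of eis_u 10 1] by (simp flip: mult.assoc)
  finally have g: "(eis_y ^ 2 * (eis_u - 1) * mod11 eisenstein_E4) ^ 11 = eis_y ^ 16 * ((eis_u) * (eis_u ^ 11 - 1))"
    unfolding eis_u_minus_1_power_11 by (simp only: mult.assoc)
  have yw: "eis_y ^ 10 * eis_y ^ 6 = eis_y ^ 16"
    by (simp flip: power_add)
  have "eis_y ^ 10 * (eis_u - 1) ^ 5 * (eis_y ^ 6 * (- 4 + 2 * eis_u + 2 * eis_u ^ 2 + 3 * eis_u ^ 3)) = eis_y ^ 16 * ((eis_u - 1) ^ 5 * (- 4 + 2 * eis_u + 2 * eis_u ^ 2 + 3 * eis_u ^ 3))"
    by (simp only: yw[symmetric] mult_ac)
  also have "\<dots> = eis_y ^ 16 * (1 * ((eis_u - 1) ^ 5 * (- 4 + 2 * eis_u + 2 * eis_u ^ 2 + 3 * eis_u ^ 3)))"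
    by simp
  also have "\<dots> = (eis_y ^ 2 * (eis_u - 1) * mod11 eisenstein_E4) ^ 11 + qderiv (eis_y ^ 14 * h)"
    unfolding core g H by (simp only: distrib_left)
  finally show ?thesis
    using class6_euler_32 by blast
qed

lemma class6_weight_8: "class6 (mod11 euler_E ^ 32 * (eis_y ^ 8 * (1 + 3 * eis_u + 3 * eis_u ^ 4))) = mod11 euler_E ^ 16 * (- mod11 eisenstein_E6)"
proof -
  define h where "h = - 3 - 4 * eis_u + 5 * eis_u ^ 2 - 2 * eis_u ^ 3 + 4 * eis_u ^ 4 - 5 * eis_u ^ 5 + 2 * eis_u ^ 6 + 5 * eis_u ^ 7 - 2 * eis_u ^ 8 - 5 * eis_u ^ 9 + 2 * eis_u ^ 11 + 3 * eis_u ^ 15"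
  define h' where "h' = - 4 + 10 * eis_u - 6 * eis_u ^ 2 + 16 * eis_u ^ 3 - 25 * eis_u ^ 4 + 12 * eis_u ^ 5 + 35 * eis_u ^ 6 - 16 * eis_u ^ 7 - 45 * eis_u ^ 8 + 45 * eis_u ^ 14"
  have "qderiv h = h' * qderiv eis_u"
    unfolding h_def h'_def by (simp add: qderiv_mult qderiv_power numeral_mod11_eq_0 algebra_simps)
  then have H: "qderiv (eis_y ^ 31 * h) = eis_y ^ 33 * ((eis_u - 1) * (62 * h + eis_u * h'))"
    using qderiv_eis_form[of h h' 31] by simp
  define v where "v = eisenstein_E4 ^ 5"
  have v: "mod11 v = eis_u"
    by (simp add: v_def eis_u_def)
  have "v ^ 3 * ((v - 1) ^ 5 * (1 + 3 * v + 3 * v ^ 4)) =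
      (- 1) * (v ^ 11 - 1) + (v - 1) * (62 * (- 3 - 4 * v + 5 * v ^ 2 - 2 * v ^ 3 + 4 * v ^ 4 - 5 * v ^ 5 + 2 * v ^ 6 + 5 * v ^ 7 - 2 * v ^ 8 - 5 * v ^ 9 + 2 * v ^ 11 + 3 * v ^ 15) + v * (- 4 + 10 * v - 6 * v ^ 2 + 16 * v ^ 3 - 25 * v ^ 4 + 12 * v ^ 5 + 35 * v ^ 6 - 16 * v ^ 7 - 45 * v ^ 8 + 45 * v ^ 14)) + 11 * (- 17 - 6 * v + 52 * v ^ 2 - 41 * v ^ 3 + 36 * v ^ 4 - 54 * v ^ 5 + 41 * v ^ 6 + 21 * v ^ 7 - 44 * v ^ 8 - 22 * v ^ 9 + 35 * v ^ 10 + 10 * v ^ 11 - 11 * v ^ 12 + 21 * v ^ 15 - 21 * v ^ 16)"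
    by algebra
  from arg_cong[OF this, of mod11] have core: "eis_u ^ 3 * ((eis_u - 1) ^ 5 * (1 + 3 * eis_u + 3 * eis_u ^ 4)) =
      (- 1) * (eis_u ^ 11 - 1) + (eis_u - 1) * (62 * h + eis_u * h')"
    unfolding h_def h'_def
    by (simp only: mod11_add mod11_diff mod11_uminus mod11_mult mod11_power mod11_numeral mod11_1 mod11_0 v eleven_mult_eq_0 add_0_right)
  have y: "eis_y ^ 18 = eis_y ^ 33 * eis_u ^ 3"
    using eis_y_u[of 3 18] by simp
  have "(eis_y ^ 2 * (eis_u - 1) * (- mod11 eisenstein_E6)) ^ 11 = - (eis_y ^ 33 * (eis_u - 1) ^ 11)"
    by (simp add: power_mult_distrib mult_ac flip: power_mult power_add)
  then have g: "(eis_y ^ 2 * (eis_u - 1) * (- mod11 eisenstein_E6)) ^ 11 = eis_y ^ 33 * ((- 1) * (eis_u ^ 11 - 1))"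
    unfolding eis_u_minus_1_power_11 by (simp add: algebra_simps)
  have yw: "eis_y ^ 10 * eis_y ^ 8 = eis_y ^ 18"
    by (simp flip: power_add)
  have "eis_y ^ 10 * (eis_u - 1) ^ 5 * (eis_y ^ 8 * (1 + 3 * eis_u + 3 * eis_u ^ 4)) = eis_y ^ 18 * ((eis_u - 1) ^ 5 * (1 + 3 * eis_u + 3 * eis_u ^ 4))"
    by (simp only: yw[symmetric] mult_ac)
  also have "\<dots> = eis_y ^ 33 * (eis_u ^ 3 * ((eis_u - 1) ^ 5 * (1 + 3 * eis_u + 3 * eis_u ^ 4)))"
    unfolding y by (simp only: mult.assoc)
  also have "\<dots> = (eis_y ^ 2 * (eis_u - 1) * (- mod11 eisenstein_E6)) ^ 11 + qderiv (eis_y ^ 31 * h)"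
    unfolding core g H by (simp only: distrib_left)
  finally show ?thesis
    using class6_euler_32 by blast
qed

lemma class6_weight_10: "class6 (mod11 euler_E ^ 32 * (eis_y ^ 20 * (- 5 - 3 * eis_u + 3 * eis_u ^ 2 + eis_u ^ 3 - 4 * eis_u ^ 4 + 5 * eis_u ^ 5 - 3 * eis_u ^ 6 - eis_u ^ 7 - 2 * eis_u ^ 8 + 5 * eis_u ^ 9 - 5 * eis_u ^ 10))) = mod11 euler_E ^ 16 * (- (3 * mod11 eisenstein_E4 ^ 2))"
proof -
  define h where "h = 1 - 5 * eis_u + 3 * eis_u ^ 2 - 5 * eis_u ^ 3 - 5 * eis_u ^ 4 - eis_u ^ 5 + 2 * eis_u ^ 6 + 3 * eis_u ^ 7 - 2 * eis_u ^ 8 + 2 * eis_u ^ 9 - 5 * eis_u ^ 10 - 3 * eis_u ^ 11 + 5 * eis_u ^ 12 + 3 * eis_u ^ 13 + 2 * eis_u ^ 14 + 5 * eis_u ^ 15 + 5 * eis_u ^ 16 - 5 * eis_u ^ 17"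
  define h' where "h' = - 5 + 6 * eis_u - 15 * eis_u ^ 2 - 20 * eis_u ^ 3 - 5 * eis_u ^ 4 + 12 * eis_u ^ 5 + 21 * eis_u ^ 6 - 16 * eis_u ^ 7 + 18 * eis_u ^ 8 - 50 * eis_u ^ 9 + 60 * eis_u ^ 11 + 39 * eis_u ^ 12 + 28 * eis_u ^ 13 + 75 * eis_u ^ 14 + 80 * eis_u ^ 15 - 85 * eis_u ^ 16"
  have "qderiv h = h' * qderiv eis_u"
    unfolding h_def h'_def by (simp add: qderiv_mult qderiv_power numeral_mod11_eq_0 algebra_simps)
  then have H: "qderiv (eis_y ^ 33 * h) = eis_y ^ 35 * ((eis_u - 1) * (66 * h + eis_u * h'))"
    using qderiv_eis_form[of h h' 33] by simp
  define v where "v = eisenstein_E4 ^ 5"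
  have v: "mod11 v = eis_u"
    by (simp add: v_def eis_u_def)
  have "v * ((v - 1) ^ 5 * (- 5 - 3 * v + 3 * v ^ 2 + v ^ 3 - 4 * v ^ 4 + 5 * v ^ 5 - 3 * v ^ 6 - v ^ 7 - 2 * v ^ 8 + 5 * v ^ 9 - 5 * v ^ 10)) =
      (- 3 * v ^ 7) * (v ^ 11 - 1) + (v - 1) * (66 * (1 - 5 * v + 3 * v ^ 2 - 5 * v ^ 3 - 5 * v ^ 4 - v ^ 5 + 2 * v ^ 6 + 3 * v ^ 7 - 2 * v ^ 8 + 2 * v ^ 9 - 5 * v ^ 10 - 3 * v ^ 11 + 5 * v ^ 12 + 3 * v ^ 13 + 2 * v ^ 14 + 5 * v ^ 15 + 5 * v ^ 16 - 5 * v ^ 17) + v * (- 5 + 6 * v - 15 * v ^ 2 - 20 * v ^ 3 - 5 * v ^ 4 + 12 * v ^ 5 + 21 * v ^ 6 - 16 * v ^ 7 + 18 * v ^ 8 - 50 * v ^ 9 + 60 * v ^ 11 + 39 * v ^ 12 + 28 * v ^ 13 + 75 * v ^ 14 + 80 * v ^ 15 - 85 * v ^ 16)) + 11 * (6 - 36 * v + 47 * v ^ 2 - 47 * v ^ 3 - v ^ 4 + 23 * v ^ 5 + 20 * v ^ 6 + 12 * v ^ 7 - 43 * v ^ 8 + 36 * v ^ 9 - 54 * v ^ 10 + 22 * v ^ 11 + 45 * v ^ 12 - 4 * v ^ 13 - 14 * v ^ 14 + 25 * v ^ 15 - 75 * v ^ 17 + 38 * v ^ 18)"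
    by algebra
  from arg_cong[OF this, of mod11] have core: "eis_u * ((eis_u - 1) ^ 5 * (- 5 - 3 * eis_u + 3 * eis_u ^ 2 + eis_u ^ 3 - 4 * eis_u ^ 4 + 5 * eis_u ^ 5 - 3 * eis_u ^ 6 - eis_u ^ 7 - 2 * eis_u ^ 8 + 5 * eis_u ^ 9 - 5 * eis_u ^ 10)) =
      (- 3 * eis_u ^ 7) * (eis_u ^ 11 - 1) + (eis_u - 1) * (66 * h + eis_u * h')"
    unfolding h_def h'_def
    by (simp only: mod11_add mod11_diff mod11_uminus mod11_mult mod11_power mod11_numeral mod11_1 mod11_0 v eleven_mult_eq_0 add_0_right)
  have y: "eis_y ^ 30 = eis_y ^ 35 * eis_u"
    using eis_y_u[of 1 30] by simp
  have "(3 :: 11 fps) ^ 11 = 3 + 11 * 16104"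
    by simp
  then have three: "(3 :: 11 fps) ^ 11 = 3"
    by (simp only: eleven_mult_eq_0 add_0_right)
  have "eis_y ^ 2 * (eis_u - 1) * (- (3 * mod11 eisenstein_E4 ^ 2)) = - (3 * ((mod11 eisenstein_E4 * eis_y) ^ 2 * (eis_u - 1)))"
    by (simp add: power_mult_distrib algebra_simps)
  then have "(eis_y ^ 2 * (eis_u - 1) * (- (3 * mod11 eisenstein_E4 ^ 2))) ^ 11 = - ((3 * (eis_u - 1)) ^ 11)"
    unfolding E4_E6_mod11 by (simp only: power_one mult_1_left) (rule power_minus_odd, simp)
  \<comment> \<open>The factor y^35 u^7 equals 1; inserting it brings the 11th power to the same
    power of y as the derivative.\<close>
  also have "(3 * (eis_u - 1)) ^ 11 = eis_y ^ 35 * eis_u ^ 7 * (3 * (eis_u ^ 11 - 1))"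
    using eis_y_u[of 7 0] by (simp only: power_mult_distrib eis_u_minus_1_power_11 three) simp
  finally have g: "(eis_y ^ 2 * (eis_u - 1) * (- (3 * mod11 eisenstein_E4 ^ 2))) ^ 11 = eis_y ^ 35 * ((- 3 * eis_u ^ 7) * (eis_u ^ 11 - 1))"
    by (simp add: algebra_simps)
  have yw: "eis_y ^ 10 * eis_y ^ 20 = eis_y ^ 30"
    by (simp flip: power_add)
  have "eis_y ^ 10 * (eis_u - 1) ^ 5 * (eis_y ^ 20 * (- 5 - 3 * eis_u + 3 * eis_u ^ 2 + eis_u ^ 3 - 4 * eis_u ^ 4 + 5 * eis_u ^ 5 - 3 * eis_u ^ 6 - eis_u ^ 7 - 2 * eis_u ^ 8 + 5 * eis_u ^ 9 - 5 * eis_u ^ 10)) = eis_y ^ 30 * ((eis_u - 1) ^ 5 * (- 5 - 3 * eis_u + 3 * eis_u ^ 2 + eis_u ^ 3 - 4 * eis_u ^ 4 + 5 * eis_u ^ 5 - 3 * eis_u ^ 6 - eis_u ^ 7 - 2 * eis_u ^ 8 + 5 * eis_u ^ 9 - 5 * eis_u ^ 10))"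
    by (simp only: yw[symmetric] mult_ac)
  also have "\<dots> = eis_y ^ 35 * (eis_u * ((eis_u - 1) ^ 5 * (- 5 - 3 * eis_u + 3 * eis_u ^ 2 + eis_u ^ 3 - 4 * eis_u ^ 4 + 5 * eis_u ^ 5 - 3 * eis_u ^ 6 - eis_u ^ 7 - 2 * eis_u ^ 8 + 5 * eis_u ^ 9 - 5 * eis_u ^ 10)))"
    unfolding y by (simp only: mult.assoc)
  also have "\<dots> = (eis_y ^ 2 * (eis_u - 1) * (- (3 * mod11 eisenstein_E4 ^ 2))) ^ 11 + qderiv (eis_y ^ 33 * h)"
    unfolding core g H by (simp only: distrib_left)
  finally show ?thesis
    using class6_euler_32 by blast
qed

lemma class6_weight_12: "class6 (mod11 euler_E ^ 32 * (eis_y ^ 12 * (1 - 2 * eis_u - eis_u ^ 2 + eis_u ^ 3 - eis_u ^ 4 + 4 * eis_u ^ 5 + 4 * eis_u ^ 6))) = mod11 euler_E ^ 16 * 9"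
proof -
  define h where "h = 2 + 5 * eis_u - 2 * eis_u ^ 2 - 2 * eis_u ^ 3 - 4 * eis_u ^ 4 - 4 * eis_u ^ 5 - 5 * eis_u ^ 6 + 5 * eis_u ^ 7 + 5 * eis_u ^ 8 - 2 * eis_u ^ 9 + eis_u ^ 10 + eis_u ^ 15"
  define h' where "h' = 5 - 4 * eis_u - 6 * eis_u ^ 2 - 16 * eis_u ^ 3 - 20 * eis_u ^ 4 - 30 * eis_u ^ 5 + 35 * eis_u ^ 6 + 40 * eis_u ^ 7 - 18 * eis_u ^ 8 + 10 * eis_u ^ 9 + 15 * eis_u ^ 14"
  have "qderiv h = h' * qderiv eis_u"
    unfolding h_def h'_def by (simp add: qderiv_mult qderiv_power numeral_mod11_eq_0 algebra_simps)
  then have H: "qderiv (eis_y ^ 20 * h) = eis_y ^ 22 * ((eis_u - 1) * (40 * h + eis_u * h'))"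
    using qderiv_eis_form[of h h' 20] by simp
  define v where "v = eisenstein_E4 ^ 5"
  have v: "mod11 v = eis_u"
    by (simp add: v_def eis_u_def)
  have "1 * ((v - 1) ^ 5 * (1 - 2 * v - v ^ 2 + v ^ 3 - v ^ 4 + 4 * v ^ 5 + 4 * v ^ 6)) =
      (9) * (v ^ 11 - 1) + (v - 1) * (40 * (2 + 5 * v - 2 * v ^ 2 - 2 * v ^ 3 - 4 * v ^ 4 - 4 * v ^ 5 - 5 * v ^ 6 + 5 * v ^ 7 + 5 * v ^ 8 - 2 * v ^ 9 + v ^ 10 + v ^ 15) + v * (5 - 4 * v - 6 * v ^ 2 - 16 * v ^ 3 - 20 * v ^ 4 - 30 * v ^ 5 + 35 * v ^ 6 + 40 * v ^ 7 - 18 * v ^ 8 + 10 * v ^ 9 + 15 * v ^ 14)) + 11 * (8 + 12 * v - 28 * v ^ 2 + 2 * v ^ 3 - 9 * v ^ 4 - 2 * v ^ 5 - v ^ 6 + 39 * v ^ 7 + v ^ 8 - 29 * v ^ 9 + 12 * v ^ 10 - 5 * v ^ 11 + 5 * v ^ 15 - 5 * v ^ 16)"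
    by algebra
  from arg_cong[OF this, of mod11] have core: "1 * ((eis_u - 1) ^ 5 * (1 - 2 * eis_u - eis_u ^ 2 + eis_u ^ 3 - eis_u ^ 4 + 4 * eis_u ^ 5 + 4 * eis_u ^ 6)) =
      (9) * (eis_u ^ 11 - 1) + (eis_u - 1) * (40 * h + eis_u * h')"
    unfolding h_def h'_def
    by (simp only: mod11_add mod11_diff mod11_uminus mod11_mult mod11_power mod11_numeral mod11_1 mod11_0 v eleven_mult_eq_0 add_0_right)
  have "(9 :: 11 fps) ^ 11 = 9 + 11 * 2852823600"
    by simp
  then have nine: "(9 :: 11 fps) ^ 11 = 9"
    by (simp only: eleven_mult_eq_0 add_0_right)
  have "(eis_y ^ 2 * (eis_u - 1) * 9) ^ 11 = eis_y ^ 22 * (9 ^ 11 * (eis_u - 1) ^ 11)"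
    by (simp only: power_mult_distrib) (simp add: mult_ac flip: power_mult)
  then have g: "(eis_y ^ 2 * (eis_u - 1) * 9) ^ 11 = eis_y ^ 22 * ((9) * (eis_u ^ 11 - 1))"
    unfolding eis_u_minus_1_power_11 nine .
  have yw: "eis_y ^ 10 * eis_y ^ 12 = eis_y ^ 22"
    by (simp flip: power_add)
  have "eis_y ^ 10 * (eis_u - 1) ^ 5 * (eis_y ^ 12 * (1 - 2 * eis_u - eis_u ^ 2 + eis_u ^ 3 - eis_u ^ 4 + 4 * eis_u ^ 5 + 4 * eis_u ^ 6)) = eis_y ^ 22 * ((eis_u - 1) ^ 5 * (1 - 2 * eis_u - eis_u ^ 2 + eis_u ^ 3 - eis_u ^ 4 + 4 * eis_u ^ 5 + 4 * eis_u ^ 6))"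
    by (simp only: yw[symmetric] mult_ac)
  also have "\<dots> = eis_y ^ 22 * (1 * ((eis_u - 1) ^ 5 * (1 - 2 * eis_u - eis_u ^ 2 + eis_u ^ 3 - eis_u ^ 4 + 4 * eis_u ^ 5 + 4 * eis_u ^ 6)))"
    by simp
  also have "\<dots> = (eis_y ^ 2 * (eis_u - 1) * 9) ^ 11 + qderiv (eis_y ^ 20 * h)"
    unfolding core g H by (simp only: distrib_left)
  finally show ?thesis
    using class6_euler_32 by blast
qed

section \<open>From moments to the class 6 of the double sums\<close>

lemma euler_32_class6_dvd:
  assumes "N mod 11 = 6"
  shows "11 dvd fps_nth (euler_E ^ 32) N"
proof -
  obtain n where n: "N = 11 * n + 6"
    using assms by (metis mult_div_mod_eq)
  have "fps_nth (class6 (mod11 (euler_E ^ 32))) n = 0"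
    by (simp only: mod11_power class6_euler_32_eq_0 fps_zero_nth)
  then have "(of_int (fps_nth (euler_E ^ 32) N) :: 11) = 0"
    by (simp add: mod11_def n)
  then show ?thesis
    by (simp add: of_int_eq_0_iff_char_dvd)
qed

text \<open>\<open>weighted_appell_cong\<close> holds modulo 121, so once the difference of moments
  is written as 11 V, a factor 11 can be divided out.\<close>

lemma class6_weighted_appell:
  assumes a: "odd a" "a \<ge> 3"
    and V: "\<And>N. N mod 11 = 6 \<Longrightarrow> [fps_nth (theta8_moment (a - 1)) N - fps_nth (theta8_moment (a + 9)) N = 11 * fps_nth V N] (mod 121)"
  shows "class6 (mod11 euler_E ^ 32 * mod11 (weighted_appell (\<lambda>m. (m - 6) ^ a))) = class6 (mod11 V)"
proof (rule fps_ext)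
  fix n :: nat
  let ?N = "11 * n + 6" and ?W = "euler_E ^ 32 * weighted_appell (\<lambda>m. (m - 6) ^ a)"
  have N: "?N mod 11 = 6" by presburger
  have "[11 * fps_nth ?W ?N = 11 * fps_nth V ?N] (mod 121)"
    by (rule cong_trans[OF weighted_appell_cong[OF N a euler_32_class6_dvd[OF N]] V[OF N]])
  then have "11 * 11 dvd 11 * (fps_nth ?W ?N - fps_nth V ?N)"
    by (simp add: cong_iff_dvd_diff right_diff_distrib)
  then have "11 dvd fps_nth ?W ?N - fps_nth V ?N"
    by (subst (asm) dvd_mult_cancel_left) simp
  then have "(of_int (fps_nth ?W ?N) :: 11) = of_int (fps_nth V ?N)"
    using of_int_eq_0_iff_char_dvd[of "fps_nth ?W ?N - fps_nth V ?N", where 'a = 11] by simp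
  then have "fps_nth (class6 (mod11 ?W)) n = fps_nth (class6 (mod11 V)) n"
    by (simp only: class6_nth mod11_def fps_nth_Abs_fps)
  then show "fps_nth (class6 (mod11 euler_E ^ 32 * mod11 (weighted_appell (\<lambda>m. (m - 6) ^ a)))) n = fps_nth (class6 (mod11 V)) n"
    by (simp only: mod11_mult mod11_power)
qed

text \<open>Substitute E2 = y^2 (7 + 5 u) and E4 = u y^4 in free variables, then specialize. In the
  higher weights E6 is written as u y^6, which keeps everything homogeneous in y.\<close>

lemma reduce_weight_4: "mod11 (- 2419200 * eisenstein_E2 ^ 2 + 120960 * eisenstein_E4) = eis_y ^ 4 * (- 4 + 3 * eis_u + 2 * eis_u ^ 2)"
proof -
  have "- 2419200 * (Y ^ 2 * (7 + 5 * v)) ^ 2 + 120960 * (v * Y ^ 4) = Y ^ 4 * (- 4 + 3 * v + 2 * v ^ 2) + 11 * (Y ^ 4 * (- 10776436 - 15383913 * v - 5498182 * v ^ 2))" for Y v :: "int fps"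
    by algebra
  from arg_cong[OF this[of eisenstein_E6 "eisenstein_E4 ^ 5"], of mod11] show ?thesis
    by (simp only: mod11_add mod11_diff mod11_uminus mod11_mult mod11_power mod11_numeral mod11_1 mod11_0 eis_u_def[symmetric] eleven_mult_eq_0 add_0_right
      eis_y_u6 eis_E2_u[symmetric] eis_E4_powers(1)[symmetric])
qed

text \<open>The moment of order 2 vanishes, and all coefficients of the moment of order 12 are
  divisible by 11. The exponents 5 and 7 behave in the same way.\<close>

lemma class6_appell_3: "class6 (mod11 euler_E ^ 32 * mod11 (weighted_appell (\<lambda>m. (m - 6) ^ 3))) = mod11 euler_E ^ 16 * 0"
proof -
  define V where "V = - 2419200 * eisenstein_E2 ^ 2 + 120960 * eisenstein_E4"
  have "theta8_moment 12 = - (11 * (euler_E ^ 32 * V))"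
    by (rule theta8_moment_eqI) (unfold theta_moment_12_eq V_def, algebra)
  then have "class6 (mod11 euler_E ^ 32 * mod11 (weighted_appell (\<lambda>m. (m - 6) ^ 3))) = class6 (mod11 (euler_E ^ 32 * V))"
    by (intro class6_weighted_appell) (simp_all add: theta8_moment_low(1) numeral_fps_const)
  then show ?thesis
    unfolding mod11_mult mod11_power V_def reduce_weight_4 class6_weight_4 .
qed

lemma reduce_weight_6: "mod11 (- 48921600 * eisenstein_E2 ^ 3 + 7338240 * eisenstein_E2 * eisenstein_E4 - 349440 * eisenstein_E6) = eis_y ^ 6 * (- 4 + 2 * eis_u + 2 * eis_u ^ 2 + 3 * eis_u ^ 3)"
proof -
  have "- 48921600 * (Y ^ 2 * (7 + 5 * v)) ^ 3 + 7338240 * (Y ^ 2 * (7 + 5 * v)) * (v * Y ^ 4) - 349440 * (v * Y ^ 6) = Y ^ 6 * (- 4 + 2 * v + 2 * v ^ 2 + 3 * v ^ 3) + 11 * (Y ^ 6 * (- 1525464436 - 3264214342 * v - 2331558982 * v ^ 2 - 555927273 * v ^ 3))" for Y v :: "int fps"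
    by algebra
  from arg_cong[OF this[of eisenstein_E6 "eisenstein_E4 ^ 5"], of mod11] show ?thesis
    by (simp only: mod11_add mod11_diff mod11_uminus mod11_mult mod11_power mod11_numeral mod11_1 mod11_0 eis_u_def[symmetric] eleven_mult_eq_0 add_0_right
      eis_y_u6 eis_E2_u[symmetric] eis_E4_powers(1)[symmetric])
qed

lemma class6_appell_5: "class6 (mod11 euler_E ^ 32 * mod11 (weighted_appell (\<lambda>m. (m - 6) ^ 5))) = mod11 euler_E ^ 16 * mod11 eisenstein_E4"
proof -
  define V where "V = - 48921600 * eisenstein_E2 ^ 3 + 7338240 * eisenstein_E2 * eisenstein_E4 - 349440 * eisenstein_E6"
  have "theta8_moment 14 = - (11 * (euler_E ^ 32 * V))"
    by (rule theta8_moment_eqI) (unfold theta_moment_14_eq V_def, algebra)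
  then have "class6 (mod11 euler_E ^ 32 * mod11 (weighted_appell (\<lambda>m. (m - 6) ^ 5))) = class6 (mod11 (euler_E ^ 32 * V))"
    by (intro class6_weighted_appell) (simp_all add: theta8_moment_low(1) numeral_fps_const)
  then show ?thesis
    unfolding mod11_mult mod11_power V_def reduce_weight_6 class6_weight_6 .
qed

lemma reduce_weight_8: "mod11 (- 978432000 * eisenstein_E2 ^ 4 + 293529600 * eisenstein_E2 ^ 2 * eisenstein_E4 - 27955200 * eisenstein_E2 * eisenstein_E6 - 5765760 * eisenstein_E4 ^ 2) = eis_y ^ 8 * (1 + 3 * eis_u + 3 * eis_u ^ 4)"
proof -
  have "- 978432000 * (Y ^ 2 * (7 + 5 * v)) ^ 4 + 293529600 * (Y ^ 2 * (7 + 5 * v)) ^ 2 * (v * Y ^ 4) - 27955200 * (Y ^ 2 * (7 + 5 * v)) * (v * Y ^ 6) - 5765760 * (v * Y ^ 4) ^ 2 = Y ^ 8 * (1 + 3 * v + 3 * v ^ 4) + 11 * (Y ^ 8 * (- 213565021091 - 608896023273 * v - 651915788160 * v ^ 2 - 310652160000 * v ^ 3 - 55592727273 * v ^ 4))" for Y v :: "int fps"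
    by algebra
  from arg_cong[OF this[of eisenstein_E6 "eisenstein_E4 ^ 5"], of mod11] show ?thesis
    by (simp only: mod11_add mod11_diff mod11_uminus mod11_mult mod11_power mod11_numeral mod11_1 mod11_0 eis_u_def[symmetric] eleven_mult_eq_0 add_0_right
      eis_y_u6 eis_E2_u[symmetric] eis_E4_powers(1)[symmetric])
qed

lemma class6_appell_7: "class6 (mod11 euler_E ^ 32 * mod11 (weighted_appell (\<lambda>m. (m - 6) ^ 7))) = mod11 euler_E ^ 16 * (- eis_y)"
proof -
  define V where "V = - 978432000 * eisenstein_E2 ^ 4 + 293529600 * eisenstein_E2 ^ 2 * eisenstein_E4 - 27955200 * eisenstein_E2 * eisenstein_E6 - 5765760 * eisenstein_E4 ^ 2"
  have "theta8_moment 16 = - (11 * (euler_E ^ 32 * V))"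
    by (rule theta8_moment_eqI) (unfold theta_moment_16_eq V_def, algebra)
  then have "class6 (mod11 euler_E ^ 32 * mod11 (weighted_appell (\<lambda>m. (m - 6) ^ 7))) = class6 (mod11 (euler_E ^ 32 * V))"
    by (intro class6_weighted_appell) (simp_all add: theta8_moment_low(1) numeral_fps_const)
  then show ?thesis
    unfolding mod11_mult mod11_power V_def reduce_weight_8 class6_weight_8 .
qed

lemma reduce_weight_10: "mod11 (19960012800 * eisenstein_E2 ^ 5 - 9980006400 * eisenstein_E2 ^ 3 * eisenstein_E4 + 1425715200 * eisenstein_E2 ^ 2 * eisenstein_E6 + 588107520 * eisenstein_E2 * eisenstein_E4 ^ 2) = eis_y ^ 10 * (- 2 + eis_u - 2 * eis_u ^ 3 - eis_u ^ 4 + 2 * eis_u ^ 5)"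
proof -
  have "19960012800 * (Y ^ 2 * (7 + 5 * v)) ^ 5 - 9980006400 * (Y ^ 2 * (7 + 5 * v)) ^ 3 * (v * Y ^ 4) + 1425715200 * (Y ^ 2 * (7 + 5 * v)) ^ 2 * (v * Y ^ 6) + 588107520 * (Y ^ 2 * (7 + 5 * v)) * (v * Y ^ 4) ^ 2 = Y ^ 10 * (- 2 + v - 2 * v ^ 3 - v ^ 4 + 2 * v ^ 5) + 11 * (Y ^ 10 * (30497085011782 + 108613316924509 * v + 154939973610240 * v ^ 2 + 110668169459782 * v ^ 3 + 39579798109091 * v ^ 4 + 5670458181818 * v ^ 5))" for Y v :: "int fps"
    by algebra
  from arg_cong[OF this[of eisenstein_E6 "eisenstein_E4 ^ 5"], of mod11] show ?thesis
    by (simp only: mod11_add mod11_diff mod11_uminus mod11_mult mod11_power mod11_numeral mod11_1 mod11_0 eis_u_def[symmetric] eleven_mult_eq_0 add_0_right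
      eis_y_u6 eis_E2_u[symmetric] eis_E4_powers(1)[symmetric])
qed

text \<open>Write n d^9 = (n/d) d^10. If 11 does not divide n, then d^10 = 1 and the sum of n/d is
  sigma_1(n). If n = 11 k, the left side is 0 and sigma_1(n) = sigma_1(k), since divisors of n that
  do not divide k are multiples of 11.\<close>

lemma qderiv_sigma_9_mod11: "qderiv (mod11 (sigma_series 9)) = mod11 (sigma_series 1) - mod11 (sigma_series 1) ^ 11"
proof (rule fps_ext)
  fix n
  define s where "s j n = (\<Sum>d | d dvd n. (of_int (int d) :: 11) ^ j)" for j n
  have nth: "fps_nth (mod11 (sigma_series j)) n = (if n = 0 then 0 else s j n)" for j n
    by (simp add: mod11_def sigma_series_nth s_def)
  have "of_nat n * s 9 n = s 1 n - (if 11 dvd n then s 1 (n div 11) else 0)" if n: "n > 0"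
  proof (cases "11 dvd n")
    case True
    then obtain k where k: "n = 11 * k" by blast
    have "s 1 n = (\<Sum>d | d dvd k. of_int (int d))"
      unfolding s_def power_one_right
    proof (rule sum.mono_neutral_right)
      show "finite {d. d dvd n}" using n by simp
      show "{d. d dvd k} \<subseteq> {d. d dvd n}" by (auto simp: k)
      show "\<forall>d\<in>{d. d dvd n} - {d. d dvd k}. (of_int (int d) :: 11) = 0"
      proof
        fix d assume d: "d \<in> {d. d dvd n} - {d. d dvd k}"
        have "11 dvd d"
        proof (rule ccontr)
          assume "\<not> 11 dvd d"
          then have "coprime d 11"
            using prime_imp_coprime[of 11 d] by (simp add: coprime_commute)
          then show False
            using d by (simp add: k coprime_dvd_mult_right_iff)
        qed
        then show "(of_int (int d) :: 11) = 0"
          by (simp add: of_nat_eq_0_iff_char_dvd)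
      qed
    qed
    moreover have "(of_nat n :: 11) = 0"
      using True by (simp add: of_nat_eq_0_iff_char_dvd)
    ultimately show ?thesis
      using True by (simp add: s_def k)
  next
    case False
    have "of_nat n * s 9 n = (\<Sum>d | d dvd n. of_nat (n div d) * (of_nat d :: 11) ^ 10)"
      unfolding s_def sum_distrib_left
    proof (rule sum.cong)
      fix d assume "d \<in> {d. d dvd n}"
      then have "(of_nat n :: 11) = of_nat (n div d) * of_nat d"
        by (simp flip: of_nat_mult)
      then show "of_nat n * of_int (int d) ^ 9 = of_nat (n div d) * (of_nat d :: 11) ^ 10"
        by (simp add: eval_nat_numeral mult_ac)
    qed simp
    also have "\<dots> = (\<Sum>d | d dvd n. of_nat (n div d))"
    proof (rule sum.cong)
      fix d assume "d \<in> {d. d dvd n}"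
      then have d: "d dvd n" "\<not> 11 dvd d" using False dvd_trans by auto
      have "[int d ^ 10 = 1] (mod 11)"
      proof -
        have "[int d * int d ^ 10 = int d * 1] (mod 11)"
          using power_11_cong[of "int d"] power_add[of "int d" 1 10] by simp
        moreover have "coprime (int d) 11"
        proof -
          have "coprime d 11"
            using d(2) prime_imp_coprime[of 11 d] by (simp add: coprime_commute)
          then have "coprime (int d) (int 11)"
            by (simp only: coprime_int_iff)
          then show ?thesis by simp
        qed
        ultimately show ?thesis
          using cong_mult_lcancel[of "int d" 11 "int d ^ 10" 1] by blast
      qed
      then have "(of_nat d :: 11) ^ 10 = 1"
        using of_int_eq_0_iff_char_dvd[of "int d ^ 10 - 1", where 'a = 11] by (simp add: cong_iff_dvd_diff)
      then show "of_nat (n div d) * (of_nat d :: 11) ^ 10 = of_nat (n div d)"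
        by simp
    qed simp
    also have "\<dots> = s 1 n"
      unfolding s_def
      by (rule sum.reindex_bij_witness[of _ "\<lambda>d. n div d" "\<lambda>d. n div d"]) (use n in \<open>auto simp: div_div_eq_right dvd_div_eq_0_iff\<close>)
    finally show ?thesis using False by simp
  qed
  then show "fps_nth (qderiv (mod11 (sigma_series 9))) n = fps_nth (mod11 (sigma_series 1) - mod11 (sigma_series 1) ^ 11) n"
    by (cases "n = 0") (auto simp: nth power_11_nth elim!: dvdE)
qed

text \<open>The derivative of sigma_9 is 6 (E2^11 - E2), which has an explicit antiderivative y^20
  h(u). The difference is killed by D, hence an 11th power.\<close>

lemma sigma_9_mod11:
  "\<exists>k. mod11 (sigma_series 9) = eis_y ^ 20 * (5 + 3 * eis_u - eis_u ^ 2 - 2 * eis_u ^ 3 + 4 * eis_u ^ 4 - 3 * eis_u ^ 5 + 4 * eis_u ^ 6 - eis_u ^ 7 + 2 * eis_u ^ 8 - 5 * eis_u ^ 9 + 5 * eis_u ^ 10) + k ^ 11"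
proof -
  define h where "h = 5 + 3 * eis_u - eis_u ^ 2 - 2 * eis_u ^ 3 + 4 * eis_u ^ 4 - 3 * eis_u ^ 5 + 4 * eis_u ^ 6 - eis_u ^ 7 + 2 * eis_u ^ 8 - 5 * eis_u ^ 9 + 5 * eis_u ^ 10"
  define h' where "h' = 3 - 2 * eis_u - 6 * eis_u ^ 2 + 16 * eis_u ^ 3 - 15 * eis_u ^ 4 + 24 * eis_u ^ 5 - 7 * eis_u ^ 6 + 16 * eis_u ^ 7 - 45 * eis_u ^ 8 + 50 * eis_u ^ 9"
  have "qderiv h = h' * qderiv eis_u"
    unfolding h_def h'_def by (simp add: qderiv_mult qderiv_power numeral_mod11_eq_0 algebra_simps)
  then have H: "qderiv (eis_y ^ 20 * h) = eis_y ^ 22 * ((eis_u - 1) * (40 * h + eis_u * h'))"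
    using qderiv_eis_form[of h h' 20] by simp
  define v where "v = eisenstein_E4 ^ 5"
  have v: "mod11 v = eis_u"
    by (simp add: v_def eis_u_def)
  have "(v - 1) * (40 * (5 + 3 * v - v ^ 2 - 2 * v ^ 3 + 4 * v ^ 4 - 3 * v ^ 5 + 4 * v ^ 6 - v ^ 7 + 2 * v ^ 8 - 5 * v ^ 9 + 5 * v ^ 10) + v * (3 - 2 * v - 6 * v ^ 2 + 16 * v ^ 3 - 15 * v ^ 4 + 24 * v ^ 5 - 7 * v ^ 6 + 16 * v ^ 7 - 45 * v ^ 8 + 50 * v ^ 9)) = 6 * (7 + 5 * v ^ 11 - v ^ 4 * (7 + 5 * v)) + 11 * (- 22 + 7 * v + 15 * v ^ 2 + 4 * v ^ 3 - 20 * v ^ 4 + 31 * v ^ 5 - 29 * v ^ 6 + 21 * v ^ 7 - 13 * v ^ 8 + 31 * v ^ 9 - 45 * v ^ 10 + 20 * v ^ 11)"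
    by algebra
  from arg_cong[OF this, of mod11] have core: "(eis_u - 1) * (40 * h + eis_u * h') = 6 * (7 + 5 * eis_u ^ 11 - eis_u ^ 4 * (7 + 5 * eis_u))"
    unfolding h_def h'_def by (simp only: mod11_add mod11_diff mod11_uminus mod11_mult mod11_power mod11_numeral mod11_1 mod11_0 v eleven_mult_eq_0 add_0_right)
  have num: "(7 :: 11 fps) ^ 11 = 7" "(5 :: 11 fps) ^ 11 = 5" "(6 :: 11 fps) ^ 11 = 6"
    by (rule fps_ext; simp add: numeral_fps_const)+
  let ?s = "mod11 (sigma_series 1)" and ?e = "mod11 eisenstein_E2"
  have "?s = 12 * ?s"
    by (simp add: numeral_mod11)
  also have "\<dots> = 24 * (6 * ?s)"
    by (simp add: numeral_mod11)
  also have "\<dots> = 6 * (24 * ?s)" by simp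
  also have "24 * ?s = 1 - ?e"
    using arg_cong[OF eisenstein_E2_def, of mod11] by simp
  finally have s: "?s = 6 * (1 - ?e)" .
  have "?s ^ 11 = 6 * (1 - ?e ^ 11)"
    using frobenius_11[of 1 "- ?e"] unfolding s power_mult_distrib num by simp
  then have "qderiv (mod11 (sigma_series 9)) = 6 * (?e ^ 11 - ?e)"
    unfolding qderiv_sigma_9_mod11 s by (simp add: algebra_simps)
  also have "?e ^ 11 = eis_y ^ 22 * (7 + 5 * eis_u ^ 11)"
    using frobenius_11[of 7 "5 * eis_u"] unfolding eis_E2_u power_mult_distrib num by (simp flip: power_mult)
  also have "?e = eis_y ^ 22 * (eis_u ^ 4 * (7 + 5 * eis_u))"
    unfolding eis_E2_u mult.assoc[symmetric] using eis_y_u[of 4 2] by simp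
  also have "6 * (eis_y ^ 22 * (7 + 5 * eis_u ^ 11) - eis_y ^ 22 * (eis_u ^ 4 * (7 + 5 * eis_u))) = qderiv (eis_y ^ 20 * h)"
    unfolding H core by (simp only: right_diff_distrib mult_ac)
  finally have "qderiv (mod11 (sigma_series 9) - eis_y ^ 20 * h) = 0"
    by simp
  from qderiv_eq_0_imp_power_11[OF this] show ?thesis
    unfolding h_def by (metis add.commute diff_add_cancel)
qed

text \<open>The moment of order 18 has one coefficient prime to 11, at E4 E6 = 1 - 264 sigma_9. Its
  constant part joins the moment of order 8 to a multiple of 11, and 264 supplies a factor 11 for
  the rest. The 11th power inside sigma_9 drops out because the class 6 of E^32 is zero.\<close>

lemma class6_appell_9: "class6 (mod11 euler_E ^ 32 * mod11 (weighted_appell (\<lambda>m. (m - 6) ^ 9))) = mod11 euler_E ^ 16 * (- (3 * mod11 eisenstein_E4 ^ 2))"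
proof -
  define p where "p = 19960012800 * eisenstein_E2 ^ 5 - 9980006400 * eisenstein_E2 ^ 3 * eisenstein_E4 + 1425715200 * eisenstein_E2 ^ 2 * eisenstein_E6 + 588107520 * eisenstein_E2 * eisenstein_E4 ^ 2"
  define V where "V = 61568640 - 16253153280 * sigma_series 9 - p"
  let ?e = "mod11 euler_E ^ 32"
  have "theta8_moment 18 = euler_E ^ 32 * (11 * p - 677214720 * (eisenstein_E4 * eisenstein_E6))"
    by (rule theta8_moment_eqI) (unfold theta_moment_18_eq p_def, algebra)
  \<comment> \<open>The constants are 40320 + 677214720 = 11 * 61568640 and 677214720 * 264 = 11 *
    16253153280.\<close>
  then have "theta8_moment 8 - theta8_moment 18 = 11 * (euler_E ^ 32 * V)"
    unfolding theta8_moment_low(2) eisenstein_E4_E6 V_def by algebra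
  then have m: "fps_nth (theta8_moment 8) N - fps_nth (theta8_moment 18) N = 11 * fps_nth (euler_E ^ 32 * V) N" for N
    by (metis fps_sub_nth fps_mult_left_const_nth numeral_fps_const)
  obtain k where k: "mod11 (sigma_series 9) = eis_y ^ 20 * (5 + 3 * eis_u - eis_u ^ 2 - 2 * eis_u ^ 3 + 4 * eis_u ^ 4 - 3 * eis_u ^ 5 + 4 * eis_u ^ 6 - eis_u ^ 7 + 2 * eis_u ^ 8 - 5 * eis_u ^ 9 + 5 * eis_u ^ 10) + k ^ 11"
    using sigma_9_mod11 by blast
  define v where "v = eisenstein_E4 ^ 5"
  have v: "mod11 v = eis_u"
    by (simp add: v_def eis_u_def)
  have "- (16253153280 * (5 + 3 * v - v ^ 2 - 2 * v ^ 3 + 4 * v ^ 4 - 3 * v ^ 5 + 4 * v ^ 6 - v ^ 7 + 2 * v ^ 8 - 5 * v ^ 9 + 5 * v ^ 10)) - v ^ 2 * (- 2 + v - 2 * v ^ 3 - v ^ 4 + 2 * v ^ 5) = (- 5 - 3 * v + 3 * v ^ 2 + v ^ 3 - 4 * v ^ 4 + 5 * v ^ 5 - 3 * v ^ 6 - v ^ 7 - 2 * v ^ 8 + 5 * v ^ 9 - 5 * v ^ 10) + 11 * (- 7387796945 - 4432678167 * v + 1477559389 * v ^ 2 + 2955118778 * v ^ 3 - 5910237556 * v ^ 4 + 4432678167 * v ^ 5 - 5910237556 * v ^ 6 + 1477559389 * v ^ 7 - 2955118778 * v ^ 8 + 7387796945 * v ^ 9 - 7387796945 * v ^ 10)"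
    by algebra
  from arg_cong[OF this, of mod11] have core: "- (16253153280 * (5 + 3 * eis_u - eis_u ^ 2 - 2 * eis_u ^ 3 + 4 * eis_u ^ 4 - 3 * eis_u ^ 5 + 4 * eis_u ^ 6 - eis_u ^ 7 + 2 * eis_u ^ 8 - 5 * eis_u ^ 9 + 5 * eis_u ^ 10)) - eis_u ^ 2 * (- 2 + eis_u - 2 * eis_u ^ 3 - eis_u ^ 4 + 2 * eis_u ^ 5) = - 5 - 3 * eis_u + 3 * eis_u ^ 2 + eis_u ^ 3 - 4 * eis_u ^ 4 + 5 * eis_u ^ 5 - 3 * eis_u ^ 6 - eis_u ^ 7 - 2 * eis_u ^ 8 + 5 * eis_u ^ 9 - 5 * eis_u ^ 10"
    by (simp only: mod11_add mod11_diff mod11_uminus mod11_mult mod11_power mod11_numeral mod11_1 mod11_0 v eleven_mult_eq_0 add_0_right)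
  have "mod11 V = 61568640 - 16253153280 * mod11 (sigma_series 9) - mod11 p"
    by (simp add: V_def)
  also have "\<dots> = 61568640 - 16253153280 * (eis_y ^ 20 * (5 + 3 * eis_u - eis_u ^ 2 - 2 * eis_u ^ 3 + 4 * eis_u ^ 4 - 3 * eis_u ^ 5 + 4 * eis_u ^ 6 - eis_u ^ 7 + 2 * eis_u ^ 8 - 5 * eis_u ^ 9 + 5 * eis_u ^ 10)) - eis_y ^ 20 * eis_u ^ 2 * (- 2 + eis_u - 2 * eis_u ^ 3 - eis_u ^ 4 + 2 * eis_u ^ 5) - 16253153280 * k ^ 11"
    unfolding p_def reduce_weight_10 k using eis_y_u[of 2 10] by (simp add: distrib_left)
  also have "\<dots> = eis_y ^ 20 * (- (16253153280 * (5 + 3 * eis_u - eis_u ^ 2 - 2 * eis_u ^ 3 + 4 * eis_u ^ 4 - 3 * eis_u ^ 5 + 4 * eis_u ^ 6 - eis_u ^ 7 + 2 * eis_u ^ 8 - 5 * eis_u ^ 9 + 5 * eis_u ^ 10)) - eis_u ^ 2 * (- 2 + eis_u - 2 * eis_u ^ 3 - eis_u ^ 4 + 2 * eis_u ^ 5)) + 61568640 - 16253153280 * k ^ 11"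
    by (simp only: right_diff_distrib mult_minus_right mult_ac add_diff_eq diff_add_eq add_uminus_conv_diff uminus_add_conv_diff)
  finally have V: "mod11 V = eis_y ^ 20 * (- 5 - 3 * eis_u + 3 * eis_u ^ 2 + eis_u ^ 3 - 4 * eis_u ^ 4 + 5 * eis_u ^ 5 - 3 * eis_u ^ 6 - eis_u ^ 7 - 2 * eis_u ^ 8 + 5 * eis_u ^ 9 - 5 * eis_u ^ 10) + 61568640 - 16253153280 * k ^ 11"
    unfolding core .
  have "class6 (?e * mod11 (weighted_appell (\<lambda>m. (m - 6) ^ 9))) = class6 (mod11 (euler_E ^ 32 * V))"
    by (rule class6_weighted_appell) (simp_all add: m)
  also have "mod11 (euler_E ^ 32 * V) = ?e * (eis_y ^ 20 * (- 5 - 3 * eis_u + 3 * eis_u ^ 2 + eis_u ^ 3 - 4 * eis_u ^ 4 + 5 * eis_u ^ 5 - 3 * eis_u ^ 6 - eis_u ^ 7 - 2 * eis_u ^ 8 + 5 * eis_u ^ 9 - 5 * eis_u ^ 10)) + 61568640 * ?e - 16253153280 * (?e * k ^ 11)"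
    by (simp only: mod11_mult mod11_power V right_diff_distrib distrib_left mult_ac)
  also have "class6 \<dots> = class6 (?e * (eis_y ^ 20 * (- 5 - 3 * eis_u + 3 * eis_u ^ 2 + eis_u ^ 3 - 4 * eis_u ^ 4 + 5 * eis_u ^ 5 - 3 * eis_u ^ 6 - eis_u ^ 7 - 2 * eis_u ^ 8 + 5 * eis_u ^ 9 - 5 * eis_u ^ 10))) + 61568640 * class6 ?e - 16253153280 * (class6 ?e * k)"
    by (simp only: class6_linear class6_mult_power_11)
  finally show ?thesis
    unfolding class6_euler_32_eq_0 class6_weight_10 by simp
qed

lemma reduce_weight_12: "mod11 (- 421378048000 * eisenstein_E2 ^ 6 + 316033536000 * eisenstein_E2 ^ 4 * eisenstein_E4 - 60196864000 * eisenstein_E2 ^ 3 * eisenstein_E6 - 37246809600 * eisenstein_E2 ^ 2 * eisenstein_E4 ^ 2 + 2131489920 * eisenstein_E4 ^ 3 + 1012928000 * eisenstein_E6 ^ 2) = eis_y ^ 12 * (1 - 2 * eis_u - eis_u ^ 2 + eis_u ^ 3 - eis_u ^ 4 + 4 * eis_u ^ 5 + 4 * eis_u ^ 6)"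
proof -
  have "- 421378048000 * (Y ^ 2 * (7 + 5 * v)) ^ 6 + 316033536000 * (Y ^ 2 * (7 + 5 * v)) ^ 4 * (v * Y ^ 4) - 60196864000 * (Y ^ 2 * (7 + 5 * v)) ^ 3 * (v * Y ^ 6) - 37246809600 * (Y ^ 2 * (7 + 5 * v)) ^ 2 * (v * Y ^ 4) ^ 2 + 2131489920 * (v * Y ^ 4) ^ 3 + 1012928000 * (v * Y ^ 6) ^ 2 = Y ^ 12 * (1 - 2 * v - v ^ 2 + v ^ 3 - v ^ 4 + 4 * v ^ 5 + 4 * v ^ 6) + 11 * (Y ^ 12 * (- 4506791451741091 - 19247716053317818 * v - 34297848971529309 * v ^ 2 - 32640276197198371 * v ^ 3 - 17497534472930909 * v ^ 4 - 5009849803636364 * v ^ 5 - 598548363636364 * v ^ 6))" for Y v :: "int fps"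
    by algebra
  from arg_cong[OF this[of eisenstein_E6 "eisenstein_E4 ^ 5"], of mod11] show ?thesis
    by (simp only: mod11_add mod11_diff mod11_uminus mod11_mult mod11_power mod11_numeral mod11_1 mod11_0 eis_u_def[symmetric] eleven_mult_eq_0 add_0_right
      eis_y_u6 eis_E2_u[symmetric] eis_E4_powers(1)[symmetric])
qed

text \<open>The parts of the moments of orders 10 and 20 not divisible by 11 are images of (24 D +
  32). At indices 6 modulo 11 this operator multiplies by a multiple of 11, and the series it is
  applied to have coefficients divisible by 11 there, so these parts vanish modulo 121.\<close>

lemma class6_appell_11: "class6 (mod11 euler_E ^ 32 * mod11 (weighted_appell (\<lambda>m. (m - 6) ^ 11))) = mod11 euler_E ^ 16 * 9"
proof -
  define V where "V = - 421378048000 * eisenstein_E2 ^ 6 + 316033536000 * eisenstein_E2 ^ 4 * eisenstein_E4 - 60196864000 * eisenstein_E2 ^ 3 * eisenstein_E6 - 37246809600 * eisenstein_E2 ^ 2 * eisenstein_E4 ^ 2 + 2131489920 * eisenstein_E4 ^ 3 + 1012928000 * eisenstein_E6 ^ 2"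
  define d where "d f = qderiv24 f + 32 * f" for f
  have p32: "euler_E ^ 32 = euler_E ^ 31 * euler_E"
    using power_add[of euler_E 31 1] by simp
  have dE: "qderiv24 (euler_E ^ 32) = 32 * (eisenstein_E2 - 1) * euler_E ^ 32"
    unfolding p32 qderiv24_simps(6) by (simp add: qderiv24_E eval_nat_numeral algebra_simps)
  have m20: "theta8_moment 20 = euler_E ^ 32 * (4635158528000 * eisenstein_E2 ^ 6 - 3476368896000 * eisenstein_E2 ^ 4 * eisenstein_E4 + 662165504000 * eisenstein_E2 ^ 3 * eisenstein_E6 + 409714905600 * eisenstein_E2 ^ 2 * eisenstein_E4 ^ 2 - 85780531200 * eisenstein_E2 * eisenstein_E4 * eisenstein_E6 - 3650881920 * eisenstein_E4 ^ 3 + 2054796800 * eisenstein_E6 ^ 2)"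
    by (rule theta8_moment_eqI) (unfold theta_moment_20_eq, algebra)
  \<comment> \<open>Since d(E^32) = 32 E2 E^32, the first constant is 1209600 / 32. In d(E^32 E4 E6)
    the term E2 E4 E6 has coefficient 32 + 20, so the second is 85780531200 / 52.\<close>
  have "theta8_moment 10 - theta8_moment 20 = 37800 * d (euler_E ^ 32) + 1649625600 * d (euler_E ^ 32 * (eisenstein_E4 * eisenstein_E6)) + 11 * (euler_E ^ 32 * V)"
    unfolding theta8_moment_low(3) m20 V_def d_def qderiv24_simps(6) dE qderiv24_E by algebra
  then have m: "fps_nth (theta8_moment 10) N - fps_nth (theta8_moment 20) N = 37800 * fps_nth (d (euler_E ^ 32)) N
      + 1649625600 * fps_nth (d (euler_E ^ 32 * (eisenstein_E4 * eisenstein_E6))) N + 11 * fps_nth (euler_E ^ 32 * V) N" for N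
    by (metis (no_types, lifting) fps_sub_nth fps_add_nth fps_mult_left_const_nth numeral_fps_const)
  have d: "121 dvd fps_nth (d f) N" if N: "N mod 11 = 6" and f: "11 dvd fps_nth f N" for f N
  proof -
    obtain n where n: "N = 11 * n + 6"
      using N by (metis mult_div_mod_eq)
    have "fps_nth (d f) N = (24 * int N + 32) * fps_nth f N"
      by (simp add: d_def qderiv24_def numeral_fps_const algebra_simps)
    also have "24 * int N + 32 = 11 * (24 * int n + 16)"
      by (simp add: n)
    finally have "fps_nth (d f) N = 11 * (24 * int n + 16) * fps_nth f N" .
    moreover have "11 * 11 dvd 11 * (24 * int n + 16) * fps_nth f N"
      using f by (intro mult_dvd_mono) auto
    ultimately show ?thesis by simp
  qed
  have E4E6: "11 dvd fps_nth (euler_E ^ 32 * (eisenstein_E4 * eisenstein_E6)) N" if N: "N mod 11 = 6" for N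
  proof -
    have "euler_E ^ 32 * (eisenstein_E4 * eisenstein_E6) = euler_E ^ 32 - 11 * (24 * (euler_E ^ 32 * sigma_series 9))"
      unfolding eisenstein_E4_E6 by (simp add: algebra_simps)
    then have "fps_nth (euler_E ^ 32 * (eisenstein_E4 * eisenstein_E6)) N = fps_nth (euler_E ^ 32) N - 11 * fps_nth (24 * (euler_E ^ 32 * sigma_series 9)) N"
      by (metis fps_sub_nth fps_mult_left_const_nth numeral_fps_const)
    then show ?thesis
      using euler_32_class6_dvd[OF N] by simp
  qed
  have "[fps_nth (theta8_moment 10) N - fps_nth (theta8_moment 20) N = 11 * fps_nth (euler_E ^ 32 * V) N] (mod 121)" if N: "N mod 11 = 6" for N
    using d[OF N euler_32_class6_dvd[OF N]] d[OF N E4E6[OF N]] unfolding m cong_iff_dvd_diff by simp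
  then have "class6 (mod11 euler_E ^ 32 * mod11 (weighted_appell (\<lambda>m. (m - 6) ^ 11))) = class6 (mod11 (euler_E ^ 32 * V))"
    by (intro class6_weighted_appell) simp_all
  then show ?thesis
    unfolding mod11_mult mod11_power V_def reduce_weight_12 class6_weight_12 .
qed

section \<open>Assembling the rank moments\<close>

lemma weighted_appell_mod11:
  assumes "\<And>m. [w m = c3 * (m - 6) ^ 3 + c5 * (m - 6) ^ 5 + c7 * (m - 6) ^ 7 + c9 * (m - 6) ^ 9 + c11 * (m - 6) ^ 11] (mod 11)"
  shows "mod11 (weighted_appell w) = fps_const (of_int c3) * mod11 (weighted_appell (\<lambda>m. (m - 6) ^ 3))
     + fps_const (of_int c5) * mod11 (weighted_appell (\<lambda>m. (m - 6) ^ 5)) + fps_const (of_int c7) * mod11 (weighted_appell (\<lambda>m. (m - 6) ^ 7))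
     + fps_const (of_int c9) * mod11 (weighted_appell (\<lambda>m. (m - 6) ^ 9)) + fps_const (of_int c11) * mod11 (weighted_appell (\<lambda>m. (m - 6) ^ 11))"
proof (rule fps_ext)
  fix N
  let ?w = "\<lambda>m. c3 * (m - 6) ^ 3 + c5 * (m - 6) ^ 5 + c7 * (m - 6) ^ 7 + c9 * (m - 6) ^ 9 + c11 * (m - 6) ^ 11 :: int"
  have "(of_int (w m) :: 11) = of_int (?w m)" for m
    using of_int_eq_0_iff_char_dvd[of "w m - ?w m", where 'a = 11] assms[of m]
    by (simp only: cong_iff_dvd_diff of_int_diff right_minus_eq) simp
  then have "fps_nth (mod11 (weighted_appell w)) N = (\<Sum>m=1..N. of_int (?w (int m)) * of_int (fps_nth (appell_coeff m) N))"
    by (simp only: mod11_def weighted_appell_def fps_nth_Abs_fps of_int_sum of_int_mult)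
  then show "fps_nth (mod11 (weighted_appell w)) N = fps_nth (fps_const (of_int c3) * mod11 (weighted_appell (\<lambda>m. (m - 6) ^ 3))
     + fps_const (of_int c5) * mod11 (weighted_appell (\<lambda>m. (m - 6) ^ 5)) + fps_const (of_int c7) * mod11 (weighted_appell (\<lambda>m. (m - 6) ^ 7))
     + fps_const (of_int c9) * mod11 (weighted_appell (\<lambda>m. (m - 6) ^ 9)) + fps_const (of_int c11) * mod11 (weighted_appell (\<lambda>m. (m - 6) ^ 11))) N"
    by (simp add: mod11_def weighted_appell_def sum_distrib_left sum.distrib distrib_right mult.assoc)
qed

lemma class6_fps_const_mult: "class6 (fps_const c * f) = fps_const c * class6 f"
  by (rule fps_ext) simp

text \<open>Multiplying P times the double sum by (E^3)^11 gives E^32 times the double sum, whose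
  class 6 is E^16 times a combination of the values found for each exponent. Taking E^3 back out
  leaves E^13.\<close>

lemma rank_moment_class6:
  assumes k: "even k" "k > 0"
    and w: "\<And>m. [m ^ k - (m - 1) ^ k = c3 * (m - 6) ^ 3 + c5 * (m - 6) ^ 5 + c7 * (m - 6) ^ 7 + c9 * (m - 6) ^ 9 + c11 * (m - 6) ^ 11] (mod 11)"
  shows "mod11 (Abs_fps (\<lambda>n. rank_moment k (11 * n + 6))) = mod11 euler_E ^ 13 *
    (2 * (fps_const (of_int c5) * mod11 eisenstein_E4 - fps_const (of_int c7) * mod11 eisenstein_E6
      - fps_const (of_int c9) * (3 * mod11 eisenstein_E4 ^ 2) + fps_const (of_int c11) * 9))"
proof -
  let ?e = "mod11 euler_E" and ?p = "mod11 partition_series"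
  let ?Z = "mod11 (weighted_appell (\<lambda>m. m ^ k - (m - 1) ^ k))"
  let ?g = "fps_const (of_int c5) * mod11 eisenstein_E4 - fps_const (of_int c7) * mod11 eisenstein_E6
      - fps_const (of_int c9) * (3 * mod11 eisenstein_E4 ^ 2) + fps_const (of_int c11) * 9"
  have pe: "?p * ?e = 1"
    using arg_cong[OF partition_series_euler_E, of mod11] by simp
  have Z: "class6 (?e ^ 32 * ?Z) = ?e ^ 16 * ?g"
  proof -
    have l: "?e ^ 32 * (fps_const c * f) = fps_const c * (?e ^ 32 * f)" for c f
      by (rule mult.left_commute)
    show ?thesis
      unfolding weighted_appell_mod11[OF w] distrib_left l class6_linear class6_fps_const_mult
        class6_appell_3 class6_appell_5 class6_appell_7 class6_appell_9 class6_appell_11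
      by (simp add: algebra_simps)
  qed
  have "mod11 (Abs_fps (rank_moment k)) = 2 * (?p * ?Z)"
    unfolding rank_moment_series[OF k] by (simp add: mult.assoc)
  moreover have "mod11 (Abs_fps (\<lambda>n. rank_moment k (11 * n + 6))) = class6 (mod11 (Abs_fps (rank_moment k)))"
    by (rule fps_ext) (simp add: mod11_def)
  ultimately have N: "mod11 (Abs_fps (\<lambda>n. rank_moment k (11 * n + 6))) = 2 * class6 (?p * ?Z)"
    by simp
  have "class6 (?p * ?Z) * ?e ^ 3 = class6 (?p * ?Z * (?e ^ 3) ^ 11)"
    by (simp only: class6_mult_power_11)
  also have "?p * ?Z * (?e ^ 3) ^ 11 = (?p * ?e) * (?e ^ 32 * ?Z)"
    using power_add[of ?e 1 32] by (simp add: mult_ac flip: power_mult)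
  also have "class6 \<dots> = ?e ^ 16 * ?g"
    by (simp only: pe mult_1_left Z)
  finally have "class6 (?p * ?Z) * ?e ^ 3 * ?p ^ 3 = ?e ^ (13 + 3) * ?g * ?p ^ 3"
    by simp
  then have "class6 (?p * ?Z) * (?p * ?e) ^ 3 = ?e ^ 13 * (?p * ?e) ^ 3 * ?g"
    by (simp only: power_mult_distrib power_add mult_ac)
  then have "class6 (?p * ?Z) = ?e ^ 13 * ?g"
    by (simp only: pe power_one mult_1_right)
  then show ?thesis
    unfolding N by (simp only: mult.left_commute)
qed

theorem theorem5p1:
  shows
    "fps_cong 11 (Abs_fps (\<lambda>n. rank_moment 2 (11 * n + 6)))
       (3 * euler_E ^ 13) \<and>
     fps_cong 11 (Abs_fps (\<lambda>n. rank_moment 4 (11 * n + 6)))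
       (7 * euler_E ^ 13) \<and>
     fps_cong 11 (Abs_fps (\<lambda>n. rank_moment 6 (11 * n + 6)))
       (euler_E ^ 13 * (4 + eisenstein_E4)) \<and>
     fps_cong 11 (Abs_fps (\<lambda>n. rank_moment 8 (11 * n + 6)))
       (euler_E ^ 13 * (5 + 6 * eisenstein_E4 + 6 * eisenstein_E6)) \<and>
     fps_cong 11 (Abs_fps (\<lambda>n. rank_moment 10 (11 * n + 6)))
       (euler_E ^ 13 * (5 + 4 * eisenstein_E4 + 6 * eisenstein_E6 + 6 * eisenstein_E4 ^ 2))"
proof -
  \<comment> \<open>With x = m - 6, m - 1 = x + 5 is x - 6 modulo 11, so for even k the weight is (x
    + 6)^k - (x - 6)^k, an odd polynomial. Its linear term is carried as x^11, equal to x by Fermat,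
    because \<open>class6_weighted_appell\<close> requires exponents of at least 3.\<close>
  have w2: "[m ^ 2 - (m - 1) ^ 2 = 0 * (m - 6) ^ 3 + 0 * (m - 6) ^ 5 + 0 * (m - 6) ^ 7 + 0 * (m - 6) ^ 9 + 2 * (m - 6) ^ 11] (mod 11)" for m :: int
  proof -
    have eq: "(x + 6) ^ 2 - ((x + 6) - 1) ^ 2 = 0 * x ^ 3 + 0 * x ^ 5 + 0 * x ^ 7 + 0 * x ^ 9 + 2 * x + 11 * (1)" for x :: int
      by algebra
    have "[2 * (m - 6) = 2 * (m - 6) ^ 11] (mod 11)"
      by (intro cong_mult cong_refl cong_sym[OF power_11_cong])
    then have "[0 * (m - 6) ^ 3 + 0 * (m - 6) ^ 5 + 0 * (m - 6) ^ 7 + 0 * (m - 6) ^ 9 + 2 * (m - 6) + 11 * (1)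
        = 0 * (m - 6) ^ 3 + 0 * (m - 6) ^ 5 + 0 * (m - 6) ^ 7 + 0 * (m - 6) ^ 9 + 2 * (m - 6) ^ 11 + 0] (mod 11)"
      by (intro cong_add cong_refl) (auto simp: cong_0_iff)
    then show ?thesis
      using eq[of "m - 6"] by (simp only: diff_add_cancel add_0_right)
  qed
  have w4: "[m ^ 4 - (m - 1) ^ 4 = 4 * (m - 6) ^ 3 + 0 * (m - 6) ^ 5 + 0 * (m - 6) ^ 7 + 0 * (m - 6) ^ 9 + 1 * (m - 6) ^ 11] (mod 11)" for m :: int
  proof -
    have eq: "(x + 6) ^ 4 - ((x + 6) - 1) ^ 4 = 4 * x ^ 3 + 0 * x ^ 5 + 0 * x ^ 7 + 0 * x ^ 9 + 1 * x + 11 * (61 + 33 * x + 6 * x ^ 2)" for x :: int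
      by algebra
    have "[1 * (m - 6) = 1 * (m - 6) ^ 11] (mod 11)"
      by (intro cong_mult cong_refl cong_sym[OF power_11_cong])
    then have "[4 * (m - 6) ^ 3 + 0 * (m - 6) ^ 5 + 0 * (m - 6) ^ 7 + 0 * (m - 6) ^ 9 + 1 * (m - 6) + 11 * (61 + 33 * (m - 6) + 6 * (m - 6) ^ 2)
        = 4 * (m - 6) ^ 3 + 0 * (m - 6) ^ 5 + 0 * (m - 6) ^ 7 + 0 * (m - 6) ^ 9 + 1 * (m - 6) ^ 11 + 0] (mod 11)"
      by (intro cong_add cong_refl) (auto simp: cong_0_iff)
    then show ?thesis
      using eq[of "m - 6"] by (simp only: diff_add_cancel add_0_right)
  qed
  have w6: "[m ^ 6 - (m - 1) ^ 6 = 5 * (m - 6) ^ 3 + 6 * (m - 6) ^ 5 + 0 * (m - 6) ^ 7 + 0 * (m - 6) ^ 9 + 10 * (m - 6) ^ 11] (mod 11)" for m :: int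
  proof -
    have eq: "(x + 6) ^ 6 - ((x + 6) - 1) ^ 6 = 5 * x ^ 3 + 6 * x ^ 5 + 0 * x ^ 7 + 0 * x ^ 9 + 10 * x + 11 * (2821 + 2536 * x + 915 * x ^ 2 + 165 * x ^ 3 + 15 * x ^ 4)" for x :: int
      by algebra
    have "[10 * (m - 6) = 10 * (m - 6) ^ 11] (mod 11)"
      by (intro cong_mult cong_refl cong_sym[OF power_11_cong])
    then have "[5 * (m - 6) ^ 3 + 6 * (m - 6) ^ 5 + 0 * (m - 6) ^ 7 + 0 * (m - 6) ^ 9 + 10 * (m - 6) + 11 * (2821 + 2536 * (m - 6) + 915 * (m - 6) ^ 2 + 165 * (m - 6) ^ 3 + 15 * (m - 6) ^ 4)
        = 5 * (m - 6) ^ 3 + 6 * (m - 6) ^ 5 + 0 * (m - 6) ^ 7 + 0 * (m - 6) ^ 9 + 10 * (m - 6) ^ 11 + 0] (mod 11)"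
      by (intro cong_add cong_refl) (auto simp: cong_0_iff)
    then show ?thesis
      using eq[of "m - 6"] by (simp only: diff_add_cancel add_0_right)
  qed
  have w8: "[m ^ 8 - (m - 1) ^ 8 = 9 * (m - 6) ^ 3 + 3 * (m - 6) ^ 5 + 8 * (m - 6) ^ 7 + 0 * (m - 6) ^ 9 + 7 * (m - 6) ^ 11] (mod 11)" for m :: int
  proof -
    have eq: "(x + 6) ^ 8 - ((x + 6) - 1) ^ 8 = 9 * x ^ 3 + 3 * x ^ 5 + 8 * x ^ 7 + 0 * x ^ 9 + 7 * x + 11 * (117181 + 146771 * x + 78988 * x ^ 2 + 23677 * x ^ 3 + 4270 * x ^ 4 + 463 * x ^ 5 + 28 * x ^ 6)" for x :: int
      by algebra
    have "[7 * (m - 6) = 7 * (m - 6) ^ 11] (mod 11)"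
      by (intro cong_mult cong_refl cong_sym[OF power_11_cong])
    then have "[9 * (m - 6) ^ 3 + 3 * (m - 6) ^ 5 + 8 * (m - 6) ^ 7 + 0 * (m - 6) ^ 9 + 7 * (m - 6) + 11 * (117181 + 146771 * (m - 6) + 78988 * (m - 6) ^ 2 + 23677 * (m - 6) ^ 3 + 4270 * (m - 6) ^ 4 + 463 * (m - 6) ^ 5 + 28 * (m - 6) ^ 6)
        = 9 * (m - 6) ^ 3 + 3 * (m - 6) ^ 5 + 8 * (m - 6) ^ 7 + 0 * (m - 6) ^ 9 + 7 * (m - 6) ^ 11 + 0] (mod 11)"
      by (intro cong_add cong_refl) (auto simp: cong_0_iff)
    then show ?thesis
      using eq[of "m - 6"] by (simp only: diff_add_cancel add_0_right)
  qed
  have w10: "[m ^ 10 - (m - 1) ^ 10 = 6 * (m - 6) ^ 3 + 2 * (m - 6) ^ 5 + 8 * (m - 6) ^ 7 + 10 * (m - 6) ^ 9 + 7 * (m - 6) ^ 11] (mod 11)" for m :: int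
  proof -
    have eq: "(x + 6) ^ 10 - ((x + 6) - 1) ^ 10 = 6 * x ^ 3 + 2 * x ^ 5 + 8 * x ^ 7 + 10 * x ^ 9 + 7 * x + 11 * (4609141 + 7385973 * x + 5273145 * x ^ 2 + 2201574 * x ^ 3 + 592410 * x ^ 4 + 106550 * x ^ 5 + 12810 * x ^ 6 + 992 * x ^ 7 + 45 * x ^ 8)" for x :: int
      by algebra
    have "[7 * (m - 6) = 7 * (m - 6) ^ 11] (mod 11)"
      by (intro cong_mult cong_refl cong_sym[OF power_11_cong])
    then have "[6 * (m - 6) ^ 3 + 2 * (m - 6) ^ 5 + 8 * (m - 6) ^ 7 + 10 * (m - 6) ^ 9 + 7 * (m - 6) + 11 * (4609141 + 7385973 * (m - 6) + 5273145 * (m - 6) ^ 2 + 2201574 * (m - 6) ^ 3 + 592410 * (m - 6) ^ 4 + 106550 * (m - 6) ^ 5 + 12810 * (m - 6) ^ 6 + 992 * (m - 6) ^ 7 + 45 * (m - 6) ^ 8)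
        = 6 * (m - 6) ^ 3 + 2 * (m - 6) ^ 5 + 8 * (m - 6) ^ 7 + 10 * (m - 6) ^ 9 + 7 * (m - 6) ^ 11 + 0] (mod 11)"
      by (intro cong_add cong_refl) (auto simp: cong_0_iff)
    then show ?thesis
      using eq[of "m - 6"] by (simp only: diff_add_cancel add_0_right)
  qed
  have numerals: "(18 :: 11 fps) = 7" "(36 :: 11 fps) = 3" "(12 :: 11 fps) = 1" "(14 :: 11 fps) = 3"
    "(15 :: 11 fps) = 4" "(16 :: 11 fps) = 5" "(126 :: 11 fps) = 5" "(180 :: 11 fps) = 4" "(60 :: 11 fps) = 5" "(- 5 :: 11 fps) = 6"
    by (rule fps_ext; simp add: numeral_fps_const)+
  let ?x = "mod11 eisenstein_E4"
  have c: "fps_const (of_int (numeral w)) = (numeral w :: 11 fps)" "fps_const (of_int 0) = (0 :: 11 fps)" "fps_const (of_int 1) = (1 :: 11 fps)" for w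
    by (simp_all add: numeral_fps_const)
  have "2 * (0 * ?x - 0 * eis_y - 0 * (3 * ?x ^ 2) + 2 * 9) = 36"
    by simp
  also have "\<dots> = 3"
    by (simp only: numerals mult_1_left)
  finally have r2: "mod11 (Abs_fps (\<lambda>n. rank_moment 2 (11 * n + 6))) = mod11 euler_E ^ 13 * (3)"
    using rank_moment_class6[of 2, OF _ _ w2] by (simp only: c even_numeral zero_less_numeral simp_thms True_implies_equals)
  have "2 * (0 * ?x - 0 * eis_y - 0 * (3 * ?x ^ 2) + 1 * 9) = 18"
    by simp
  also have "\<dots> = 7"
    by (simp only: numerals mult_1_left)
  finally have r4: "mod11 (Abs_fps (\<lambda>n. rank_moment 4 (11 * n + 6))) = mod11 euler_E ^ 13 * (7)"
    using rank_moment_class6[of 4, OF _ _ w4] by (simp only: c even_numeral zero_less_numeral simp_thms True_implies_equals)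
  have "2 * (6 * ?x - 0 * eis_y - 0 * (3 * ?x ^ 2) + 10 * 9) = 180 + 12 * ?x"
    by simp
  also have "\<dots> = 4 + ?x"
    by (simp only: numerals mult_1_left)
  finally have r6: "mod11 (Abs_fps (\<lambda>n. rank_moment 6 (11 * n + 6))) = mod11 euler_E ^ 13 * (4 + ?x)"
    using rank_moment_class6[of 6, OF _ _ w6] by (simp only: c even_numeral zero_less_numeral simp_thms True_implies_equals)
  have "2 * (3 * ?x - 8 * eis_y - 0 * (3 * ?x ^ 2) + 7 * 9) = 126 + 6 * ?x + (- 16) * eis_y"
    by simp
  also have "\<dots> = 5 + 6 * ?x + 6 * eis_y"
    by (simp only: numerals mult_1_left)
  finally have r8: "mod11 (Abs_fps (\<lambda>n. rank_moment 8 (11 * n + 6))) = mod11 euler_E ^ 13 * (5 + 6 * ?x + 6 * eis_y)"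
    using rank_moment_class6[of 8, OF _ _ w8] by (simp only: c even_numeral zero_less_numeral simp_thms True_implies_equals)
  have "2 * (2 * ?x - 8 * eis_y - 10 * (3 * ?x ^ 2) + 7 * 9) = 126 + 4 * ?x + (- 16) * eis_y + (- 60) * ?x ^ 2"
    by simp
  also have "\<dots> = 5 + 4 * ?x + 6 * eis_y + 6 * ?x ^ 2"
    by (simp only: numerals mult_1_left)
  finally have r10: "mod11 (Abs_fps (\<lambda>n. rank_moment 10 (11 * n + 6))) = mod11 euler_E ^ 13 * (5 + 4 * ?x + 6 * eis_y + 6 * ?x ^ 2)"
    using rank_moment_class6[of 10, OF _ _ w10] by (simp only: c even_numeral zero_less_numeral simp_thms True_implies_equals)
  show ?thesis
    by (simp only: fps_cong_11_iff mod11_add mod11_mult mod11_power mod11_numeral r2 r4 r6 r8 r10)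
      (simp add: mult.commute)
qed

end
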